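(* The Bargmann transform $\mathfrak{B}$ is a unitary operator from $\mathcal{H}$ onto $\mathcal{B}_1$. Thus, the system $$\left\{\sqrt{\frac{\pi}{2^{n-\frac12}\,n!\left(n+2\pi+\frac12\right)}}\;H_n(\sqrt{2\pi}x)e^{-\pi x^2},\ n\ge 0\right\}$$ forms an orthonormal basis of $\mathcal{H}$.
   Context: The Fourier transform is $\hat f(t)=\int_{\mathbb{R}} f(x)e^{-2\pi i t x}\,dx$. The Fourier symmetric Sobolev space $\mathcal{H}$ is the Hilbert space of functions $f$ on $\mathbb{R}$ with $$\|f\|_{\mathcal{H}}^2=\int_{\mathbb{R}}|f(x)|^2(1+x^2)\,dx+\int_{\mathbb{R}}|\hat f(\xi)|^2(1+\xi^2)\,d\xi<\infty,$$ with the corresponding inner product. The Bargmann transform is $$(\mathfrak{B}f)(z)=\frac{2^{1/4}}{\pi^{3/2}}\int_{\mathbb{R}} f\!\left(\frac{t}{\sqrt{2\pi}}\right)e^{2tz-z^2-t^2/2}\,dt,\qquad z\in\mathbb{C}.$$ $\mathcal{B}_1$ is the Hilbert space of all entire functions $F$ satisfying $$\|F\|_{\mathcal{B}_1}^2=\int_{\mathbb{C}}|F(z)|^2e^{-2|z|^2}\left(2\pi-\frac12+2|z|^2\right)dA<\infty,$$ where $dA$ is Lebesgue area measure on $\mathbb{C}$. $H_n(x)=(-1)^ne^{x^2}\frac{d^n}{dx^n}e^{-x^2}$ is the $n$th (physicists') Hermite polynomial. *)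

theory Defs
  imports "HOL-Analysis.Analysis"
begin

section \<open>Hilbert spaces of complex functions, unitary operators, orthonormal bases\<close>

text \<open>
  A space is given by a set \<open>V\<close> of functions with pointwise operations, the relation \<open>eqv\<close> by
  which functions are identified (equality almost everywhere, or plain equality), and an inner
  product \<open>ip\<close>, linear in its first argument.  Axiom \<open>definite\<close> says that \<open>eqv\<close> is exactly the
  identification under which \<open>ip\<close> is positive definite, so the Hilbert space meant is the
  quotient of \<open>V\<close> by \<open>eqv\<close>.
\<close>

definition ip_norm :: "(('a \<Rightarrow> complex) \<Rightarrow> ('a \<Rightarrow> complex) \<Rightarrow> complex) \<Rightarrow> ('a \<Rightarrow> complex) \<Rightarrow> real" where
  "ip_norm ip f = sqrt (Re (ip f f))"

locale hilbert_space =
  fixes V :: "('a \<Rightarrow> complex) set"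
    and eqv :: "('a \<Rightarrow> complex) \<Rightarrow> ('a \<Rightarrow> complex) \<Rightarrow> bool"
    and ip :: "('a \<Rightarrow> complex) \<Rightarrow> ('a \<Rightarrow> complex) \<Rightarrow> complex"
  assumes zero_closed: "(\<lambda>x. 0) \<in> V"
    and add_closed: "\<lbrakk>f \<in> V; g \<in> V\<rbrakk> \<Longrightarrow> (\<lambda>x. f x + g x) \<in> V"
    and scale_closed: "f \<in> V \<Longrightarrow> (\<lambda>x. c * f x) \<in> V"
    and ip_add_left: "\<lbrakk>f \<in> V; g \<in> V; h \<in> V\<rbrakk> \<Longrightarrow> ip (\<lambda>x. f x + g x) h = ip f h + ip g h"
    and ip_scale_left: "\<lbrakk>f \<in> V; h \<in> V\<rbrakk> \<Longrightarrow> ip (\<lambda>x. c * f x) h = c * ip f h"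
    and ip_hermitian: "\<lbrakk>f \<in> V; g \<in> V\<rbrakk> \<Longrightarrow> ip g f = cnj (ip f g)"
    and ip_nonneg: "f \<in> V \<Longrightarrow> 0 \<le> Re (ip f f)"
    and definite:
      "\<lbrakk>f \<in> V; g \<in> V\<rbrakk> \<Longrightarrow> eqv f g \<longleftrightarrow> ip (\<lambda>x. f x - g x) (\<lambda>x. f x - g x) = 0"
    and complete:
      "\<lbrakk>\<And>n. X n \<in> V;
        \<And>e. 0 < e \<Longrightarrow> \<exists>N. \<forall>m\<ge>N. \<forall>n\<ge>N. ip_norm ip (\<lambda>x. X m x - X n x) < e\<rbrakk>
       \<Longrightarrow> \<exists>f\<in>V. (\<lambda>n. ip_norm ip (\<lambda>x. X n x - f x)) \<longlonglongrightarrow> 0"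

definition unitary_operator ::
  "('a \<Rightarrow> complex) set \<Rightarrow> (('a \<Rightarrow> complex) \<Rightarrow> ('a \<Rightarrow> complex) \<Rightarrow> bool) \<Rightarrow>
   (('a \<Rightarrow> complex) \<Rightarrow> ('a \<Rightarrow> complex) \<Rightarrow> complex) \<Rightarrow>
   ('b \<Rightarrow> complex) set \<Rightarrow> (('b \<Rightarrow> complex) \<Rightarrow> ('b \<Rightarrow> complex) \<Rightarrow> bool) \<Rightarrow>
   (('b \<Rightarrow> complex) \<Rightarrow> ('b \<Rightarrow> complex) \<Rightarrow> complex) \<Rightarrow>
   (('a \<Rightarrow> complex) \<Rightarrow> ('b \<Rightarrow> complex)) \<Rightarrow> bool" where
  "unitary_operator V eqV ipV W eqW ipW T \<longleftrightarrow>
     hilbert_space V eqV ipV \<and> hilbert_space W eqW ipW \<and>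
     (\<forall>f\<in>V. T f \<in> W) \<and>
     (\<forall>f\<in>V. \<forall>g\<in>V. eqV f g \<longrightarrow> eqW (T f) (T g)) \<and>
     (\<forall>f\<in>V. \<forall>g\<in>V. eqW (T (\<lambda>x. f x + g x)) (\<lambda>z. T f z + T g z)) \<and>
     (\<forall>f\<in>V. \<forall>c. eqW (T (\<lambda>x. c * f x)) (\<lambda>z. c * T f z)) \<and>
     (\<forall>f\<in>V. \<forall>g\<in>V. ipW (T f) (T g) = ipV f g) \<and>
     (\<forall>h\<in>W. \<exists>f\<in>V. eqW (T f) h)"

definition orthonormal_basis ::
  "('a \<Rightarrow> complex) set \<Rightarrow> (('a \<Rightarrow> complex) \<Rightarrow> ('a \<Rightarrow> complex) \<Rightarrow> bool) \<Rightarrow>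
   (('a \<Rightarrow> complex) \<Rightarrow> ('a \<Rightarrow> complex) \<Rightarrow> complex) \<Rightarrow> ('i \<Rightarrow> 'a \<Rightarrow> complex) \<Rightarrow> bool" where
  "orthonormal_basis V eqv ip e \<longleftrightarrow>
     hilbert_space V eqv ip \<and>
     (\<forall>i. e i \<in> V) \<and>
     (\<forall>i j. ip (e i) (e j) = (if i = j then 1 else 0)) \<and>
     (\<forall>f\<in>V. \<forall>\<epsilon>>0. \<exists>A c. finite A \<and> ip_norm ip (\<lambda>x. f x - (\<Sum>i\<in>A. c i * e i x)) < \<epsilon>)"

section \<open>The Fourier symmetric Sobolev space\<close>

text \<open>
  For measurable \<open>f\<close> the first integrability condition of \<open>fourier_sobolev\<close> gives
  \<open>f \<in> L\<^sup>1\<close> by Cauchy-Schwarz, so on that space the integral below converges absolutely.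
\<close>

definition fourier :: "(real \<Rightarrow> complex) \<Rightarrow> real \<Rightarrow> complex" where
  "fourier f t = (LINT x|lborel. f x * exp (- 2 * of_real pi * \<i> * of_real t * of_real x))"

definition fourier_sobolev :: "(real \<Rightarrow> complex) set" where
  "fourier_sobolev =
     {f \<in> borel_measurable lborel.
        integrable lborel (\<lambda>x. (cmod (f x))\<^sup>2 * (1 + x\<^sup>2)) \<and>
        integrable lborel (\<lambda>\<xi>. (cmod (fourier f \<xi>))\<^sup>2 * (1 + \<xi>\<^sup>2))}"

definition ae_eq :: "(real \<Rightarrow> complex) \<Rightarrow> (real \<Rightarrow> complex) \<Rightarrow> bool" where
  "ae_eq f g \<longleftrightarrow> (AE x in lborel. f x = g x)"

definition fourier_sobolev_ip :: "(real \<Rightarrow> complex) \<Rightarrow> (real \<Rightarrow> complex) \<Rightarrow> complex" where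
  "fourier_sobolev_ip f g =
     (LINT x|lborel. f x * cnj (g x) * of_real (1 + x\<^sup>2)) +
     (LINT \<xi>|lborel. fourier f \<xi> * cnj (fourier g \<xi>) * of_real (1 + \<xi>\<^sup>2))"

section \<open>The Bargmann transform and its range\<close>

definition bargmann :: "(real \<Rightarrow> complex) \<Rightarrow> complex \<Rightarrow> complex" where
  "bargmann f z = of_real (2 powr (1/4) / pi powr (3/2)) *
     (LINT t|lborel. f (t / sqrt (2 * pi)) *
        exp (2 * of_real t * z - z\<^sup>2 - of_real (t\<^sup>2 / 2)))"

definition B1_weight :: "complex \<Rightarrow> real" where
  "B1_weight z = exp (- 2 * (cmod z)\<^sup>2) * (2 * pi - 1/2 + 2 * (cmod z)\<^sup>2)"

definition B1 :: "(complex \<Rightarrow> complex) set" where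
  "B1 = {F. F holomorphic_on UNIV \<and> integrable lborel (\<lambda>z. (cmod (F z))\<^sup>2 * B1_weight z)}"

definition B1_ip :: "(complex \<Rightarrow> complex) \<Rightarrow> (complex \<Rightarrow> complex) \<Rightarrow> complex" where
  "B1_ip F G = (LINT z|lborel. F z * cnj (G z) * of_real (B1_weight z))"

section \<open>The Hermite system\<close>

definition hermite :: "nat \<Rightarrow> real \<Rightarrow> real" where
  "hermite n x = (-1) ^ n * exp (x\<^sup>2) * (deriv ^^ n) (\<lambda>y. exp (- y\<^sup>2)) x"

definition hermite_system :: "nat \<Rightarrow> real \<Rightarrow> complex" where
  "hermite_system n x = of_real
     (sqrt (pi / (2 powr (real n - 1/2) * fact n * (real n + 2 * pi + 1/2))) *
      hermite n (sqrt (2 * pi) * x) * exp (- pi * x\<^sup>2))"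

end

theory Submission
  imports Defs "HOL-Probability.Probability" "HOL-Complex_Analysis.Complex_Analysis"
begin

text \<open>
  Write \<open>h n\<close> for the Hermite functions.  They are eigenfunctions of the Fourier transform, and
  multiplication by \<open>x\<^sup>2\<close> sends \<open>h n\<close> to a combination of \<open>h (n + 2)\<close>, \<open>h n\<close> and \<open>h (n - 2)\<close>
  whose outer terms change sign on the Fourier side.  Hence the inner product of \<open>f\<close> with \<open>h n\<close> in
  the Sobolev space is \<open>(n + 2 * pi + 1 / 2) / pi\<close> times their inner product in \<open>L\<^sup>2\<close>.  Expanding
  \<open>exp (2 * t * z - z\<^sup>2)\<close> in Hermite polynomials then shows that the Bargmann transform carries the
  normalised Hermite functions to normalised monomials and acts on Hermite coefficients as the
  identity.  The monomials are orthogonal in \<open>B1\<close> by rotation invariance on discs.  A function with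
  vanishing Hermite coefficients has vanishing Bargmann transform, and on the imaginary axis
  this is the Fourier transform of \<open>f\<close> times a Gaussian, so \<open>f = 0\<close> almost everywhere.
  Isometry onto \<open>B1\<close> is then Parseval and Riesz-Fischer, and \<open>B1\<close> inherits completeness.
\<close>

section \<open>Orthonormal sequences in Hilbert spaces\<close>

text \<open>The theorem rests on one match of constants. Multiplication by 1 + x^2 has diagonal
  coefficient 1 + (n + 1/2) / (2 pi) on the n-th Hermite function, and it counts twice because the
  Fourier side contributes the same amount. In \<open>B1\<close> the weight gives z^n the factor 2
  pi - 1/2 from its constant part and n + 1 from 2 |z|^2. Both sides thus carry n + 2 pi + 1/2.

  Every integral of a Hermite polynomial comes from one device: integrate the generating function,
  which leaves a Gaussian integral, and compare power series coefficients in z.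

  Plancherel's theorem is bypassed. The weight forces f into L1, where the transform is bounded by
  the L1 norm and Fubini gives the multiplication formula.

  The obstacle is that neither completeness of \<open>B1\<close> nor density of polynomials in it is
  available beforehand. Power series are therefore integrated over discs only, and pointwise limits
  are turned into norm bounds by Fatou's lemma.\<close>

lemma mult_cnj_cmod: "z * cnj z = (complex_of_real (cmod z))\<^sup>2"
  by (simp add: complex_norm_square[symmetric])

text \<open>\<open>hilbert_space\<close> without completeness. The inner product calculus is needed
  in both spaces before either is known to be complete.\<close>

locale pre_hilbert =
  fixes V :: "('a \<Rightarrow> complex) set"
    and eqv :: "('a \<Rightarrow> complex) \<Rightarrow> ('a \<Rightarrow> complex) \<Rightarrow> bool"
    and ip :: "('a \<Rightarrow> complex) \<Rightarrow> ('a \<Rightarrow> complex) \<Rightarrow> complex"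
  assumes zero_closed: "(\<lambda>x. 0) \<in> V"
    and add_closed: "\<lbrakk>f \<in> V; g \<in> V\<rbrakk> \<Longrightarrow> (\<lambda>x. f x + g x) \<in> V"
    and scale_closed: "f \<in> V \<Longrightarrow> (\<lambda>x. c * f x) \<in> V"
    and ip_add_left: "\<lbrakk>f \<in> V; g \<in> V; h \<in> V\<rbrakk> \<Longrightarrow> ip (\<lambda>x. f x + g x) h = ip f h + ip g h"
    and ip_scale_left: "\<lbrakk>f \<in> V; h \<in> V\<rbrakk> \<Longrightarrow> ip (\<lambda>x. c * f x) h = c * ip f h"
    and ip_hermitian: "\<lbrakk>f \<in> V; g \<in> V\<rbrakk> \<Longrightarrow> ip g f = cnj (ip f g)"
    and ip_nonneg: "f \<in> V \<Longrightarrow> 0 \<le> Re (ip f f)"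
    and definite:
      "\<lbrakk>f \<in> V; g \<in> V\<rbrakk> \<Longrightarrow> eqv f g \<longleftrightarrow> ip (\<lambda>x. f x - g x) (\<lambda>x. f x - g x) = 0"
begin

abbreviation nrm :: "('a \<Rightarrow> complex) \<Rightarrow> real" where
  "nrm \<equiv> ip_norm ip"

lemma diff_closed:
  assumes "f \<in> V" "g \<in> V"
  shows "(\<lambda>x. f x - g x) \<in> V"
  using add_closed[OF assms(1) scale_closed[OF assms(2), of "-1"]] by simp

lemma sum_closed:
  assumes "\<And>i. i \<in> A \<Longrightarrow> e i \<in> V"
  shows "(\<lambda>x. \<Sum>i\<in>A. c i * e i x) \<in> V"
  using assms
proof (induction A rule: infinite_finite_induct)
  case (insert i A)
  then have "(\<lambda>x. c i * e i x + (\<Sum>i\<in>A. c i * e i x)) \<in> V"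
    by (intro add_closed scale_closed) auto
  then show ?case using insert by simp
qed (auto simp: zero_closed)

lemma ip_diff_left:
  assumes "f \<in> V" "g \<in> V" "h \<in> V"
  shows "ip (\<lambda>x. f x - g x) h = ip f h - ip g h"
  using ip_add_left[OF assms(1) scale_closed[OF assms(2), of "-1"] assms(3)]
    ip_scale_left[OF assms(2,3), of "-1"] by simp

lemma ip_zero_left:
  assumes "h \<in> V"
  shows "ip (\<lambda>x. 0) h = 0"
  using ip_scale_left[OF zero_closed assms, of 0] by simp

lemma ip_sum_left:
  assumes "\<And>i. i \<in> A \<Longrightarrow> e i \<in> V" "h \<in> V"
  shows "ip (\<lambda>x. \<Sum>i\<in>A. c i * e i x) h = (\<Sum>i\<in>A. c i * ip (e i) h)"
  using assms
proof (induction A rule: infinite_finite_induct)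
  case (insert i A)
  have "ip (\<lambda>x. \<Sum>i\<in>insert i A. c i * e i x) h
      = ip (\<lambda>x. c i * e i x + (\<Sum>i\<in>A. c i * e i x)) h"
    using insert.hyps by simp
  also have "\<dots> = c i * ip (e i) h + ip (\<lambda>x. \<Sum>i\<in>A. c i * e i x) h"
    using insert.prems by (subst ip_add_left) (auto intro!: scale_closed sum_closed ip_scale_left)
  finally show ?case using insert by simp
qed (auto simp: ip_zero_left)

lemma ip_add_right:
  assumes "f \<in> V" "g \<in> V" "h \<in> V"
  shows "ip h (\<lambda>x. f x + g x) = ip h f + ip h g"
  by (simp add: ip_hermitian[OF add_closed[OF assms(1,2)] assms(3)] ip_add_left assms
      ip_hermitian[OF assms(1,3)] ip_hermitian[OF assms(2,3)])

lemma ip_diff_right: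
  assumes "f \<in> V" "g \<in> V" "h \<in> V"
  shows "ip h (\<lambda>x. f x - g x) = ip h f - ip h g"
  by (simp add: ip_hermitian[OF diff_closed[OF assms(1,2)] assms(3)] ip_diff_left assms
      ip_hermitian[OF assms(1,3)] ip_hermitian[OF assms(2,3)])

lemma ip_scale_right:
  assumes "f \<in> V" "h \<in> V"
  shows "ip h (\<lambda>x. c * f x) = cnj c * ip h f"
  by (simp add: ip_hermitian[OF scale_closed[OF assms(1)] assms(2)] ip_scale_left assms
      ip_hermitian[OF assms])

lemma ip_sum_right:
  assumes "\<And>i. i \<in> A \<Longrightarrow> e i \<in> V" "h \<in> V"
  shows "ip h (\<lambda>x. \<Sum>i\<in>A. c i * e i x) = (\<Sum>i\<in>A. cnj (c i) * ip h (e i))"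
proof -
  have "ip h (\<lambda>x. \<Sum>i\<in>A. c i * e i x) = cnj (ip (\<lambda>x. \<Sum>i\<in>A. c i * e i x) h)"
    using assms by (intro ip_hermitian sum_closed)
  also have "\<dots> = (\<Sum>i\<in>A. cnj (c i) * ip h (e i))"
    using assms
    by (simp add: ip_sum_left) (intro sum.cong refl arg_cong2[where f="(*)"] ip_hermitian[symmetric], auto)
  finally show ?thesis .
qed

lemma nrm_nonneg [simp]: "f \<in> V \<Longrightarrow> 0 \<le> nrm f"
  by (simp add: ip_norm_def ip_nonneg)

lemma nrm_sq: "f \<in> V \<Longrightarrow> (nrm f)\<^sup>2 = Re (ip f f)"
  by (simp add: ip_norm_def ip_nonneg)

lemma ip_self: "f \<in> V \<Longrightarrow> ip f f = of_real ((nrm f)\<^sup>2)"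
  using ip_hermitian[of f f] by (simp add: nrm_sq complex_eq_iff)

lemma nrm_sq_diff:
  assumes "f \<in> V" "g \<in> V"
  shows "(nrm (\<lambda>x. f x - g x))\<^sup>2 = (nrm f)\<^sup>2 + (nrm g)\<^sup>2 - 2 * Re (ip f g)"
  using assms ip_hermitian[OF assms]
  by (simp add: nrm_sq diff_closed ip_diff_left ip_diff_right)

lemma nrm_sq_add:
  assumes "f \<in> V" "g \<in> V"
  shows "(nrm (\<lambda>x. f x + g x))\<^sup>2 = (nrm f)\<^sup>2 + (nrm g)\<^sup>2 + 2 * Re (ip f g)"
  using assms ip_hermitian[OF assms]
  by (simp add: nrm_sq add_closed ip_add_left ip_add_right)

lemma nrm_scale:
  assumes "f \<in> V"
  shows "nrm (\<lambda>x. c * f x) = cmod c * nrm f"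
proof -
  have "ip (\<lambda>x. c * f x) (\<lambda>x. c * f x) = of_real ((cmod c * nrm f)\<^sup>2)"
    using assms
    by (simp add: ip_scale_left ip_scale_right scale_closed ip_self[OF assms]
        power_mult_distrib mult_cnj_cmod)
  then show ?thesis
    using assms by (simp add: ip_norm_def[of _ "\<lambda>x. c * f x"] del: of_real_power)
qed

lemma nrm_minus_commute:
  assumes "f \<in> V" "g \<in> V"
  shows "nrm (\<lambda>x. f x - g x) = nrm (\<lambda>x. g x - f x)"
  using nrm_scale[OF diff_closed[OF assms], of "-1"] by simp

lemma Cauchy_Schwarz:
  assumes "f \<in> V" "g \<in> V"
  shows "cmod (ip f g) \<le> nrm f * nrm g"
proof -
  define c where "c = cmod (ip f g)"
  \<comment> \<open>The square of the norm of f - s <f,g> g, expanded for real s.\<close>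
  have *: "0 \<le> (nrm f)\<^sup>2 - 2 * s * c\<^sup>2 + s\<^sup>2 * c\<^sup>2 * (nrm g)\<^sup>2" for s :: real
  proof -
    let ?t = "of_real s * ip f g"
    have "Re (ip f (\<lambda>x. ?t * g x)) = Re (cnj ?t * ip f g)"
      using assms by (simp only: ip_scale_right)
    also have "cnj ?t * ip f g = of_real (s * c\<^sup>2)"
      by (simp add: c_def complex_norm_square[symmetric] mult.commute[of "cnj _"] mult.assoc)
    finally have "(nrm (\<lambda>x. f x - ?t * g x))\<^sup>2 = (nrm f)\<^sup>2 + (\<bar>s\<bar> * c * nrm g)\<^sup>2 - 2 * (s * c\<^sup>2)"
      using assms by (simp add: nrm_sq_diff scale_closed nrm_scale norm_mult c_def)
    then show ?thesis
      using zero_le_power2[of "nrm (\<lambda>x. f x - ?t * g x)"]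
      by (simp add: power_mult_distrib)
  qed
  have "c\<^sup>2 \<le> (nrm f * nrm g)\<^sup>2"
  proof (cases "nrm g = 0")
    case True
    have "c = 0"
    proof (rule ccontr)
      assume "c \<noteq> 0"
      \<comment> \<open>Elements of norm 0 need not be the zero function. For such g the expression
        is linear in s, and at this s it equals - (nrm f)^2 - 2.\<close>
      then show False
        using *[of "((nrm f)\<^sup>2 + 1) / c\<^sup>2"] True zero_le_power2[of "nrm f"] by simp
    qed
    then show ?thesis by simp
  next
    case False
    then have pos: "0 < (nrm g)\<^sup>2" by simp
    \<comment> \<open>The value s = 1 / (nrm g)^2 minimises the quadratic expression.\<close>
    have "0 \<le> (nrm f)\<^sup>2 - 2 * (1 / (nrm g)\<^sup>2) * c\<^sup>2 + (1 / (nrm g)\<^sup>2)\<^sup>2 * c\<^sup>2 * (nrm g)\<^sup>2"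
      by (rule *)
    also have "\<dots> = (nrm f)\<^sup>2 - c\<^sup>2 / (nrm g)\<^sup>2"
      using False by (simp add: power2_eq_square)
    finally show ?thesis
      using pos unfolding power_mult_distrib by (simp only: diff_ge_0_iff_ge pos_divide_le_eq)
  qed
  then show ?thesis
    unfolding c_def by (rule power2_le_imp_le) (simp add: assms)
qed

lemma nrm_triangle:
  assumes "f \<in> V" "g \<in> V"
  shows "nrm (\<lambda>x. f x + g x) \<le> nrm f + nrm g"
proof (rule power2_le_imp_le)
  show "(nrm (\<lambda>x. f x + g x))\<^sup>2 \<le> (nrm f + nrm g)\<^sup>2"
    using Cauchy_Schwarz[OF assms] complex_Re_le_cmod[of "ip f g"]
    by (simp add: nrm_sq_add[OF assms] power2_sum)
qed (use assms in simp)

lemma nrm_triangle_diff: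
  assumes "f \<in> V" "g \<in> V"
  shows "\<bar>nrm f - nrm g\<bar> \<le> nrm (\<lambda>x. f x - g x)"
  using nrm_triangle[OF diff_closed[OF assms] assms(2)]
    nrm_triangle[OF diff_closed[OF assms(2,1)] assms(1)] nrm_minus_commute[OF assms]
  by (simp add: abs_le_iff)

lemma tendsto_nrm:
  assumes "\<And>n. X n \<in> V" "f \<in> V" "(\<lambda>n. nrm (\<lambda>x. X n x - f x)) \<longlonglongrightarrow> 0"
  shows "(\<lambda>n. nrm (X n)) \<longlonglongrightarrow> nrm f"
  by (rule LIM_zero_cancel, rule Lim_null_comparison[OF _ assms(3)])
    (auto intro!: always_eventually nrm_triangle_diff assms)

lemma tendsto_ip_left:
  assumes "\<And>n. X n \<in> V" "f \<in> V" "h \<in> V" "(\<lambda>n. nrm (\<lambda>x. X n x - f x)) \<longlonglongrightarrow> 0"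
  shows "(\<lambda>n. ip (X n) h) \<longlonglongrightarrow> ip f h"
proof (rule LIM_zero_cancel, rule Lim_null_comparison)
  show "\<forall>\<^sub>F n in sequentially. norm (ip (X n) h - ip f h) \<le> nrm (\<lambda>x. X n x - f x) * nrm h"
    using Cauchy_Schwarz[OF diff_closed[OF assms(1,2)] assms(3)]
    by (simp add: ip_diff_left assms)
  show "(\<lambda>n. nrm (\<lambda>x. X n x - f x) * nrm h) \<longlonglongrightarrow> 0"
    using tendsto_mult_right[OF assms(4)] by simp
qed

lemma eqv_iff_nrm: "\<lbrakk>f \<in> V; g \<in> V\<rbrakk> \<Longrightarrow> eqv f g \<longleftrightarrow> nrm (\<lambda>x. f x - g x) = 0"
  by (simp add: definite ip_self diff_closed)

text \<open>The imaginary part comes from f + i g, because \<open>ip\<close> is conjugate linear in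
  its second argument: Re <f, i g> = Im <f, g>. It lets an equality of norms yield an equality of
  inner products.\<close>

lemma polarization:
  assumes "f \<in> V" "g \<in> V"
  shows "ip f g = Complex ((nrm (\<lambda>x. f x + g x))\<^sup>2 - (nrm f)\<^sup>2 - (nrm g)\<^sup>2)
      ((nrm (\<lambda>x. f x + \<i> * g x))\<^sup>2 - (nrm f)\<^sup>2 - (nrm g)\<^sup>2) / 2"
  using assms
  by (simp add: nrm_sq_add scale_closed nrm_scale ip_scale_right complex_eq_iff)

end

sublocale hilbert_space \<subseteq> pre: pre_hilbert V eqv ip
  by unfold_locales
    (fact zero_closed add_closed scale_closed ip_add_left ip_scale_left ip_hermitian ip_nonneg definite)+

text \<open>Completeness is not assumed, so Bessel's inequality can be applied to the monomials in
  \<open>B1\<close> at a stage where \<open>B1\<close> is only a pre-Hilbert space.\<close>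

locale orthonormal_seq = pre_hilbert +
  fixes e :: "nat \<Rightarrow> 'a \<Rightarrow> complex"
  assumes e_closed: "e i \<in> V"
    and e_orthonormal: "ip (e i) (e j) = (if i = j then 1 else 0)"
begin

lemma comb_closed: "(\<lambda>x. \<Sum>i\<in>A. c i * e i x) \<in> V"
  by (intro sum_closed e_closed)

lemma ip_comb_left:
  assumes "finite A"
  shows "ip (\<lambda>x. \<Sum>i\<in>A. c i * e i x) (e k) = (if k \<in> A then c k else 0)"
  using assms
  by (simp add: ip_sum_left e_closed e_orthonormal if_distrib[of "(*) _"] sum.delta cong: if_cong)

lemma nrm_comb:
  assumes "finite A"
  shows "(nrm (\<lambda>x. \<Sum>i\<in>A. c i * e i x))\<^sup>2 = (\<Sum>i\<in>A. (cmod (c i))\<^sup>2)"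
proof -
  have "ip (\<lambda>x. \<Sum>i\<in>A. c i * e i x) (\<lambda>x. \<Sum>i\<in>A. c i * e i x) = (\<Sum>i\<in>A. cnj (c i) * c i)"
    using assms by (subst ip_sum_right) (auto simp: e_closed comb_closed ip_comb_left)
  also have "\<dots> = of_real (\<Sum>i\<in>A. (cmod (c i))\<^sup>2)"
    by (simp add: mult_cnj_cmod mult.commute[of "cnj _"])
  finally show ?thesis
    by (simp add: ip_self[OF comb_closed] of_real_eq_iff del: of_real_power of_real_sum)
qed

lemma Bessel_sum:
  assumes "f \<in> V" "finite A"
  shows "(\<Sum>i\<in>A. (cmod (ip f (e i)))\<^sup>2) \<le> (nrm f)\<^sup>2"
proof -
  let ?s = "\<lambda>x. \<Sum>i\<in>A. ip f (e i) * e i x"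
  have "ip f ?s = (\<Sum>i\<in>A. cnj (ip f (e i)) * ip f (e i))"
    using assms by (subst ip_sum_right) (auto simp: e_closed)
  also have "\<dots> = of_real (\<Sum>i\<in>A. (cmod (ip f (e i)))\<^sup>2)"
    by (simp add: mult_cnj_cmod mult.commute[of "cnj _"])
  finally have "Re (ip f ?s) = (\<Sum>i\<in>A. (cmod (ip f (e i)))\<^sup>2)"
    by simp
  then show ?thesis
    using nrm_sq_diff[OF assms(1) comb_closed, of "\<lambda>i. ip f (e i)" A] nrm_comb[OF assms(2), of "\<lambda>i. ip f (e i)"]
      zero_le_power2[of "nrm (\<lambda>x. f x - ?s x)"] by linarith
qed

lemma Bessel:
  assumes "f \<in> V"
  shows "summable (\<lambda>i. (cmod (ip f (e i)))\<^sup>2)"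
  by (rule summableI_nonneg_bounded[of _ "(nrm f)\<^sup>2"]) (auto intro: Bessel_sum assms)

lemma comb_diff:
  assumes "N \<le> M"
  shows "(\<Sum>i<M. c i * e i x) - (\<Sum>i<N. c i * e i x) = (\<Sum>i\<in>{N..<M}. c i * e i x)"
  using assms sum_diff_nat_ivl[of 0 N M "\<lambda>i. c i * e i x"] by (simp add: atLeast0LessThan)

end

locale hilbert_orthonormal_seq = orthonormal_seq + hilbert_space V eqv ip
begin

text \<open>Blocks of the series have squared norm equal to the corresponding block of sum |c i|^2,
  so the partial sums are Cauchy. The coefficients of the limit follow from continuity of
  \<open>ip\<close>, since each one is constant along the partial sums from some index on.\<close>

lemma Riesz_Fischer:
  assumes "summable (\<lambda>i. (cmod (c i))\<^sup>2)"
  obtains f where "f \<in> V" "(\<lambda>N. nrm (\<lambda>x. (\<Sum>i<N. c i * e i x) - f x)) \<longlonglongrightarrow> 0"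
    "\<And>k. ip f (e k) = c k"
proof -
  let ?X = "\<lambda>N x. \<Sum>i<N. c i * e i x"
  have "\<exists>f\<in>V. (\<lambda>N. nrm (\<lambda>x. ?X N x - f x)) \<longlonglongrightarrow> 0"
  proof (rule complete[where X="?X"])
    fix \<epsilon> :: real assume "0 < \<epsilon>"
    then obtain N where N: "\<And>m n. m \<ge> N \<Longrightarrow> norm (\<Sum>i\<in>{m..<n}. (cmod (c i))\<^sup>2) < \<epsilon>\<^sup>2"
      using assms unfolding summable_Cauchy by (metis zero_less_power)
    have le: "nrm (\<lambda>x. ?X n x - ?X m x) < \<epsilon>" if "N \<le> m" "m \<le> n" for m n
    proof (rule power_less_imp_less_base)
      show "(nrm (\<lambda>x. ?X n x - ?X m x))\<^sup>2 < \<epsilon>\<^sup>2"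
        using N[OF that(1), of n] that(2) by (simp add: comb_diff nrm_comb)
    qed (use \<open>0 < \<epsilon>\<close> in simp)
    have "nrm (\<lambda>x. ?X m x - ?X n x) < \<epsilon>" if "m \<ge> N" "n \<ge> N" for m n
      using le[of m n] le[of n m] that nrm_minus_commute[OF comb_closed comb_closed] linear[of m n]
      by metis
    then show "\<exists>N. \<forall>m\<ge>N. \<forall>n\<ge>N. nrm (\<lambda>x. ?X m x - ?X n x) < \<epsilon>"
      by blast
  qed (rule comb_closed)
  then obtain f where f: "f \<in> V" "(\<lambda>N. nrm (\<lambda>x. ?X N x - f x)) \<longlonglongrightarrow> 0"
    by blast
  have "ip f (e k) = c k" for k
  proof (rule LIMSEQ_unique)
    show "(\<lambda>N. ip (?X N) (e k)) \<longlonglongrightarrow> ip f (e k)"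
      by (rule tendsto_ip_left[OF comb_closed f(1) e_closed f(2)])
    have "\<forall>\<^sub>F N in sequentially. ip (?X N) (e k) = c k"
      using eventually_gt_at_top[of k] by eventually_elim (simp add: ip_comb_left)
    then show "(\<lambda>N. ip (?X N) (e k)) \<longlonglongrightarrow> c k"
      by (simp add: tendsto_eventually)
  qed
  with f that show thesis by blast
qed

text \<open>Bessel's inequality and \<open>Riesz_Fischer\<close> produce a limit g with the same
  coefficients as f. By totality g - f has norm 0, so convergence to g is convergence to f.\<close>

lemma expansion:
  assumes total: "\<And>f. f \<in> V \<Longrightarrow> (\<And>n. ip f (e n) = 0) \<Longrightarrow> eqv f (\<lambda>x. 0)"
    and f: "f \<in> V"
  shows "(\<lambda>N. nrm (\<lambda>x. (\<Sum>i<N. ip f (e i) * e i x) - f x)) \<longlonglongrightarrow> 0"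
proof -
  let ?X = "\<lambda>N x. \<Sum>i<N. ip f (e i) * e i x"
  obtain g where g: "g \<in> V" "(\<lambda>N. nrm (\<lambda>x. ?X N x - g x)) \<longlonglongrightarrow> 0"
    "\<And>k. ip g (e k) = ip f (e k)"
    using Riesz_Fischer[OF Bessel[OF f]] by blast
  have "eqv (\<lambda>x. g x - f x) (\<lambda>x. 0)"
    using g f by (intro total diff_closed) (simp_all add: ip_diff_left e_closed)
  then have gf: "nrm (\<lambda>x. g x - f x) = 0"
    using g f by (subst (asm) eqv_iff_nrm) (auto simp: diff_closed zero_closed)
  show ?thesis
  proof (rule Lim_null_comparison[OF _ g(2)], rule always_eventually, rule allI)
    fix N
    show "norm (nrm (\<lambda>x. ?X N x - f x)) \<le> nrm (\<lambda>x. ?X N x - g x)"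
      using nrm_triangle[OF diff_closed[OF comb_closed g(1)] diff_closed[OF g(1) f], of "\<lambda>i. ip f (e i)" "{..<N}"] gf
      by (simp add: diff_closed comb_closed f)
  qed
qed

lemma orthonormal_basisI:
  assumes total: "\<And>f. f \<in> V \<Longrightarrow> (\<And>n. ip f (e n) = 0) \<Longrightarrow> eqv f (\<lambda>x. 0)"
  shows "orthonormal_basis V eqv ip e"
  unfolding orthonormal_basis_def
proof (intro conjI ballI allI impI)
  show "hilbert_space V eqv ip" by (rule hilbert_space_axioms)
next
  fix f and \<epsilon> :: real assume f: "f \<in> V" and "0 < \<epsilon>"
  then have "\<forall>\<^sub>F N in sequentially. nrm (\<lambda>x. (\<Sum>i<N. ip f (e i) * e i x) - f x) < \<epsilon>"
    by (intro order_tendstoD(2)[OF expansion] total f)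
  then obtain N where "nrm (\<lambda>x. (\<Sum>i<N. ip f (e i) * e i x) - f x) < \<epsilon>"
    using eventually_happens' sequentially_bot by blast
  then have "nrm (\<lambda>x. f x - (\<Sum>i<N. ip f (e i) * e i x)) < \<epsilon>"
    by (rule ord_eq_less_trans[OF nrm_minus_commute[OF f comb_closed]])
  then show "\<exists>A c. finite A \<and> nrm (\<lambda>x. f x - (\<Sum>i\<in>A. c i * e i x)) < \<epsilon>"
    by (intro exI[of _ "{..<N}"] exI[of _ "\<lambda>i. ip f (e i)"]) simp
qed (simp_all add: e_closed e_orthonormal)

end

text \<open>A Cauchy sequence is pulled back along T, which preserves norms of differences, and the
  image of the limit is a limit of the original sequence. Surjectivity is required as equality of
  functions, so preimages can be chosen exactly.\<close>

lemma hilbert_space_unitary_image: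
  fixes V :: "('a \<Rightarrow> complex) set" and W :: "('b \<Rightarrow> complex) set"
  assumes V: "hilbert_space V eqV ipV" and W: "pre_hilbert W eqW ipW"
    and T: "\<And>f. f \<in> V \<Longrightarrow> T f \<in> W"
    and T_diff: "\<And>f g. \<lbrakk>f \<in> V; g \<in> V\<rbrakk> \<Longrightarrow> T (\<lambda>x. f x - g x) = (\<lambda>z. T f z - T g z)"
    and T_norm: "\<And>f. f \<in> V \<Longrightarrow> ip_norm ipW (T f) = ip_norm ipV f"
    and T_onto: "\<And>h. h \<in> W \<Longrightarrow> \<exists>f\<in>V. T f = h"
  shows "hilbert_space W eqW ipW"
proof -
  interpret V: hilbert_space V eqV ipV by fact
  interpret W: pre_hilbert W eqW ipW by fact
  show ?thesis
  proof unfold_locales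
    fix X :: "nat \<Rightarrow> 'b \<Rightarrow> complex" assume X: "\<And>n. X n \<in> W"
      and Cauchy: "\<And>e. 0 < e \<Longrightarrow> \<exists>N. \<forall>m\<ge>N. \<forall>n\<ge>N. W.nrm (\<lambda>x. X m x - X n x) < e"
    obtain Y where Y: "\<And>n. Y n \<in> V" "\<And>n. T (Y n) = X n"
      using T_onto[OF X] by metis
    have eq: "W.nrm (\<lambda>x. X n x - T f x) = V.pre.nrm (\<lambda>x. Y n x - f x)" if "f \<in> V" for n f
      using T_norm[OF V.pre.diff_closed[OF Y(1) that]] T_diff[OF Y(1) that] Y(2) by simp
    have "\<exists>f\<in>V. (\<lambda>n. V.pre.nrm (\<lambda>x. Y n x - f x)) \<longlonglongrightarrow> 0"
      using Cauchy eq[OF Y(1)] by (intro V.complete Y) (simp add: Y)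
    then obtain f where "f \<in> V" "(\<lambda>n. V.pre.nrm (\<lambda>x. Y n x - f x)) \<longlonglongrightarrow> 0"
      by blast
    then show "\<exists>h\<in>W. (\<lambda>n. W.nrm (\<lambda>x. X n x - h x)) \<longlonglongrightarrow> 0"
      using eq T by (intro bexI[of _ "T f"]) simp_all
  qed (fact W.zero_closed W.add_closed W.scale_closed W.ip_add_left W.ip_scale_left
      W.ip_hermitian W.ip_nonneg W.definite)+
qed

section \<open>Weighted square-integrable functions and the Fourier transform\<close>

lemma borel_measurable_cnj [measurable (raw)]:
  "f \<in> borel_measurable M \<Longrightarrow> (\<lambda>x. cnj (f x)) \<in> borel_measurable M"
  by (rule borel_measurable_continuous_on[of cnj]) (auto intro: continuous_intros)

text \<open>Serves both spaces: \<open>sobolev_weight\<close> is used for f and for its Fourier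
  transform, and \<open>B1_weight\<close> for entire functions.\<close>

definition L2w :: "'a measure \<Rightarrow> ('a \<Rightarrow> real) \<Rightarrow> ('a \<Rightarrow> complex) set" where
  "L2w M w = {f \<in> borel_measurable M. integrable M (\<lambda>x. (cmod (f x))\<^sup>2 * w x)}"

definition ipw :: "'a measure \<Rightarrow> ('a \<Rightarrow> real) \<Rightarrow> ('a \<Rightarrow> complex) \<Rightarrow> ('a \<Rightarrow> complex) \<Rightarrow> complex" where
  "ipw M w f g = (LINT x|M. f x * cnj (g x) * of_real (w x))"

locale weighted_L2 =
  fixes M :: "'a measure" and w :: "'a \<Rightarrow> real"
  assumes w_measurable [measurable]: "w \<in> borel_measurable M"
    and w_pos: "\<And>x. 0 < w x"
begin

lemma w_nonzero [simp]: "w x \<noteq> 0"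
  using w_pos[of x] by simp

lemma measurableD [measurable_dest]: "f \<in> L2w M w \<Longrightarrow> f \<in> borel_measurable M"
  by (simp add: L2w_def)

lemma integrable_sq: "f \<in> L2w M w \<Longrightarrow> integrable M (\<lambda>x. (cmod (f x))\<^sup>2 * w x)"
  by (simp add: L2w_def)

lemma integrable_ipw:
  assumes f: "f \<in> L2w M w" and g: "g \<in> L2w M w"
  shows "integrable M (\<lambda>x. f x * cnj (g x) * of_real (w x))"
proof (rule Bochner_Integration.integrable_bound)
  show "integrable M (\<lambda>x. (cmod (f x))\<^sup>2 * w x + (cmod (g x))\<^sup>2 * w x)"
    using assms by (intro Bochner_Integration.integrable_add integrable_sq)
  show "(\<lambda>x. f x * cnj (g x) * of_real (w x)) \<in> borel_measurable M"
    using measurableD[OF f] measurableD[OF g] by measurable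
  show "AE x in M. norm (f x * cnj (g x) * of_real (w x)) \<le> norm ((cmod (f x))\<^sup>2 * w x + (cmod (g x))\<^sup>2 * w x)"
  proof (rule AE_I2)
    fix x
    have "2 * (cmod (f x) * cmod (g x)) \<le> (cmod (f x))\<^sup>2 + (cmod (g x))\<^sup>2"
      using sum_squares_bound[of "cmod (f x)" "cmod (g x)"] by simp
    moreover have "0 \<le> cmod (f x) * cmod (g x)" by simp
    ultimately have "cmod (f x) * cmod (g x) \<le> (cmod (f x))\<^sup>2 + (cmod (g x))\<^sup>2"
      by linarith
    then have "cmod (f x) * cmod (g x) * w x \<le> ((cmod (f x))\<^sup>2 + (cmod (g x))\<^sup>2) * w x"
      using w_pos[of x] by (intro mult_right_mono) auto
    then show "norm (f x * cnj (g x) * of_real (w x)) \<le> norm ((cmod (f x))\<^sup>2 * w x + (cmod (g x))\<^sup>2 * w x)"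
      using w_pos[of x] by (simp add: norm_mult distrib_right)
  qed
qed

lemma add_closed:
  assumes "f \<in> L2w M w" "g \<in> L2w M w"
  shows "(\<lambda>x. f x + g x) \<in> L2w M w"
proof -
  have [measurable]: "f \<in> borel_measurable M" "g \<in> borel_measurable M"
    using assms by (auto dest: measurableD)
  have "integrable M (\<lambda>x. (cmod (f x + g x))\<^sup>2 * w x)"
  proof (rule Bochner_Integration.integrable_bound)
    show "integrable M (\<lambda>x. 2 * ((cmod (f x))\<^sup>2 * w x) + 2 * ((cmod (g x))\<^sup>2 * w x))"
      using assms by (intro Bochner_Integration.integrable_add integrable_mult_right integrable_sq)
    show "AE x in M. norm ((cmod (f x + g x))\<^sup>2 * w x) \<le> norm (2 * ((cmod (f x))\<^sup>2 * w x) + 2 * ((cmod (g x))\<^sup>2 * w x))"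
    proof (rule AE_I2)
      fix x
      have "(cmod (f x + g x))\<^sup>2 \<le> (cmod (f x) + cmod (g x))\<^sup>2"
        by (intro power_mono norm_triangle_ineq) auto
      also have "\<dots> \<le> 2 * (cmod (f x))\<^sup>2 + 2 * (cmod (g x))\<^sup>2"
        using sum_squares_bound[of "cmod (f x)" "cmod (g x)"] by (simp add: power2_sum)
      finally have "(cmod (f x + g x))\<^sup>2 * w x \<le> (2 * (cmod (f x))\<^sup>2 + 2 * (cmod (g x))\<^sup>2) * w x"
        using w_pos[of x] by (intro mult_right_mono) auto
      then show "norm ((cmod (f x + g x))\<^sup>2 * w x) \<le> norm (2 * ((cmod (f x))\<^sup>2 * w x) + 2 * ((cmod (g x))\<^sup>2 * w x))"
        using w_pos[of x] by (simp add: algebra_simps)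
    qed
  qed measurable
  then show ?thesis by (simp add: L2w_def)
qed

lemma scale_closed:
  assumes "f \<in> L2w M w"
  shows "(\<lambda>x. c * f x) \<in> L2w M w"
proof -
  have [measurable]: "f \<in> borel_measurable M"
    using assms by (auto dest: measurableD)
  have "integrable M (\<lambda>x. (cmod c)\<^sup>2 * ((cmod (f x))\<^sup>2 * w x))"
    using assms by (intro integrable_mult_right integrable_sq)
  then show ?thesis by (simp add: L2w_def norm_mult power_mult_distrib mult.assoc)
qed

lemma zero_closed: "(\<lambda>x. 0) \<in> L2w M w"
  by (simp add: L2w_def)

lemma diff_closed:
  assumes "f \<in> L2w M w" "g \<in> L2w M w"
  shows "(\<lambda>x. f x - g x) \<in> L2w M w"
  using add_closed[OF assms(1) scale_closed[OF assms(2), of "-1"]] by simp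

lemma ipw_add_left:
  assumes "f \<in> L2w M w" "g \<in> L2w M w" "h \<in> L2w M w"
  shows "ipw M w (\<lambda>x. f x + g x) h = ipw M w f h + ipw M w g h"
  using Bochner_Integration.integral_add[OF integrable_ipw[OF assms(1,3)] integrable_ipw[OF assms(2,3)]]
  by (simp add: ipw_def distrib_right)

lemma ipw_scale_left: "ipw M w (\<lambda>x. c * f x) h = c * ipw M w f h"
  by (simp add: ipw_def mult.assoc)

lemma ipw_hermitian: "ipw M w g f = cnj (ipw M w f g)"
proof -
  have "cnj (ipw M w f g) = (LINT x|M. cnj (f x * cnj (g x) * of_real (w x)))"
    unfolding ipw_def by (rule Bochner_Integration.integral_cnj[symmetric])
  then show ?thesis
    by (simp only: ipw_def complex_cnj_mult complex_cnj_cnj complex_cnj_complex_of_real mult_ac)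
qed

lemma ipw_self: "ipw M w f f = of_real (LINT x|M. (cmod (f x))\<^sup>2 * w x)"
  by (simp add: ipw_def flip: integral_complex_of_real complex_norm_square)

lemma Re_ipw_self: "Re (ipw M w f f) = (LINT x|M. (cmod (f x))\<^sup>2 * w x)"
  by (simp add: ipw_self)

lemma Re_ipw_nonneg: "0 \<le> Re (ipw M w f f)"
  unfolding Re_ipw_self by (intro Bochner_Integration.integral_nonneg) (simp add: w_pos less_imp_le)

lemma ipw_self_eq_0_iff:
  assumes "f \<in> L2w M w"
  shows "ipw M w f f = 0 \<longleftrightarrow> (AE x in M. f x = 0)"
proof -
  have "(LINT x|M. (cmod (f x))\<^sup>2 * w x) = 0 \<longleftrightarrow> (AE x in M. (cmod (f x))\<^sup>2 * w x = 0)"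
    using w_pos by (intro integral_nonneg_eq_0_iff_AE integrable_sq assms AE_I2) (simp add: less_imp_le)
  also have "\<dots> \<longleftrightarrow> (AE x in M. f x = 0)"
    by (intro AE_cong) simp
  finally show ?thesis by (simp add: ipw_self)
qed

text \<open>The tool that turns pointwise limits into norm estimates. It supplies the limits in the
  completeness proof and the bounds on tails of power series.\<close>

lemma Fatou:
  assumes X: "\<And>n. X n \<in> L2w M w" and f [measurable]: "f \<in> borel_measurable M"
    and lim: "AE x in M. (\<lambda>n. X n x) \<longlonglongrightarrow> f x"
    and bd: "\<forall>\<^sub>F n in sequentially. (LINT x|M. (cmod (X n x))\<^sup>2 * w x) \<le> C"
  shows "f \<in> L2w M w" "(LINT x|M. (cmod (f x))\<^sup>2 * w x) \<le> C"
proof -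
  have [measurable]: "X n \<in> borel_measurable M" for n
    using X by (auto dest: measurableD)
  have X_eq: "(\<integral>\<^sup>+x. ennreal ((cmod (X n x))\<^sup>2 * w x) \<partial>M) = ennreal (LINT x|M. (cmod (X n x))\<^sup>2 * w x)" for n
    using w_pos by (intro nn_integral_eq_integral integrable_sq X AE_I2) (simp add: less_imp_le)
  have "(\<integral>\<^sup>+x. ennreal ((cmod (f x))\<^sup>2 * w x) \<partial>M)
      = (\<integral>\<^sup>+x. liminf (\<lambda>n. ennreal ((cmod (X n x))\<^sup>2 * w x)) \<partial>M)"
  proof (rule nn_integral_cong_AE, use lim in eventually_elim)
    case (elim x)
    have "(\<lambda>n. ennreal ((cmod (X n x))\<^sup>2 * w x)) \<longlonglongrightarrow> ennreal ((cmod (f x))\<^sup>2 * w x)"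
      by (intro tendsto_intros elim)
    then show ?case
      by (simp add: lim_imp_Liminf)
  qed
  also have "\<dots> \<le> liminf (\<lambda>n. \<integral>\<^sup>+x. ennreal ((cmod (X n x))\<^sup>2 * w x) \<partial>M)"
    by (rule nn_integral_liminf) measurable
  also have "\<dots> \<le> liminf (\<lambda>n. ennreal C)"
    unfolding X_eq by (intro Liminf_mono eventually_mono[OF bd] ennreal_leI)
  finally have le: "(\<integral>\<^sup>+x. ennreal ((cmod (f x))\<^sup>2 * w x) \<partial>M) \<le> ennreal C"
    by (simp add: Liminf_const)
  have int: "integrable M (\<lambda>x. (cmod (f x))\<^sup>2 * w x)"
  proof (rule integrableI_bounded)
    show "(\<integral>\<^sup>+x. ennreal (norm ((cmod (f x))\<^sup>2 * w x)) \<partial>M) < \<infinity>"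
      using le w_pos by (auto simp: abs_mult less_imp_le intro: le_less_trans)
  qed measurable
  then show "f \<in> L2w M w"
    by (simp add: L2w_def)
  \<comment> \<open>\<open>ennreal\<close> sends negative numbers to 0, so the extended bound can be
    read back in the reals only once C is known to be nonnegative.\<close>
  have "0 \<le> C"
  proof -
    obtain n where "(LINT x|M. (cmod (X n x))\<^sup>2 * w x) \<le> C"
      using bd eventually_happens' sequentially_bot by blast
    moreover have "0 \<le> (LINT x|M. (cmod (X n x))\<^sup>2 * w x)"
      using Re_ipw_nonneg[of "X n"] by (simp add: Re_ipw_self)
    ultimately show ?thesis by linarith
  qed
  moreover have "(\<integral>\<^sup>+x. ennreal ((cmod (f x))\<^sup>2 * w x) \<partial>M) = ennreal (LINT x|M. (cmod (f x))\<^sup>2 * w x)"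
    using w_pos by (intro nn_integral_eq_integral int AE_I2) (simp add: less_imp_le)
  ultimately show "(LINT x|M. (cmod (f x))\<^sup>2 * w x) \<le> C"
    using le by simp
qed

end

section \<open>Embedding of the weighted space into L1\<close>

lemma integrable_inverse_1_plus_sq: "integrable lborel (\<lambda>x::real. 1 / (1 + x\<^sup>2))"
  and integral_inverse_1_plus_sq: "(LINT x|lborel. 1 / (1 + x\<^sup>2)) = pi"
proof -
  show "integrable lborel (\<lambda>x::real. 1 / (1 + x\<^sup>2))"
    using integrable_inverse_1_plus_square by (simp add: set_integrable_def inverse_eq_divide)
  show "(LINT x|lborel. 1 / (1 + x\<^sup>2)) = pi"
    using LBINT_inverse_1_plus_square
    by (simp add: interval_lebesgue_integral_def set_lebesgue_integral_def inverse_eq_divide)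
qed

definition sobolev_weight :: "real \<Rightarrow> real" where
  "sobolev_weight x = 1 + x\<^sup>2"

lemma sobolev_weight_pos: "0 < sobolev_weight x"
  by (simp add: sobolev_weight_def add_pos_nonneg)

interpretation sob: weighted_L2 lborel sobolev_weight
proof unfold_locales
  show "sobolev_weight \<in> borel_measurable lborel"
    unfolding sobolev_weight_def[abs_def] by measurable
qed (rule sobolev_weight_pos)

text \<open>The inequality 2 a <= a^2 w / d + d / w with w = 1 + x^2, from a square. Integrated, it
  replaces Cauchy-Schwarz; the parameter d makes the resulting bound linear in the norm.\<close>

lemma sobolev_L1_pointwise:
  fixes a :: real
  assumes "0 < d"
  shows "a \<le> (a\<^sup>2 * sobolev_weight x / d + d * (1 / (1 + x\<^sup>2))) / 2"
proof -
  have *: "2 * b \<le> b\<^sup>2 * w / d + d * (1 / w)" if "0 < w" for b w :: real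
  proof -
    have "(d / w) * (w / d) = 1"
      using that assms by simp
    then have "b\<^sup>2 * (w / d) + d / w - 2 * b = (b - d / w)\<^sup>2 * (w / d)"
      by algebra
    moreover have "0 \<le> (b - d / w)\<^sup>2 * (w / d)"
      using that assms by simp
    ultimately show ?thesis by simp
  qed
  show ?thesis
    using *[of "1 + x\<^sup>2" a] sobolev_weight_pos[of x] unfolding sobolev_weight_def by simp
qed

lemma sobolev_imp_integrable:
  assumes "f \<in> L2w lborel sobolev_weight"
  shows "integrable lborel f"
proof (rule Bochner_Integration.integrable_bound)
  show "integrable lborel (\<lambda>x. ((cmod (f x))\<^sup>2 * sobolev_weight x / 1 + 1 * (1 / (1 + x\<^sup>2))) / 2)"
    using sob.integrable_sq[OF assms] integrable_inverse_1_plus_sq by simp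
  show "AE x in lborel. norm (f x) \<le> norm (((cmod (f x))\<^sup>2 * sobolev_weight x / 1 + 1 * (1 / (1 + x\<^sup>2))) / 2)"
    unfolding real_norm_def by (intro AE_I2 order_trans[OF sobolev_L1_pointwise[of 1] abs_ge_self]) simp
qed (use assms in \<open>auto dest: sob.measurableD\<close>)

text \<open>The integrated inequality gives (d + pi d) / 2, and 3 is a convenient constant above (1
  + pi) / 2. Linearity in d makes norm-Cauchy sequences L1-Cauchy, which also controls Fourier
  transforms uniformly.\<close>

lemma sobolev_L1_bound:
  assumes f: "f \<in> L2w lborel sobolev_weight" and d: "0 < d"
    and le: "(LINT x|lborel. (cmod (f x))\<^sup>2 * sobolev_weight x) \<le> d\<^sup>2"
  shows "(LINT x|lborel. cmod (f x)) \<le> 3 * d"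
proof -
  have "(LINT x|lborel. cmod (f x))
      \<le> (LINT x|lborel. ((cmod (f x))\<^sup>2 * sobolev_weight x / d + d * (1 / (1 + x\<^sup>2))) / 2)"
    by (intro integral_mono integrable_norm sobolev_imp_integrable[OF f] sobolev_L1_pointwise[OF d]
        Bochner_Integration.integrable_add integrable_divide integrable_mult_right
        sob.integrable_sq[OF f] integrable_inverse_1_plus_sq)
  also have "\<dots> = ((LINT x|lborel. (cmod (f x))\<^sup>2 * sobolev_weight x) / d + d * pi) / 2"
    using Bochner_Integration.integral_add[OF integrable_divide[OF sob.integrable_sq[OF f], of d]
        integrable_mult_right[OF integrable_inverse_1_plus_sq, of d]] integral_inverse_1_plus_sq
    by simp (simp add: divide_inverse)
  also have "\<dots> \<le> (d\<^sup>2 / d + d * 4) / 2"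
    using le d pi_less_4 by (intro divide_right_mono add_mono mult_left_mono) auto
  also have "\<dots> \<le> 3 * d"
    using d by (simp add: power2_eq_square)
  finally show ?thesis .
qed

section \<open>The Fourier transform of integrable functions\<close>

abbreviation fourier_kernel :: "real \<Rightarrow> real \<Rightarrow> complex" where
  "fourier_kernel t x \<equiv> exp (- 2 * of_real pi * \<i> * of_real t * of_real x)"

lemma norm_fourier_kernel [simp]: "cmod (fourier_kernel t x) = 1"
  by (simp add: norm_exp_eq_Re)

lemma integrable_fourier_kernel:
  assumes "integrable lborel f"
  shows "integrable lborel (\<lambda>x. f x * fourier_kernel t x)"
proof (rule Bochner_Integration.integrable_bound[OF assms])
  show "(\<lambda>x. f x * fourier_kernel t x) \<in> borel_measurable lborel"
    using borel_measurable_integrable[OF assms] by measurable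
qed (simp add: norm_mult del: of_real_mult)

lemma fourier_add:
  assumes "integrable lborel f" "integrable lborel g"
  shows "fourier (\<lambda>x. f x + g x) t = fourier f t + fourier g t"
  using Bochner_Integration.integral_add[OF assms[THEN integrable_fourier_kernel, of t]]
  by (simp add: fourier_def distrib_right)

lemma fourier_scale: "fourier (\<lambda>x. c * f x) t = c * fourier f t"
  by (simp add: fourier_def mult.assoc)

lemma fourier_diff:
  assumes "integrable lborel f" "integrable lborel g"
  shows "fourier (\<lambda>x. f x - g x) t = fourier f t - fourier g t"
  using fourier_add[OF assms(1) integrable_mult_right[OF assms(2), of "-1"], of t] fourier_scale[of "-1" g t]
  by simp

lemma norm_fourier_le:
  "cmod (fourier f t) \<le> (LINT x|lborel. cmod (f x))"
  using integral_norm_bound[of lborel "\<lambda>x. f x * fourier_kernel t x"]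
  by (simp add: fourier_def norm_mult del: of_real_mult)

lemma borel_measurable_fourier:
  assumes [measurable]: "f \<in> borel_measurable borel"
  shows "fourier f \<in> borel_measurable borel"
proof -
  have "(\<lambda>t. LINT x|lborel. f x * fourier_kernel t x) \<in> borel_measurable borel"
    by (rule sigma_finite_measure.borel_measurable_lebesgue_integral[OF sigma_finite_lborel])
      (simp add: split_beta', measurable)
  then show ?thesis by (simp add: fourier_def[abs_def])
qed

text \<open>Fubini applies because the kernel has modulus 1, and the kernel is symmetric in t and x.
  This formula does the work for which Plancherel would otherwise be called.\<close>

lemma fourier_multiplication:
  assumes f: "integrable lborel f" and g: "integrable lborel g"
  shows "(LINT t|lborel. fourier f t * g t) = (LINT x|lborel. f x * fourier g x)"
proof -
  have [measurable]: "f \<in> borel_measurable borel" "g \<in> borel_measurable borel"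
    using borel_measurable_integrable[OF f] borel_measurable_integrable[OF g] by auto
  have int: "integrable (lborel \<Otimes>\<^sub>M lborel) (\<lambda>(x, t). f x * fourier_kernel t x * g t)"
  proof (rule Bochner_Integration.integrable_bound)
    show "integrable (lborel \<Otimes>\<^sub>M lborel) (\<lambda>(x, t). f x * g t)"
      by (intro lborel_pair.Fubini_integrable)
        (use f g in \<open>auto simp: norm_mult intro!: integrable_norm integrable_mult_left integrable_mult_right\<close>)
    show "(\<lambda>(x, t). f x * fourier_kernel t x * g t) \<in> borel_measurable (lborel \<Otimes>\<^sub>M lborel)"
      by (simp add: split_beta', measurable)
  qed (auto simp: norm_mult simp del: of_real_mult)
  have "(LINT t|lborel. fourier f t * g t) = (LINT t|lborel. LINT x|lborel. f x * fourier_kernel t x * g t)"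
    by (simp only: fourier_def integral_mult_left_zero)
  also have "\<dots> = (LINT x|lborel. LINT t|lborel. f x * fourier_kernel t x * g t)"
    by (rule lborel_pair.Fubini_integral[OF int])
  also have "\<dots> = (LINT x|lborel. f x * fourier g x)"
  proof (rule Bochner_Integration.integral_cong[OF refl])
    fix x
    have "(LINT t|lborel. f x * fourier_kernel t x * g t) = (LINT t|lborel. f x * (g t * fourier_kernel x t))"
      by (simp only: mult_ac)
    then show "(LINT t|lborel. f x * fourier_kernel t x * g t) = f x * fourier g x"
      by (simp only: fourier_def integral_mult_right_zero)
  qed
  finally show ?thesis .
qed

section \<open>Hermite polynomials and Gaussian integrals\<close>

text \<open>The physicists' Hermite polynomials by their recursion, over a general field: the
  Hermite functions use real arguments, while the generating function and the Cauchy estimates live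
  in the complex plane.\<close>

fun herm :: "nat \<Rightarrow> 'a::real_normed_field \<Rightarrow> 'a" where
  "herm 0 x = 1"
| "herm (Suc 0) x = 2 * x"
| "herm (Suc (Suc n)) x = 2 * x * herm (Suc n) x - 2 * of_nat (Suc n) * herm n x"

text \<open>At n = 0 the truncated n - 1 is harmless, since its coefficient vanishes.\<close>

lemma herm_Suc: "herm (Suc n) x = 2 * x * herm n x - 2 * of_nat n * herm (n - 1) x"
  by (cases n) auto

lemma of_real_herm: "of_real (herm n x) = (herm n (of_real x) :: 'a::real_normed_field)"
  by (induction n x rule: herm.induct) auto

text \<open>Differentiating the recursion for index n + 2 gives 2 H_(n+1) plus 2 (n + 1) times an
  expression that the recursion folds back into H_(n+1).\<close>

lemma has_field_derivative_herm:
  "(herm n has_field_derivative 2 * of_nat n * herm (n - 1) x) (at x)"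
proof (induction n "x" rule: herm.induct)
  case (3 n x)
  have "((\<lambda>x. 2 * x * herm (Suc n) x - 2 * of_nat (Suc n) * herm n x) has_field_derivative
      2 * herm (Suc n) x + 2 * x * (2 * of_nat (Suc n) * herm n x)
        - 2 * of_nat (Suc n) * (2 * of_nat n * herm (n - 1) x)) (at x)"
    using 3 by (auto intro!: derivative_eq_intros)
  also have "2 * herm (Suc n) x + 2 * x * (2 * of_nat (Suc n) * herm n x)
        - 2 * of_nat (Suc n) * (2 * of_nat n * herm (n - 1) x)
      = 2 * herm (Suc n) x + 2 * of_nat (Suc n) * (2 * x * herm n x - 2 * of_nat n * herm (n - 1) x)"
    by (simp only: right_diff_distrib add_diff_eq mult_ac)
  also have "\<dots> = 2 * of_nat (Suc (Suc n)) * herm (Suc (Suc n) - 1) x"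
    unfolding herm_Suc[of n x, symmetric] by (simp add: distrib_right distrib_left)
  finally show ?case by simp
qed (auto intro!: derivative_eq_intros simp: fun_eq_iff)

lemma continuous_herm [continuous_intros]:
  fixes f :: "'b::topological_space \<Rightarrow> 'a::real_normed_field"
  shows "continuous_on S f \<Longrightarrow> continuous_on S (\<lambda>x. herm n (f x))"
  using continuous_on_compose2[of UNIV "herm n" S f] has_field_derivative_herm DERIV_isCont
  by (metis continuous_at_imp_continuous_on subset_UNIV)

lemma borel_measurable_herm [measurable]:
  "(herm n :: real \<Rightarrow> real) \<in> borel_measurable borel"
  by (intro borel_measurable_continuous_onI continuous_intros)

lemma higher_deriv_gaussian:
  "(deriv ^^ n) (\<lambda>y::real. exp (- y\<^sup>2)) = (\<lambda>y. (-1) ^ n * herm n y * exp (- y\<^sup>2))"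
proof (induction n)
  case (Suc n)
  have "deriv (\<lambda>y::real. (-1) ^ n * herm n y * exp (- y\<^sup>2)) y = (-1) ^ Suc n * herm (Suc n) y * exp (- y\<^sup>2)" for y
    by (rule DERIV_imp_deriv)
      (auto intro!: derivative_eq_intros has_field_derivative_herm simp: herm_Suc[of n] algebra_simps)
  then show ?case by (simp add: Suc fun_eq_iff)
qed auto

lemma hermite_eq_herm: "hermite n x = herm n x"
proof -
  have "hermite n x = ((-1) * (-1)) ^ n * (exp (x\<^sup>2) * exp (- x\<^sup>2)) * herm n x"
    unfolding hermite_def higher_deriv_gaussian power_mult_distrib by (simp only: mult_ac)
  then show ?thesis
    by (simp flip: exp_add)
qed

text \<open>Up to the factor exp(t^2) the function is a Gaussian in t - z, so differentiation in z
  reproduces Hermite polynomials at t - z. At z = 0 this gives the Taylor coefficients of the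
  generating function.\<close>

lemma higher_deriv_hermite_generating:
  "(deriv ^^ n) (\<lambda>z::complex. exp (2 * t * z - z\<^sup>2)) = (\<lambda>z. herm n (t - z) * exp (2 * t * z - z\<^sup>2))"
proof (induction n)
  case (Suc n)
  have "deriv (\<lambda>z. herm n (t - z) * exp (2 * t * z - z\<^sup>2)) z = herm (Suc n) (t - z) * exp (2 * t * z - z\<^sup>2)" for z
  proof (rule DERIV_imp_deriv)
    have "((\<lambda>z. herm n (t - z)) has_field_derivative 2 * of_nat n * herm (n - 1) (t - z) * (- 1)) (at z)"
      by (rule DERIV_chain2[OF has_field_derivative_herm]) (auto intro!: derivative_eq_intros)
    then show "((\<lambda>z. herm n (t - z) * exp (2 * t * z - z\<^sup>2)) has_field_derivative
        herm (Suc n) (t - z) * exp (2 * t * z - z\<^sup>2)) (at z)"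
      by (auto intro!: derivative_eq_intros simp: herm_Suc[of n] algebra_simps)
  qed
  then show ?case by (simp add: Suc fun_eq_iff)
qed auto

lemma hermite_generating:
  fixes t z :: complex
  shows "(\<lambda>n. herm n t / fact n * z ^ n) sums exp (2 * t * z - z\<^sup>2)"
proof -
  have "(\<lambda>n. (deriv ^^ n) (\<lambda>z. exp (2 * t * z - z\<^sup>2)) 0 / fact n * (z - 0) ^ n) sums exp (2 * t * z - z\<^sup>2)"
    by (rule holomorphic_power_series[where r = "cmod z + 1"]) (auto intro!: holomorphic_intros)
  then show ?thesis by (simp add: higher_deriv_hermite_generating)
qed

text \<open>Cauchy's estimate for the generating function on the circle of radius r. The radius
  stays free: a large r gives geometric decay in the generating series, r = 1 a crude growth bound
  for fixed n.\<close>

lemma norm_herm_le: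
  fixes t :: complex
  assumes "0 < r"
  shows "cmod (herm n t) \<le> fact n * exp (2 * cmod t * r + r\<^sup>2) / r ^ n"
proof -
  have "cmod ((deriv ^^ n) (\<lambda>z. exp (2 * t * z - z\<^sup>2)) 0) \<le> fact n * exp (2 * cmod t * r + r\<^sup>2) / r ^ n"
  proof (rule Cauchy_inequality)
    fix z :: complex assume z: "cmod (0 - z) = r"
    have "cmod (exp (2 * t * z - z\<^sup>2)) \<le> exp (cmod (2 * t * z - z\<^sup>2))"
      by (rule norm_exp)
    also have "cmod (2 * t * z - z\<^sup>2) \<le> 2 * cmod t * cmod z + (cmod z)\<^sup>2"
      using norm_triangle_ineq4[of "2 * t * z" "z\<^sup>2"] by (simp add: norm_mult norm_power)
    then have "exp (cmod (2 * t * z - z\<^sup>2)) \<le> exp (2 * cmod t * r + r\<^sup>2)"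
      using z by simp
    finally show "cmod (exp (2 * t * z - z\<^sup>2)) \<le> exp (2 * cmod t * r + r\<^sup>2)" .
  qed (auto intro!: holomorphic_intros continuous_intros assms)
  then show ?thesis by (simp add: higher_deriv_hermite_generating)
qed

lemma abs_herm_le:
  fixes t :: real
  assumes "0 < r"
  shows "\<bar>herm n t\<bar> \<le> fact n * exp (2 * \<bar>t\<bar> * r + r\<^sup>2) / r ^ n"
  using norm_herm_le[OF assms, of n "of_real t"] by (simp flip: of_real_herm)

text \<open>Integrability against every exponential in |t|, which dominates both the Hermite
  polynomials and exp(2 t z). It is the class in which the generating series may be integrated term
  by term.\<close>

definition exp_integrable :: "(real \<Rightarrow> complex) \<Rightarrow> bool" where
  "exp_integrable f \<longleftrightarrow> f \<in> borel_measurable borel \<and>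
     (\<forall>c. integrable lborel (\<lambda>t. cmod (f t) * exp (c * \<bar>t\<bar>)))"

lemma exp_integrable_bound:
  assumes f: "exp_integrable f" and [measurable]: "g \<in> borel_measurable borel"
    and le: "\<And>t. cmod (g t) \<le> cmod (f t) * (K * exp (c * \<bar>t\<bar>))"
  shows "integrable lborel g"
proof (rule Bochner_Integration.integrable_bound)
  show "integrable lborel (\<lambda>t. K * (cmod (f t) * exp (c * \<bar>t\<bar>)))"
    using f by (intro integrable_mult_right) (auto simp: exp_integrable_def)
  show "AE t in lborel. norm (g t) \<le> norm (K * (cmod (f t) * exp (c * \<bar>t\<bar>)))"
    using le by (intro AE_I2 order_trans[OF le]) (simp add: mult_ac)
qed simp

text \<open>Hermite integrals are read off below by expanding the same entire function of z in two
  ways.\<close>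

lemma power_series_coeff_unique:
  fixes a b :: "nat \<Rightarrow> complex"
  assumes "\<And>z. (\<lambda>n. a n * z ^ n) sums F z" "\<And>z. (\<lambda>n. b n * z ^ n) sums F z"
  shows "a n = b n"
proof -
  have "(deriv ^^ n) F 0 / fact n = c n" if *: "\<And>z. (\<lambda>n. c n * z ^ n) sums F z" for c
  proof -
    have "F has_fps_expansion Abs_fps c"
      unfolding has_fps_expansion_def
    proof
      have "conv_radius c = \<infinity>"
        using * by (intro conv_radius_inftyI'') (auto simp: sums_iff)
      then show "0 < fps_conv_radius (Abs_fps c)"
        by (simp add: fps_conv_radius_def)
      show "\<forall>\<^sub>F z in nhds 0. eval_fps (Abs_fps c) z = F z"
        using * by (simp add: eval_fps_def sums_iff)
    qed
    then show ?thesis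
      using fps_nth_fps_expansion by fastforce
  qed
  from this[OF assms(1)] this[OF assms(2)] show ?thesis by simp
qed

text \<open>The engine of the computations: the Hermite moments of f are the Taylor coefficients of
  its integral against the generating function. Sum and integral are exchanged by a geometric
  majorant.\<close>

lemma hermite_interchange:
  assumes f: "exp_integrable f"
  shows "(\<lambda>n. (LINT t|lborel. f t * of_real (herm n t)) / fact n * z ^ n) sums
      (LINT t|lborel. f t * exp (2 * of_real t * z - z\<^sup>2))"
proof -
  \<comment> \<open>This radius gives |z| / r <= 1/2, hence the factor (1/2)^n; the summand 1 keeps
    r positive when z = 0.\<close>
  define r where "r = 2 * cmod z + 1"
  have r: "0 < r"
    unfolding r_def by (rule add_nonneg_pos) auto
  moreover have "cmod z * 2 \<le> r"
    by (simp add: r_def)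
  ultimately have zr: "cmod z / r \<le> 1 / 2"
    by (simp add: field_simps)
  define F where "F n t = f t * (of_real (herm n t) / fact n * z ^ n)" for n t
  let ?K = "exp (r\<^sup>2)"
  have [measurable]: "f \<in> borel_measurable borel"
    using f by (simp add: exp_integrable_def)
  have [measurable]: "F n \<in> borel_measurable borel" for n
    unfolding F_def by measurable
  have le: "cmod (F n t) \<le> cmod (f t) * (?K * (1 / 2) ^ n * exp (2 * r * \<bar>t\<bar>))" for n t
  proof -
    have "\<bar>herm n t\<bar> / fact n * cmod z ^ n \<le> (fact n * exp (2 * \<bar>t\<bar> * r + r\<^sup>2) / r ^ n) / fact n * cmod z ^ n"
      by (intro mult_right_mono divide_right_mono abs_herm_le r) auto
    also have "\<dots> = exp (2 * \<bar>t\<bar> * r + r\<^sup>2) * (cmod z / r) ^ n"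
      by (simp add: power_divide)
    also have "\<dots> \<le> exp (2 * \<bar>t\<bar> * r + r\<^sup>2) * (1 / 2) ^ n"
      using r zr by (intro mult_left_mono power_mono) auto
    also have "\<dots> = ?K * (1 / 2) ^ n * exp (2 * r * \<bar>t\<bar>)"
      by (simp add: exp_add mult_ac)
    finally have "cmod (f t) * (\<bar>herm n t\<bar> / fact n * cmod z ^ n)
        \<le> cmod (f t) * (?K * (1 / 2) ^ n * exp (2 * r * \<bar>t\<bar>))"
      by (rule mult_left_mono) simp
    then show ?thesis
      unfolding F_def by (simp add: norm_mult norm_divide norm_power)
  qed
  have int: "integrable lborel (F n)" for n
    by (rule exp_integrable_bound[OF f _ le]) measurable
  have "(\<lambda>n. integral\<^sup>L lborel (F n)) sums (LINT t|lborel. (\<Sum>n. F n t))"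
  proof (rule sums_integral[OF int])
    show "AE t in lborel. summable (\<lambda>n. norm (F n t))"
    proof (rule AE_I2, rule summable_comparison_test'[where N = 0])
      fix t
      show "summable (\<lambda>n. cmod (f t) * (?K * (1 / 2) ^ n * exp (2 * r * \<bar>t\<bar>)))"
        by (intro summable_mult summable_mult2 summable_geometric) auto
      show "norm (norm (F n t)) \<le> cmod (f t) * (?K * (1 / 2) ^ n * exp (2 * r * \<bar>t\<bar>))" for n
        using le by simp
    qed
    have intb: "integrable lborel (\<lambda>t. cmod (f t) * exp (2 * r * \<bar>t\<bar>))"
      using f by (simp add: exp_integrable_def)
    show "summable (\<lambda>n. LINT t|lborel. norm (F n t))"
    proof (rule summable_comparison_test'[where N = 0])
      show "summable (\<lambda>n. (1 / 2) ^ n * (?K * (LINT t|lborel. cmod (f t) * exp (2 * r * \<bar>t\<bar>))))"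
        by (intro summable_mult2 summable_geometric) auto
      fix n
      have "(LINT t|lborel. norm (F n t)) \<le> (LINT t|lborel. (1 / 2) ^ n * ?K * (cmod (f t) * exp (2 * r * \<bar>t\<bar>)))"
        using le[of n] by (intro integral_mono integrable_norm int integrable_mult_right intb) (simp add: mult_ac)
      then show "norm (LINT t|lborel. norm (F n t)) \<le> (1 / 2) ^ n * (?K * (LINT t|lborel. cmod (f t) * exp (2 * r * \<bar>t\<bar>)))"
        by (simp add: mult.assoc)
    qed
  qed
  moreover have "(\<Sum>n. F n t) = f t * exp (2 * of_real t * z - z\<^sup>2)" for t
    unfolding F_def using sums_unique[OF sums_mult[OF hermite_generating[of "of_real t" z], of "f t"]]
    by (simp add: of_real_herm)
  moreover have "integral\<^sup>L lborel (F n) = (LINT t|lborel. f t * of_real (herm n t)) / fact n * z ^ n" for n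
    unfolding F_def
    by (simp flip: integral_mult_left_zero integral_divide_zero add: mult.assoc)
  ultimately show ?thesis by simp
qed

section \<open>Gaussian decay and Gaussian integrals\<close>

lemma integrable_exp_neg_sq:
  assumes "0 < \<alpha>"
  shows "integrable lborel (\<lambda>t::real. exp (- \<alpha> * t\<^sup>2))"
proof -
  have "integrable lborel (\<lambda>t. sqrt (pi / \<alpha>) * normal_density 0 (1 / sqrt (2 * \<alpha>)) t)"
    using assms by (intro integrable_mult_right integrable_normal_density) simp_all
  also have "(\<lambda>t. sqrt (pi / \<alpha>) * normal_density 0 (1 / sqrt (2 * \<alpha>)) t) = (\<lambda>t. exp (- \<alpha> * t\<^sup>2))"
    using assms by (simp add: normal_density_def fun_eq_iff power_divide real_sqrt_divide mult.commute)
  finally show ?thesis .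
qed

lemma exp_integrable_gaussian:
  assumes [measurable]: "f \<in> borel_measurable borel" and "0 < \<alpha>"
    and le: "\<And>t. cmod (f t) \<le> K * exp (C * \<bar>t\<bar> - \<alpha> * t\<^sup>2)"
  shows "exp_integrable f"
  unfolding exp_integrable_def
proof (intro conjI allI)
  fix c
  \<comment> \<open>Half of the Gaussian absorbs the exponential: \<open>?D\<close> is the constant
    left after completing the square in (C + c) |t| - (\<alpha> / 2) t^2.\<close>
  let ?D = "(C + c)\<^sup>2 / (2 * \<alpha>)"
  have K: "0 \<le> K" using le[of 0] norm_ge_zero[of "f 0"] by (simp del: norm_ge_zero)
  show "integrable lborel (\<lambda>t. cmod (f t) * exp (c * \<bar>t\<bar>))"
  proof (rule Bochner_Integration.integrable_bound)
    show "integrable lborel (\<lambda>t. K * exp ?D * exp (- (\<alpha> / 2) * t\<^sup>2))"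
      using assms by (intro integrable_mult_right integrable_exp_neg_sq) simp
    have "cmod (f t) * exp (c * \<bar>t\<bar>) \<le> K * exp ?D * exp (- (\<alpha> / 2) * t\<^sup>2)" for t
    proof -
      have "0 \<le> ((C + c) - \<alpha> * \<bar>t\<bar>)\<^sup>2 / (2 * \<alpha>)"
        using assms by simp
      also have "\<dots> = ?D - (C + c) * \<bar>t\<bar> + \<alpha> / 2 * t\<^sup>2"
        using assms by (simp add: power2_diff diff_divide_distrib add_divide_distrib power_mult_distrib)
          (simp add: power2_eq_square)
      finally have *: "C * \<bar>t\<bar> - \<alpha> * t\<^sup>2 + c * \<bar>t\<bar> \<le> ?D + - (\<alpha> / 2) * t\<^sup>2"
        by (simp add: algebra_simps)
      have "cmod (f t) * exp (c * \<bar>t\<bar>) \<le> K * exp (C * \<bar>t\<bar> - \<alpha> * t\<^sup>2) * exp (c * \<bar>t\<bar>)"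
        by (intro mult_right_mono le) simp
      also have "\<dots> = K * exp (C * \<bar>t\<bar> - \<alpha> * t\<^sup>2 + c * \<bar>t\<bar>)"
        by (simp only: exp_add mult.assoc)
      also have "\<dots> \<le> K * exp (?D + - (\<alpha> / 2) * t\<^sup>2)"
        using K * by (intro mult_left_mono) auto
      also have "\<dots> = K * exp ?D * exp (- (\<alpha> / 2) * t\<^sup>2)"
        by (simp only: exp_add mult.assoc)
      finally show ?thesis .
    qed
    then show "AE t in lborel. norm (cmod (f t) * exp (c * \<bar>t\<bar>)) \<le> norm (K * exp ?D * exp (- (\<alpha> / 2) * t\<^sup>2))"
      using K by (intro AE_I2) (simp add: abs_mult)
  qed measurable
qed simp

lemma LINT_affine:
  fixes f :: "real \<Rightarrow> complex"
  assumes "c \<noteq> 0"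
  shows "(LINT x|lborel. f x) = of_real \<bar>c\<bar> * (LINT x|lborel. f (a + c * x))"
  using lborel_integral_real_affine[OF assms, of f a] by (simp add: scaleR_conv_of_real)

text \<open>The imaginary part of \<open>u\<close> is handled by the characteristic function of the normal
  distribution, the real part by a translation.\<close>
lemma gaussian_integral:
  fixes u :: complex
  shows
  "(LINT t|lborel. exp (of_real t * u - of_real (t\<^sup>2 / 2))) = of_real (sqrt (2 * pi)) * exp (u\<^sup>2 / 2)"
proof -
  define a where "a = Re u"
  define b where "b = Im u"
  have u: "u = of_real a + \<i> * of_real b"
    by (simp add: a_def b_def complex_eq_iff)
  have s2: "sqrt (2 * pi) \<noteq> 0" by simp
  have "of_real (exp (- (b\<^sup>2) / 2)) = char std_normal_distribution b"
    by (simp add: char_std_normal_distribution)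
  also have "\<dots> = (LINT x|lborel. std_normal_density x *\<^sub>R iexp (b * x))"
    unfolding char_def by (subst integral_density) (auto simp: normal_density_nonneg)
  also have "\<dots> = (LINT x|lborel. iexp (b * x) * of_real (exp (- x\<^sup>2 / 2)) / of_real (sqrt (2 * pi)))"
    by (intro Bochner_Integration.integral_cong) (auto simp: std_normal_density_def scaleR_conv_of_real)
  finally have 1: "(LINT x|lborel. iexp (b * x) * of_real (exp (- x\<^sup>2 / 2))) = of_real (sqrt (2 * pi)) * of_real (exp (- (b\<^sup>2) / 2))"
    using s2 by (simp add: field_simps)
  have "(LINT t|lborel. exp (of_real t * u - of_real (t\<^sup>2 / 2)))
      = (LINT t|lborel. exp (of_real (a + 1 * t) * u - of_real ((a + 1 * t)\<^sup>2 / 2)))"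
    using LINT_affine[of 1 "\<lambda>t. exp (of_real t * u - of_real (t\<^sup>2 / 2))" a] by simp
  also have "\<dots> = (LINT t|lborel. exp (of_real a * u - of_real (a\<^sup>2 / 2)) * (iexp (b * t) * of_real (exp (- t\<^sup>2 / 2))))"
    by (intro Bochner_Integration.integral_cong)
      (auto simp: u exp_add[symmetric] exp_of_real[symmetric] power2_sum add_divide_distrib simp flip: exp_add intro!: arg_cong[where f = exp], simp add: algebra_simps)
  also have "\<dots> = exp (of_real a * u - of_real (a\<^sup>2 / 2)) * (of_real (sqrt (2 * pi)) * of_real (exp (- (b\<^sup>2) / 2)))"
    using 1 by simp
  also have "\<dots> = of_real (sqrt (2 * pi)) * exp (of_real a * u - of_real (a\<^sup>2 / 2) + of_real (- (b\<^sup>2) / 2))"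
    by (simp only: exp_add exp_of_real mult_ac)
  also have "of_real a * u - of_real (a\<^sup>2 / 2) + of_real (- (b\<^sup>2) / 2) = u\<^sup>2 / 2"
    by (simp add: u power2_sum power_mult_distrib field_simps) (simp add: power2_eq_square)
  finally show ?thesis .
qed

lemma gaussian_integral':
  fixes z :: complex
  shows
  "(LINT t|lborel. exp (2 * of_real t * z - of_real (t\<^sup>2))) = of_real (sqrt pi) * exp (z\<^sup>2)"
proof -
  let ?f = "\<lambda>t. exp (of_real t * (of_real (sqrt 2) * z) - of_real (t\<^sup>2 / 2))"
  have "?f (0 + sqrt 2 * t) = exp (2 * of_real t * z - of_real (t\<^sup>2))" for t
  proof -
    have "of_real (0 + sqrt 2 * t) * (of_real (sqrt 2) * z) = (of_real (sqrt 2 * sqrt 2) * of_real t * z :: complex)"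
      by (simp only: of_real_mult add_0 mult_ac)
    also have "\<dots> = 2 * of_real t * z"
      by (simp only: real_sqrt_mult_self) simp
    finally have 1: "of_real (0 + sqrt 2 * t) * (of_real (sqrt 2) * z) = 2 * of_real t * z" .
    have 2: "(0 + sqrt 2 * t)\<^sup>2 / 2 = t\<^sup>2" by (simp add: power_mult_distrib)
    show ?thesis by (simp only: 1 2)
  qed
  then have "(LINT t|lborel. ?f t) = of_real (sqrt 2) * (LINT t|lborel. exp (2 * of_real t * z - of_real (t\<^sup>2)))"
    using LINT_affine[of "sqrt 2" ?f 0] by simp
  also have "(LINT t|lborel. ?f t) = of_real (sqrt (2 * pi)) * exp ((of_real (sqrt 2) * z)\<^sup>2 / 2)"
    by (rule gaussian_integral)
  also have "(of_real (sqrt 2) * z)\<^sup>2 / 2 = z\<^sup>2"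
    by (simp add: power_mult_distrib flip: of_real_power)
  finally show ?thesis
    by (simp add: real_sqrt_mult)
qed

section \<open>Hermite functions\<close>

text \<open>The Gaussian here is exp(-(t - w)^2). Its integral against the generating function is
  sqrt(pi) exp(2 w z), and the coefficients in z are compared.\<close>

lemma hermite_gaussian_moment:
  fixes w :: complex
  shows
  "(LINT t|lborel. exp (2 * of_real t * w - w\<^sup>2 - of_real (t\<^sup>2)) * of_real (herm n t))
     = of_real (sqrt pi) * (2 * w) ^ n"
proof -
  define f :: "real \<Rightarrow> complex" where "f t = exp (2 * of_real t * w - w\<^sup>2 - of_real (t\<^sup>2))" for t
  have f: "exp_integrable f"
  proof (rule exp_integrable_gaussian)
    show "f \<in> borel_measurable borel" unfolding f_def by measurable
    fix t
    have "cmod (f t) = exp (2 * t * Re w - Re (w\<^sup>2) - t\<^sup>2)"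
      by (simp add: f_def norm_exp_eq_Re Re_power2)
    also have "\<dots> \<le> exp (cmod (w\<^sup>2) + (2 * cmod w * \<bar>t\<bar> - 1 * t\<^sup>2))"
    proof -
      have "t * Re w \<le> \<bar>t\<bar> * cmod w"
        by (rule order_trans[OF _ mult_left_mono[OF abs_Re_le_cmod abs_ge_zero]])
          (simp add: abs_mult[symmetric])
      moreover have "- Re (w\<^sup>2) \<le> cmod (w\<^sup>2)"
        using abs_Re_le_cmod[of "w\<^sup>2"] by linarith
      ultimately show ?thesis
        unfolding exp_le_cancel_iff by (simp only: mult.assoc mult.commute[of "cmod w"])
    qed
    also have "\<dots> = exp (cmod (w\<^sup>2)) * exp (2 * cmod w * \<bar>t\<bar> - 1 * t\<^sup>2)"
      by (rule exp_add)
    finally show "cmod (f t) \<le> exp (cmod (w\<^sup>2)) * exp (2 * cmod w * \<bar>t\<bar> - 1 * t\<^sup>2)" .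
  qed simp
  let ?F = "\<lambda>z. LINT t|lborel. f t * exp (2 * of_real t * z - z\<^sup>2)"
  have F: "?F z = of_real (sqrt pi) * exp (2 * w * z)" for z
  proof -
    have "?F z = (LINT t|lborel. exp (- (w\<^sup>2 + z\<^sup>2)) * exp (2 * of_real t * (w + z) - of_real (t\<^sup>2)))"
      unfolding f_def by (simp only: exp_add[symmetric]) (simp add: algebra_simps)
    also have "\<dots> = exp (- (w\<^sup>2 + z\<^sup>2)) * (of_real (sqrt pi) * exp ((w + z)\<^sup>2))"
      by (simp only: integral_mult_right_zero gaussian_integral')
    also have "\<dots> = of_real (sqrt pi) * exp (- (w\<^sup>2 + z\<^sup>2) + (w + z)\<^sup>2)"
      by (simp only: exp_add mult_ac)
    also have "- (w\<^sup>2 + z\<^sup>2) + (w + z)\<^sup>2 = 2 * w * z"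
      by (simp add: power2_sum)
    finally show ?thesis .
  qed
  have "(\<lambda>n. of_real (sqrt pi) * (2 * w) ^ n / fact n * z ^ n) sums ?F z" for z
    unfolding F using sums_mult[OF exp_converges[of "2 * w * z"], of "of_real (sqrt pi)"]
    by (simp add: scaleR_conv_of_real power_mult_distrib field_simps)
  then have "(LINT t|lborel. f t * of_real (herm n t)) / fact n = of_real (sqrt pi) * (2 * w) ^ n / fact n"
    by (rule power_series_coeff_unique[OF hermite_interchange[OF f]])
  then show ?thesis by (simp add: f_def)
qed

text \<open>The bounded factor u makes room for the oscillating exponential in the Fourier
  transform; elsewhere u = 1.\<close>

lemma exp_integrable_hermite_gaussian:
  fixes u :: "real \<Rightarrow> complex"
  assumes [measurable]: "u \<in> borel_measurable borel" and u: "\<And>t. cmod (u t) \<le> 1" and \<alpha>: "0 < \<alpha>"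
  shows "exp_integrable (\<lambda>t. of_real (herm n t * exp (- \<alpha> * t\<^sup>2)) * u t)"
proof (rule exp_integrable_gaussian[OF _ \<alpha>])
  fix t
  have "cmod (of_real (herm n t * exp (- \<alpha> * t\<^sup>2)) * u t) \<le> \<bar>herm n t\<bar> * exp (- \<alpha> * t\<^sup>2) * 1"
    unfolding norm_mult norm_of_real abs_mult by (intro mult_mono u) auto
  also have "\<dots> \<le> (fact n * exp (2 * \<bar>t\<bar> * 1 + 1\<^sup>2) / 1 ^ n) * exp (- \<alpha> * t\<^sup>2) * 1"
    by (intro mult_right_mono abs_herm_le) auto
  also have "\<dots> = fact n * (exp 1 * (exp (2 * \<bar>t\<bar>) * exp (- \<alpha> * t\<^sup>2)))"
    by (simp add: exp_add)
  also have "exp (2 * \<bar>t\<bar>) * exp (- \<alpha> * t\<^sup>2) = exp (2 * \<bar>t\<bar> - \<alpha> * t\<^sup>2)"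
    unfolding exp_add[symmetric] by simp
  also have "fact n * (exp 1 * exp (2 * \<bar>t\<bar> - \<alpha> * t\<^sup>2)) = (fact n * exp 1) * exp (2 * \<bar>t\<bar> - \<alpha> * t\<^sup>2)"
    by (simp only: mult.assoc)
  finally show "cmod (of_real (herm n t * exp (- \<alpha> * t\<^sup>2)) * u t) \<le> (fact n * exp 1) * exp (2 * \<bar>t\<bar> - \<alpha> * t\<^sup>2)" .
qed measurable

text \<open>Integrated against H_n(t) exp(-t^2), the generating function yields the preceding moment
  with w = z. That is a single monomial in z, so every coefficient except the n-th vanishes.\<close>

lemma hermite_orthogonal:
  "(LINT t|lborel. complex_of_real (herm n t * exp (- t\<^sup>2)) * of_real (herm m t))
     = (if m = n then of_real (sqrt pi * 2 ^ n * fact n) else 0)"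
proof -
  define f :: "real \<Rightarrow> complex" where "f t = of_real (herm n t * exp (- t\<^sup>2))" for t
  have f: "exp_integrable f"
    using exp_integrable_hermite_gaussian[of "\<lambda>_. 1" 1 n] by (simp add: f_def[abs_def])
  let ?F = "\<lambda>z. LINT t|lborel. f t * exp (2 * of_real t * z - z\<^sup>2)"
  have F: "?F z = of_real (sqrt pi) * (2 * z) ^ n" for z
  proof -
    have "?F z = (LINT t|lborel. exp (2 * of_real t * z - z\<^sup>2 - of_real (t\<^sup>2)) * of_real (herm n t))"
    proof (rule Bochner_Integration.integral_cong[OF refl])
      fix t
      have "exp (2 * of_real t * z - z\<^sup>2 - of_real (t\<^sup>2)) = exp (2 * of_real t * z - z\<^sup>2) * exp (of_real (- t\<^sup>2))"
        unfolding exp_add[symmetric] by simp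
      then show "f t * exp (2 * of_real t * z - z\<^sup>2) = exp (2 * of_real t * z - z\<^sup>2 - of_real (t\<^sup>2)) * of_real (herm n t)"
        by (simp add: f_def exp_of_real del: of_real_minus)
    qed
    then show ?thesis by (simp only: hermite_gaussian_moment)
  qed
  let ?b = "\<lambda>m. if m = n then of_real (sqrt pi) * 2 ^ n else (0 :: complex)"
  have "(\<lambda>m. ?b m * z ^ m) sums ?F z" for z
  proof -
      have "(\<lambda>m. if m = n then of_real (sqrt pi) * 2 ^ n * z ^ m else 0) sums (of_real (sqrt pi) * 2 ^ n * z ^ n)"
        by (rule sums_single)
      moreover have "(\<lambda>m. ?b m * z ^ m) = (\<lambda>m. if m = n then of_real (sqrt pi) * 2 ^ n * z ^ m else 0)"
        by auto
      ultimately show ?thesis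
        unfolding F by (simp add: power_mult_distrib mult.assoc)
  qed
  then have "(LINT t|lborel. f t * of_real (herm m t)) / fact m = ?b m"
    by (rule power_series_coeff_unique[OF hermite_interchange[OF f]])
  then show ?thesis by (auto simp: f_def field_simps split: if_splits)
qed

lemma sqrt_2pi_pos: "0 < sqrt (2 * pi)"
  by simp

lemma sqrt_2pi_sq: "(sqrt (2 * pi))\<^sup>2 = 2 * pi"
  by simp

text \<open>The Hermite functions without normalising constant, dilated by sqrt(2 pi) so that they
  are eigenfunctions for the kernel exp(-2 pi i t x).\<close>

definition hfun :: "nat \<Rightarrow> real \<Rightarrow> complex" where
  "hfun n x = of_real (herm n (sqrt (2 * pi) * x) * exp (- pi * x\<^sup>2))"

text \<open>The substitution inside the Bargmann integral undoes the dilation and leaves the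
  classical H_n(t) exp(-t^2 / 2).\<close>

lemma hfun_scaled: "hfun n (t / sqrt (2 * pi)) = of_real (herm n t * exp (- (1 / 2) * t\<^sup>2))"
proof -
  have "- pi * (t / sqrt (2 * pi))\<^sup>2 = - (1 / 2) * t\<^sup>2"
    by (simp only: power_divide sqrt_2pi_sq) simp
  moreover have "sqrt (2 * pi) * (t / sqrt (2 * pi)) = t" by simp
  ultimately show ?thesis by (simp only: hfun_def)
qed

lemma cnj_hfun [simp]: "cnj (hfun n x) = hfun n x"
  by (simp add: hfun_def)

lemma borel_measurable_hfun [measurable]: "hfun n \<in> borel_measurable borel"
  unfolding hfun_def[abs_def] by measurable

lemma LINT_2pi:
  fixes f :: "real \<Rightarrow> complex"
  shows "(LINT x|lborel. f x) = (LINT t|lborel. f (t / sqrt (2 * pi))) / of_real (sqrt (2 * pi))"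
  using LINT_affine[of "1 / sqrt (2 * pi)" f 0] by simp

lemma integrable_2pi_iff:
  fixes f :: "real \<Rightarrow> 'a::{banach, second_countable_topology}"
  shows "integrable lborel (\<lambda>t. f (t / sqrt (2 * pi))) \<longleftrightarrow> integrable lborel f"
  using lborel_integrable_real_affine_iff[of "1 / sqrt (2 * pi)" f 0] by simp

text \<open>In |g|^2 times the weight, one factor |g| is kept for its decay, while the other factor
  and the weight are bounded by exponentials. The cast to complex values fits
  \<open>exp_integrable_bound\<close>.\<close>

lemma hfun_L2w: "hfun n \<in> L2w lborel sobolev_weight"
proof -
  define g :: "real \<Rightarrow> complex" where "g t = of_real (herm n t * exp (- (1 / 2) * t\<^sup>2))" for t
  have g: "exp_integrable g"
    using exp_integrable_hermite_gaussian[of "\<lambda>_. 1" "1 / 2" n] by (simp add: g_def[abs_def])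
  have [measurable]: "g \<in> borel_measurable borel"
    using g by (simp add: exp_integrable_def)
  have "integrable lborel (\<lambda>t. complex_of_real ((cmod (g t))\<^sup>2 * sobolev_weight (t / sqrt (2 * pi))))"
  proof (rule exp_integrable_bound[OF g])
    show "(\<lambda>t. complex_of_real ((cmod (g t))\<^sup>2 * sobolev_weight (t / sqrt (2 * pi)))) \<in> borel_measurable borel"
      unfolding sobolev_weight_def by measurable
    fix t
    have w: "sobolev_weight (t / sqrt (2 * pi)) \<le> 2 * exp \<bar>t\<bar>"
    proof -
      have "t\<^sup>2 / (2 * pi) \<le> t\<^sup>2 / 2"
        using pi_ge_two by (intro divide_left_mono) auto
      then have "sobolev_weight (t / sqrt (2 * pi)) \<le> 1 + \<bar>t\<bar> + \<bar>t\<bar>\<^sup>2 / 2"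
        by (simp only: sobolev_weight_def power_divide sqrt_2pi_sq power2_abs)
      also have "\<dots> \<le> exp \<bar>t\<bar>"
        by (rule exp_lower_Taylor_quadratic) simp
      finally show ?thesis by (smt (verit) exp_gt_zero)
    qed
    have b: "cmod (g t) \<le> (fact n * exp 1) * exp (2 * \<bar>t\<bar>)"
    proof -
      have "cmod (g t) = \<bar>herm n t\<bar> * exp (- (1 / 2) * t\<^sup>2)"
        by (simp add: g_def abs_mult norm_mult del: of_real_mult)
      also have "\<dots> \<le> \<bar>herm n t\<bar> * 1"
        by (intro mult_left_mono) auto
      also have "\<dots> \<le> fact n * exp (2 * \<bar>t\<bar> * 1 + 1\<^sup>2) / 1 ^ n"
        using abs_herm_le[of 1 n t] by simp
      finally show ?thesis by (simp add: exp_add mult_ac)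
    qed
    have "(cmod (g t))\<^sup>2 * sobolev_weight (t / sqrt (2 * pi))
        \<le> (cmod (g t) * ((fact n * exp 1) * exp (2 * \<bar>t\<bar>))) * (2 * exp \<bar>t\<bar>)"
      unfolding power2_eq_square using b w sobolev_weight_pos
      by (intro mult_mono mult_left_mono) (auto simp: less_imp_le)
    also have "\<dots> = cmod (g t) * ((2 * fact n * exp 1) * (exp (2 * \<bar>t\<bar>) * exp \<bar>t\<bar>))"
      by (simp only: mult_ac)
    also have "exp (2 * \<bar>t\<bar>) * exp \<bar>t\<bar> = exp (3 * \<bar>t\<bar>)"
      unfolding exp_add[symmetric] by simp
    finally show "cmod (complex_of_real ((cmod (g t))\<^sup>2 * sobolev_weight (t / sqrt (2 * pi))))
        \<le> cmod (g t) * ((2 * fact n * exp 1) * exp (3 * \<bar>t\<bar>))"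
      using sobolev_weight_pos[of "t / sqrt (2 * pi)"] by (simp only: norm_of_real) (simp add: abs_mult)
  qed
  then have "integrable lborel (\<lambda>t. (cmod (g t))\<^sup>2 * sobolev_weight (t / sqrt (2 * pi)))"
    by (simp only: complex_of_real_integrable_eq)
  then have "integrable lborel (\<lambda>t. (cmod (hfun n (t / sqrt (2 * pi))))\<^sup>2 * sobolev_weight (t / sqrt (2 * pi)))"
    by (simp only: hfun_scaled g_def)
  then have "integrable lborel (\<lambda>x. (cmod (hfun n x))\<^sup>2 * sobolev_weight x)"
    using integrable_2pi_iff[of "\<lambda>x. (cmod (hfun n x))\<^sup>2 * sobolev_weight x"] by simp
  then show ?thesis by (simp add: L2w_def)
qed

lemma integrable_hfun: "integrable lborel (hfun n)"
  by (rule sobolev_imp_integrable[OF hfun_L2w])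

lemma hfun_orthogonal:
  "(LINT x|lborel. hfun n x * hfun m x) = (if m = n then of_real (2 ^ n * fact n / sqrt 2) else 0)"
proof -
  have *: "hfun n (t / sqrt (2 * pi)) * hfun m (t / sqrt (2 * pi)) = of_real (herm n t * exp (- t\<^sup>2)) * of_real (herm m t)" for t
  proof -
    have "exp (- (1 / 2) * t\<^sup>2) * exp (- (1 / 2) * t\<^sup>2) = exp (- t\<^sup>2)"
      unfolding exp_add[symmetric] by simp
    then have "(herm n t * exp (- (1 / 2) * t\<^sup>2)) * (herm m t * exp (- (1 / 2) * t\<^sup>2)) = (herm n t * exp (- t\<^sup>2)) * herm m t"
      by (simp only: mult_ac)
    then show ?thesis
      unfolding hfun_scaled by (simp only: of_real_mult[symmetric])
  qed
  have "(LINT x|lborel. hfun n x * hfun m x)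
      = (if m = n then of_real (sqrt pi * 2 ^ n * fact n) else 0) / of_real (sqrt (2 * pi))"
    unfolding LINT_2pi[of "\<lambda>x. hfun n x * hfun m x"] * hermite_orthogonal ..
  also have "\<dots> = (if m = n then of_real (2 ^ n * fact n / sqrt 2) else 0)"
    by (simp add: real_sqrt_mult)
  finally show ?thesis .
qed

text \<open>The transform of the whole generating function is a Gaussian integral that reproduces
  the generating function at -i z. Comparing coefficients of z^n leaves the factor (-i)^n.\<close>

lemma fourier_hfun: "fourier (hfun n) \<xi> = (- \<i>) ^ n * hfun n \<xi>"
proof -
  let ?s = "sqrt (2 * pi)"
  define f :: "real \<Rightarrow> complex" where
    "f t = of_real (exp (- (1 / 2) * t\<^sup>2)) * exp (- \<i> * of_real (?s * \<xi> * t))" for t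
  have f: "exp_integrable f"
    using exp_integrable_hermite_gaussian[of "\<lambda>t. exp (- \<i> * of_real (?s * \<xi> * t))" "1 / 2" 0]
    by (simp add: f_def[abs_def] norm_exp_eq_Re)
  let ?F = "\<lambda>z. LINT t|lborel. f t * exp (2 * of_real t * z - z\<^sup>2)"
  have F: "?F z = of_real ?s * of_real (exp (- pi * \<xi>\<^sup>2)) * exp (2 * of_real (?s * \<xi>) * (- \<i> * z) - (- \<i> * z)\<^sup>2)" for z
  proof -
    let ?u = "2 * z - \<i> * of_real (?s * \<xi>)"
    have "?F z = (LINT t|lborel. exp (- (z\<^sup>2)) * exp (of_real t * ?u - of_real (t\<^sup>2 / 2)))"
    proof (rule Bochner_Integration.integral_cong[OF refl])
      fix t
      show "f t * exp (2 * of_real t * z - z\<^sup>2) = exp (- (z\<^sup>2)) * exp (of_real t * ?u - of_real (t\<^sup>2 / 2))"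
        unfolding f_def exp_of_real[symmetric] exp_add[symmetric]
        by (rule arg_cong[where f = exp]) (simp add: algebra_simps)
    qed
    also have "\<dots> = exp (- (z\<^sup>2)) * (of_real ?s * exp (?u\<^sup>2 / 2))"
      by (simp only: integral_mult_right_zero gaussian_integral)
    also have "\<dots> = of_real ?s * exp (- (z\<^sup>2) + ?u\<^sup>2 / 2)"
      by (simp only: exp_add mult_ac)
    \<comment> \<open>With c = sqrt(2 pi) \<xi> both sides equal z^2 - 2 i c z - c^2 / 2.\<close>
    also have "- (z\<^sup>2) + ?u\<^sup>2 / 2 = of_real (- pi * \<xi>\<^sup>2) + (2 * of_real (?s * \<xi>) * (- \<i> * z) - (- \<i> * z)\<^sup>2)"
    proof -
      define c where "c = complex_of_real (?s * \<xi>)"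
      have "c\<^sup>2 = of_real (2 * pi * \<xi>\<^sup>2)"
        unfolding c_def of_real_power[symmetric] power_mult_distrib sqrt_2pi_sq ..
      then have "of_real (- pi * \<xi>\<^sup>2) = - (c\<^sup>2) / 2" by simp
      then show ?thesis
        unfolding c_def[symmetric] by (simp add: power2_eq_square field_simps)
    qed
    also have "exp \<dots> = of_real (exp (- pi * \<xi>\<^sup>2)) * exp (2 * of_real (?s * \<xi>) * (- \<i> * z) - (- \<i> * z)\<^sup>2)"
      by (simp only: exp_add exp_of_real)
    finally show ?thesis by (simp only: mult.assoc)
  qed
  have "(\<lambda>n. of_real ?s * ((- \<i>) ^ n * hfun n \<xi>) / fact n * z ^ n) sums ?F z" for z
  proof -
      have "of_real ?s * ((- \<i>) ^ n * hfun n \<xi>) / fact n * z ^ n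
          = of_real ?s * of_real (exp (- pi * \<xi>\<^sup>2)) * (herm n (of_real (?s * \<xi>)) / fact n * (- \<i> * z) ^ n)" for n
        unfolding hfun_def of_real_mult[of "herm n _"] of_real_herm power_mult_distrib by (simp only: mult_ac times_divide_eq_right times_divide_eq_left)
      then show ?thesis
        unfolding F using sums_mult[OF hermite_generating[of "of_real (?s * \<xi>)" "- \<i> * z"]] by presburger
  qed
  then have "(LINT t|lborel. f t * of_real (herm n t)) / fact n = of_real ?s * ((- \<i>) ^ n * hfun n \<xi>) / fact n"
    by (rule power_series_coeff_unique[OF hermite_interchange[OF f]])
  then have *: "(LINT t|lborel. f t * of_real (herm n t)) = of_real ?s * ((- \<i>) ^ n * hfun n \<xi>)"
    by simp
  have "fourier (hfun n) \<xi> = (LINT t|lborel. hfun n (t / ?s) * fourier_kernel \<xi> (t / ?s)) / of_real ?s"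
    unfolding fourier_def by (rule LINT_2pi)
  also have "(\<lambda>t. hfun n (t / ?s) * fourier_kernel \<xi> (t / ?s)) = (\<lambda>t. f t * of_real (herm n t))"
  proof
    fix t
    have "2 * pi * \<xi> * (t / ?s) = ?s * \<xi> * t"
      using sqrt_2pi_sq sqrt_2pi_pos by (simp add: field_simps power2_eq_square)
    moreover have "- 2 * of_real pi * \<i> * of_real \<xi> * of_real (t / ?s) = - \<i> * of_real (2 * pi * \<xi> * (t / ?s))"
      by simp
    ultimately have "fourier_kernel \<xi> (t / ?s) = exp (- \<i> * of_real (?s * \<xi> * t))"
      by (simp only:)
    then show "hfun n (t / ?s) * fourier_kernel \<xi> (t / ?s) = f t * of_real (herm n t)"
      unfolding hfun_scaled f_def of_real_mult[of "herm n _"] by (simp only: mult_ac)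
  qed
  finally show ?thesis
    unfolding * by simp
qed

text \<open>The three-term recursion applied twice; for \<open>n < 2\<close> the last coefficient vanishes.\<close>
lemma sq_mult_hfun:
  "of_real (x\<^sup>2) * hfun n x = 1 / (2 * of_real pi) *
     (hfun (n + 2) x / 4 + (of_nat n + 1 / 2) * hfun n x + of_nat n * (of_nat n - 1) * hfun (n - 2) x)"
proof -
  have *: "s\<^sup>2 * herm n s = herm (n + 2) s / 4 + (real n + 1 / 2) * herm n s + real n * (real n - 1) * herm (n - 2) s"
    for s :: real
  proof -
    have 1: "2 * s * herm n s = herm (Suc n) s + 2 * real n * herm (n - 1) s" for n
      using herm_Suc[of n s] by simp
    have "4 * (s\<^sup>2 * herm n s) = 2 * s * (2 * s * herm n s)"
      by (simp add: power2_eq_square)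
    also have "\<dots> = 2 * s * (herm (Suc n) s + 2 * real n * herm (n - 1) s)"
      by (simp only: 1)
    also have "\<dots> = 2 * s * herm (Suc n) s + 2 * real n * (2 * s * herm (n - 1) s)"
      by (simp only: distrib_left mult_ac)
    also have "\<dots> = herm (Suc (Suc n)) s + 2 * real (Suc n) * herm n s
        + 2 * real n * (herm (Suc (n - 1)) s + 2 * real (n - 1) * herm (n - 1 - 1) s)"
      by (simp only: 1) simp
    also have "\<dots> = herm (n + 2) s + (4 * real n + 2) * herm n s + 4 * (real n * (real n - 1)) * herm (n - 2) s"
      by (cases n) (auto simp: algebra_simps numeral_2_eq_2)
    finally have "4 * (s\<^sup>2 * herm n s)
        = herm (n + 2) s + (4 * real n + 2) * herm n s + 4 * (real n * (real n - 1)) * herm (n - 2) s" .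
    moreover have "X = A / 4 + (N + 1 / 2) * B + N * (N - 1) * C"
      if "4 * X = A + (4 * N + 2) * B + 4 * (N * (N - 1)) * C" for X A B C N :: real
      using that by (simp add: field_simps)
    ultimately show ?thesis by blast
  qed
  let ?s = "sqrt (2 * pi) * x"
  have "?s\<^sup>2 = 2 * pi * x\<^sup>2"
    by (simp add: power_mult_distrib)
  then have "x\<^sup>2 * herm n ?s = 1 / (2 * pi) * (?s\<^sup>2 * herm n ?s)"
    by simp
  then have eq: "x\<^sup>2 * herm n ?s = 1 / (2 * pi) *
     (herm (n + 2) ?s / 4 + (real n + 1 / 2) * herm n ?s + real n * (real n - 1) * herm (n - 2) ?s)"
    unfolding * .
  have **: "X * Y * E = c * ((A * E) / 4 + p * (B * E) + q * (C * E))"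
    if "X * Y = c * (A / 4 + p * B + q * C)" for X Y A B C E c p q :: real
    unfolding that by (simp add: algebra_simps)
  have "x\<^sup>2 * (herm n ?s * exp (- pi * x\<^sup>2)) = 1 / (2 * pi) *
     ((herm (n + 2) ?s * exp (- pi * x\<^sup>2)) / 4 + (real n + 1 / 2) * (herm n ?s * exp (- pi * x\<^sup>2))
       + real n * (real n - 1) * (herm (n - 2) ?s * exp (- pi * x\<^sup>2)))"
    unfolding mult.assoc[symmetric, of "x\<^sup>2"] by (rule **[OF eq])
  then have "complex_of_real (x\<^sup>2 * (herm n ?s * exp (- pi * x\<^sup>2))) = of_real (1 / (2 * pi) *
     ((herm (n + 2) ?s * exp (- pi * x\<^sup>2)) / 4 + (real n + 1 / 2) * (herm n ?s * exp (- pi * x\<^sup>2))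
       + real n * (real n - 1) * (herm (n - 2) ?s * exp (- pi * x\<^sup>2))))"
    by (simp only:)
  then show ?thesis
    unfolding hfun_def by simp
qed

section \<open>The target space of the Bargmann transform\<close>

lemma nn_integral_lborel_plus:
  fixes f :: "'a::euclidean_space \<Rightarrow> ennreal"
  assumes [measurable]: "f \<in> borel_measurable borel"
  shows "(\<integral>\<^sup>+x. f (c + x) \<partial>lborel) = (\<integral>\<^sup>+x. f x \<partial>lborel)"
  by (subst (2) lborel_distr_plus[of c, symmetric], subst nn_integral_distr) auto

text \<open>Uniqueness of Haar measure in disguise: the indicator of the unit ball is invariant under
  rotations, so convolving with it and applying Fubini transfers the rotation.\<close>
lemma nn_integral_rotation:
  fixes f :: "complex \<Rightarrow> ennreal"
  assumes [measurable]: "f \<in> borel_measurable borel" and u: "cmod u = 1"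
  shows "(\<integral>\<^sup>+z. f (u * z) \<partial>lborel) = (\<integral>\<^sup>+z. f z \<partial>lborel)"
proof -
  define g :: "complex \<Rightarrow> ennreal" where "g = indicator (ball 0 1)"
  define V where "V = (\<integral>\<^sup>+z. g z \<partial>lborel)"
  have [measurable]: "g \<in> borel_measurable borel"
    unfolding g_def by (rule borel_measurable_indicator) simp
  have V: "V \<noteq> 0" "V \<noteq> \<infinity>"
    by (simp_all add: V_def g_def emeasure_ball unit_ball_vol_2)
  have u0: "u \<noteq> 0" using u by auto
  have g_rot: "g (- (x / u) + y) = g (- (u * y) + x)" for x y
  proof -
    have "cmod (- (x / u) + y) = cmod (u * (- (x / u) + y))"
      using u by (simp add: norm_mult)
    also have "u * (- (x / u) + y) = - (- (u * y) + x)"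
      using u0 by (simp add: field_simps)
    finally show ?thesis by (simp only: norm_minus_cancel g_def indicator_def mem_ball dist_0_norm)
  qed
  have "(\<integral>\<^sup>+z. f z \<partial>lborel) * V = (\<integral>\<^sup>+y. (\<integral>\<^sup>+x. f x * g y \<partial>lborel) \<partial>lborel)"
    unfolding V_def by (simp add: nn_integral_multc nn_integral_cmult)
  also have "\<dots> = (\<integral>\<^sup>+y. (\<integral>\<^sup>+x. f (u * y + x) * g y \<partial>lborel) \<partial>lborel)"
    by (simp add: nn_integral_multc nn_integral_lborel_plus)
  also have "\<dots> = (\<integral>\<^sup>+x. (\<integral>\<^sup>+y. f (u * y + x) * g y \<partial>lborel) \<partial>lborel)"
    by (rule lborel_pair.Fubini') (simp add: split_beta', measurable)
  \<comment> \<open>The shift by -x / u removes x from the argument of f. After \<open>g_rot\<close>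
    only g depends on x, and integrating over x first returns V.\<close>
  also have "\<dots> = (\<integral>\<^sup>+x. (\<integral>\<^sup>+y. f (u * (- (x / u) + y) + x) * g (- (x / u) + y) \<partial>lborel) \<partial>lborel)"
  proof (rule nn_integral_cong)
    fix x
    show "(\<integral>\<^sup>+y. f (u * y + x) * g y \<partial>lborel) = (\<integral>\<^sup>+y. f (u * (- (x / u) + y) + x) * g (- (x / u) + y) \<partial>lborel)"
      by (rule nn_integral_lborel_plus[of "\<lambda>y. f (u * y + x) * g y", symmetric]) measurable
  qed
  also have "\<dots> = (\<integral>\<^sup>+x. (\<integral>\<^sup>+y. f (u * y) * g (- (u * y) + x) \<partial>lborel) \<partial>lborel)"
  proof -
    have "u * (- (x / u) + y) + x = u * y" for x y
      using u0 by (simp add: field_simps)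
    then show ?thesis by (simp only: g_rot)
  qed
  also have "\<dots> = (\<integral>\<^sup>+y. (\<integral>\<^sup>+x. f (u * y) * g (- (u * y) + x) \<partial>lborel) \<partial>lborel)"
    by (rule lborel_pair.Fubini') (simp add: split_beta', measurable)
  also have "\<dots> = (\<integral>\<^sup>+y. f (u * y) \<partial>lborel) * V"
  proof -
    have "(\<integral>\<^sup>+x. f (u * y) * g (- (u * y) + x) \<partial>lborel) = f (u * y) * V" for y
      unfolding V_def nn_integral_lborel_plus[of g "- (u * y)", symmetric, OF \<open>g \<in> borel_measurable borel\<close>]
      by (rule nn_integral_cmult) measurable
    then show ?thesis by (simp only:) (rule nn_integral_multc, measurable)
  qed
  finally have "V * (\<integral>\<^sup>+z. f z \<partial>lborel) = V * (\<integral>\<^sup>+z. f (u * z) \<partial>lborel)"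
    by (simp only: mult.commute)
  then show ?thesis
    using V by (subst (asm) ennreal_mult_cancel_left) auto
qed

text \<open>The nonnegative version applied to indicators shows that the rotation preserves Lebesgue
  measure, which gives the statement for vector-valued integrands.\<close>

lemma LINT_rotation:
  fixes f :: "complex \<Rightarrow> 'a::{banach, second_countable_topology}"
  assumes [measurable]: "f \<in> borel_measurable borel" and u: "cmod u = 1"
  shows "(LINT z|lborel. f (u * z)) = (LINT z|lborel. f z)"
proof -
  have "distr lborel borel (\<lambda>z. u * z) = lborel"
  proof (rule measure_eqI)
    fix A assume "A \<in> sets (distr lborel borel (\<lambda>z. u * z))"
    then have [measurable]: "A \<in> sets borel" by simp
    have "emeasure (distr lborel borel (\<lambda>z. u * z)) A = (\<integral>\<^sup>+z. indicator A z \<partial>distr lborel borel (\<lambda>z. u * z))"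
      by simp
    also have "\<dots> = (\<integral>\<^sup>+z. indicator A (u * z) \<partial>lborel)"
      by (rule nn_integral_distr) auto
    also have "\<dots> = (\<integral>\<^sup>+z. indicator A z \<partial>lborel)"
      by (rule nn_integral_rotation[OF _ u]) auto
    finally show "emeasure (distr lborel borel (\<lambda>z. u * z)) A = emeasure lborel A"
      by simp
  qed simp
  then have "(LINT z|lborel. f z) = (LINT z|distr lborel borel (\<lambda>z. u * z). f z)"
    by simp
  also have "\<dots> = (LINT z|lborel. f (u * z))"
    by (rule integral_distr) auto
  finally show ?thesis ..
qed

text \<open>The disc of radius sqrt(s) has area pi s, so both measures agree on the half-lines below
  s, which generate the Borel sets. This replaces polar coordinates.\<close>

lemma distr_cmod_sq:
  "distr lborel borel (\<lambda>z::complex. (cmod z)\<^sup>2) = density lborel (\<lambda>s. ennreal pi * indicator {0..} s)"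
  (is "?M = ?N")
proof (rule measure_eqI_generator_eq)
  let ?E = "range (\<lambda>s::real. {..<s})"
  show "Int_stable ?E"
  proof -
    have "{..<a} \<inter> {..<b} = {..<min a b}" for a b :: real by auto
    then show ?thesis by (auto simp: Int_stable_def)
  qed
  show "?E \<subseteq> Pow UNIV" by simp
  show "sets ?M = sigma_sets UNIV ?E" "sets ?N = sigma_sets UNIV ?E"
    by (simp_all add: borel_Iio sets_measure_of)
  have M: "emeasure ?M {..<s} = ennreal (pi * max 0 s)" for s
  proof -
    have "emeasure ?M {..<s} = emeasure lborel ((\<lambda>z::complex. (cmod z)\<^sup>2) -` {..<s})"
      by (subst emeasure_distr) auto
    also have "(\<lambda>z::complex. (cmod z)\<^sup>2) -` {..<s} = ball 0 (sqrt (max 0 s))"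
    proof (cases "0 \<le> s")
      case True
      have "(cmod z)\<^sup>2 < s \<longleftrightarrow> cmod z < sqrt s" for z
        using True real_less_lsqrt real_sqrt_less_iff[of "(cmod z)\<^sup>2" s] by simp
      then show ?thesis using True by auto
    next
      case False
      have "\<not> (cmod z)\<^sup>2 < s" for z
        using False zero_le_power2[of "cmod z"] by linarith
      then show ?thesis using False by auto
    qed
    finally show ?thesis
      by (simp add: emeasure_ball unit_ball_vol_2)
  qed
  have N: "emeasure ?N {..<s} = ennreal (pi * max 0 s)" for s
  proof -
    have "emeasure ?N {..<s} = (\<integral>\<^sup>+x. ennreal pi * indicator {0..<s} x \<partial>lborel)"
      by (subst emeasure_density) (auto intro!: nn_integral_cong simp: indicator_def)
    also have "\<dots> = ennreal pi * emeasure lborel {0..<s}"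
      by (simp add: nn_integral_cmult)
    also have "emeasure lborel {0..<s} = ennreal (max 0 s)"
      by (cases "0 \<le> s") auto
    finally show ?thesis by (simp add: ennreal_mult)
  qed
  show "emeasure ?M X = emeasure ?N X" if "X \<in> ?E" for X
    using that M N by auto
  show "range (\<lambda>n::nat. {..<real n}) \<subseteq> ?E" by auto
  show "(\<Union>n::nat. {..<real n}) = UNIV"
    using reals_Archimedean2 by auto
  show "emeasure ?M {..<real n} \<noteq> \<infinity>" for n
    unfolding M by simp
qed

lemma nn_integral_radial:
  assumes [measurable]: "f \<in> borel_measurable borel"
  shows "(\<integral>\<^sup>+z. f ((cmod z)\<^sup>2) \<partial>(lborel :: complex measure)) = ennreal pi * (\<integral>\<^sup>+s. f s * indicator {0..} s \<partial>lborel)"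
proof -
  have "(\<integral>\<^sup>+z. f ((cmod z)\<^sup>2) \<partial>(lborel :: complex measure)) = (\<integral>\<^sup>+s. f s \<partial>distr lborel borel (\<lambda>z::complex. (cmod z)\<^sup>2))"
    by (subst nn_integral_distr) auto
  also have "\<dots> = (\<integral>\<^sup>+s. ennreal pi * indicator {0..} s * f s \<partial>lborel)"
    unfolding distr_cmod_sq by (subst nn_integral_density) auto
  also have "\<dots> = ennreal pi * (\<integral>\<^sup>+s. f s * indicator {0..} s \<partial>lborel)"
    by (subst nn_integral_cmult[symmetric]) (auto simp: mult_ac)
  finally show ?thesis .
qed

lemma nn_integral_power_exp_2:
  "(\<integral>\<^sup>+s. ennreal (s ^ k * exp (- 2 * s)) * indicator {0..} s \<partial>lborel) = ennreal (fact k / 2 ^ (k + 1))"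
proof -
  let ?f = "\<lambda>s::real. ennreal (s ^ k * exp (- s)) * indicator {0..} s"
  have "ennreal (fact k) = (\<integral>\<^sup>+s. ?f s \<partial>lborel)"
    unfolding nn_intergal_power_times_exp_Ici by (simp flip: ennreal_of_nat_eq_real_of_nat)
  also have "\<dots> = ennreal \<bar>2\<bar> * (\<integral>\<^sup>+s. ?f (0 + 2 * s) \<partial>lborel)"
    by (rule nn_integral_real_affine) auto
  also have "(\<integral>\<^sup>+s. ?f (0 + 2 * s) \<partial>lborel) = (\<integral>\<^sup>+s. ennreal (2 ^ k) * (ennreal (s ^ k * exp (- 2 * s)) * indicator {0..} s) \<partial>lborel)"
    by (intro nn_integral_cong)
      (auto simp: indicator_def power_mult_distrib mult.assoc ennreal_mult[symmetric])
  also have "\<dots> = ennreal (2 ^ k) * (\<integral>\<^sup>+s. ennreal (s ^ k * exp (- 2 * s)) * indicator {0..} s \<partial>lborel)"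
    by (rule nn_integral_cmult) auto
  finally have "ennreal (fact k) = ennreal (2 ^ (k + 1)) * (\<integral>\<^sup>+s. ennreal (s ^ k * exp (- 2 * s)) * indicator {0..} s \<partial>lborel)"
    by (simp add: mult.assoc ennreal_mult)
  moreover have "ennreal (fact k) = ennreal (2 ^ (k + 1)) * ennreal (fact k / 2 ^ (k + 1))"
    by (subst ennreal_mult[symmetric]) auto
  ultimately have "ennreal (2 ^ (k + 1)) * (\<integral>\<^sup>+s. ennreal (s ^ k * exp (- 2 * s)) * indicator {0..} s \<partial>lborel)
      = ennreal (2 ^ (k + 1)) * ennreal (fact k / 2 ^ (k + 1))"
    by simp
  then show ?thesis
    by (subst (asm) ennreal_mult_cancel_left) (auto simp del: power_Suc)
qed

lemma has_bochner_integral_gaussian_moment: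
  "has_bochner_integral (lborel :: complex measure) (\<lambda>z. (cmod z) ^ (2 * k) * exp (- 2 * (cmod z)\<^sup>2)) (pi * fact k / 2 ^ (k + 1))"
proof (rule has_bochner_integral_nn_integral)
  have "(\<integral>\<^sup>+z. ennreal ((cmod z) ^ (2 * k) * exp (- 2 * (cmod z)\<^sup>2)) \<partial>(lborel :: complex measure))
      = (\<integral>\<^sup>+z. ennreal (((cmod z)\<^sup>2) ^ k * exp (- 2 * (cmod z)\<^sup>2)) \<partial>(lborel :: complex measure))"
    by (simp only: power_mult)
  also have "\<dots> = ennreal pi * ennreal (fact k / 2 ^ (k + 1))"
    unfolding nn_integral_power_exp_2[symmetric]
    by (rule nn_integral_radial[of "\<lambda>s. ennreal (s ^ k * exp (- 2 * s))"]) measurable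
  also have "\<dots> = ennreal (pi * fact k / 2 ^ (k + 1))"
    by (subst ennreal_mult[symmetric]) auto
  finally show "(\<integral>\<^sup>+z. ennreal ((cmod z) ^ (2 * k) * exp (- 2 * (cmod z)\<^sup>2)) \<partial>(lborel :: complex measure)) = ennreal (pi * fact k / 2 ^ (k + 1))" .
qed auto

definition fock_moment :: "nat \<Rightarrow> real" where
  "fock_moment n = pi * fact n / 2 ^ (n + 1) * (real n + 2 * pi + 1 / 2)"

lemma fock_moment_pos: "0 < fock_moment n"
  by (simp add: fock_moment_def add_nonneg_pos add_pos_pos)

text \<open>The term 2 |z|^2 raises the Gaussian moment from n to n + 1 and so multiplies it by n +
  1. Adding 2 pi - 1/2 gives n + 2 pi + 1/2.\<close>

lemma has_bochner_integral_B1_moment: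
  "has_bochner_integral lborel (\<lambda>z. (cmod z) ^ (2 * n) * B1_weight z) (fock_moment n)"
proof -
  have "has_bochner_integral (lborel :: complex measure)
      (\<lambda>z. (2 * pi - 1 / 2) * ((cmod z) ^ (2 * n) * exp (- 2 * (cmod z)\<^sup>2)) + 2 * ((cmod z) ^ (2 * Suc n) * exp (- 2 * (cmod z)\<^sup>2)))
      ((2 * pi - 1 / 2) * (pi * fact n / 2 ^ (n + 1)) + 2 * (pi * fact (Suc n) / 2 ^ (Suc n + 1)))"
    by (intro has_bochner_integral_add has_bochner_integral_mult_right has_bochner_integral_gaussian_moment)
  also have "(\<lambda>z. (2 * pi - 1 / 2) * ((cmod z) ^ (2 * n) * exp (- 2 * (cmod z)\<^sup>2)) + 2 * ((cmod z) ^ (2 * Suc n) * exp (- 2 * (cmod z)\<^sup>2)))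
      = (\<lambda>z. (cmod z) ^ (2 * n) * B1_weight z)"
    by (simp add: fun_eq_iff B1_weight_def power2_eq_square algebra_simps)
  also have "(2 * pi - 1 / 2) * (pi * fact n / 2 ^ (n + 1)) + 2 * (pi * fact (Suc n) / 2 ^ (Suc n + 1)) = fock_moment n"
    by (simp add: fock_moment_def field_simps)
  finally show ?thesis .
qed

section \<open>The target space as an inner product space\<close>

lemma B1_weight_pos: "0 < B1_weight z"
  using pi_ge_two unfolding B1_weight_def by (intro mult_pos_pos add_pos_nonneg) auto

lemma borel_measurable_B1_weight [measurable]: "B1_weight \<in> borel_measurable borel"
  unfolding B1_weight_def[abs_def] by measurable

interpretation fock: weighted_L2 lborel B1_weight
  by unfold_locales (simp_all add: B1_weight_pos)

lemma borel_measurable_indicator_cball [measurable]: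
  "indicat_real (cball c R) \<in> borel_measurable borel"
  by (rule borel_measurable_indicator) simp

lemma holomorphic_borel_measurable: "F holomorphic_on UNIV \<Longrightarrow> F \<in> borel_measurable borel"
  by (intro borel_measurable_continuous_onI holomorphic_on_imp_continuous_on)

lemma B1_iff: "F \<in> B1 \<longleftrightarrow> F holomorphic_on UNIV \<and> F \<in> L2w lborel B1_weight"
  by (auto simp: B1_def L2w_def dest: holomorphic_borel_measurable)

lemma B1_ip_eq: "B1_ip F G = ipw lborel B1_weight F G"
  by (simp add: B1_ip_def ipw_def)

text \<open>Balls have positive measure, so a continuous function vanishing almost everywhere
  vanishes. This is why plain equality is the right identification in \<open>B1\<close>.\<close>

lemma AE_eq_0_continuous:
  fixes F :: "'a::euclidean_space \<Rightarrow> 'b::real_normed_vector"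
  assumes "continuous_on UNIV F" "AE z in lborel. F z = 0"
  shows "F z = 0"
proof (rule ccontr)
  assume "F z \<noteq> 0"
  moreover have "open (F -` (- {0}))"
    using assms(1) by (intro open_vimage) auto
  ultimately obtain e where e: "0 < e" "ball z e \<subseteq> F -` (- {0})"
    by (metis openE vimageI ComplI singletonD)
  have "AE x in lborel. x \<notin> ball z e"
    using assms(2) by eventually_elim (use e in auto)
  then have "emeasure lborel (ball z e) = 0"
    by (subst (asm) AE_iff_null_sets[symmetric]) auto
  then show False
    using e(1) unit_ball_vol_pos[of "real DIM('a)"] by (simp add: emeasure_ball)
qed

interpretation B1: pre_hilbert B1 "(=)" B1_ip
proof unfold_locales
  show "(\<lambda>x. 0) \<in> B1"
    by (auto simp: B1_iff fock.zero_closed)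
  show "(\<lambda>x. f x + g x) \<in> B1" if "f \<in> B1" "g \<in> B1" for f g
    using that by (auto simp: B1_iff fock.add_closed intro: holomorphic_intros)
  show "(\<lambda>x. c * f x) \<in> B1" if "f \<in> B1" for c f
    using that by (auto simp: B1_iff fock.scale_closed intro: holomorphic_intros)
  show "B1_ip (\<lambda>x. f x + g x) h = B1_ip f h + B1_ip g h" if "f \<in> B1" "g \<in> B1" "h \<in> B1" for f g h
    using that by (simp add: B1_iff B1_ip_eq fock.ipw_add_left)
  show "B1_ip (\<lambda>x. c * f x) h = c * B1_ip f h" for c f h
    by (simp add: B1_ip_eq fock.ipw_scale_left)
  show "B1_ip g f = cnj (B1_ip f g)" for f g
    unfolding B1_ip_eq by (rule fock.ipw_hermitian)
  show "0 \<le> Re (B1_ip f f)" for f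
    unfolding B1_ip_eq by (rule fock.Re_ipw_nonneg)
  show "f = g \<longleftrightarrow> B1_ip (\<lambda>x. f x - g x) (\<lambda>x. f x - g x) = 0" if "f \<in> B1" "g \<in> B1" for f g
  proof -
    let ?d = "\<lambda>x. f x - g x"
    have d: "?d \<in> L2w lborel B1_weight" "continuous_on UNIV ?d"
      using that by (auto simp: B1_iff fock.diff_closed intro!: holomorphic_on_imp_continuous_on holomorphic_intros)
    have "B1_ip ?d ?d = 0 \<longleftrightarrow> (AE x in lborel. ?d x = 0)"
      unfolding B1_ip_eq by (rule fock.ipw_self_eq_0_iff[OF d(1)])
    also have "\<dots> \<longleftrightarrow> f = g"
    proof
      assume "AE x in lborel. ?d x = 0"
      then have "?d x = 0" for x
        by (rule AE_eq_0_continuous[OF d(2)])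
      then show "f = g" by (simp add: fun_eq_iff)
    qed simp
    finally show ?thesis ..
  qed
qed

lemma power_in_B1: "(\<lambda>z. z ^ n) \<in> B1"
proof -
  have "integrable lborel (\<lambda>z. (cmod z) ^ (2 * n) * B1_weight z)"
    using has_bochner_integral_B1_moment by (simp add: has_bochner_integral_iff)
  then have "(\<lambda>z. z ^ n) \<in> L2w lborel B1_weight"
    by (simp add: L2w_def norm_power power_mult[symmetric] mult.commute[of n])
  then show ?thesis
    by (auto simp: B1_iff intro: holomorphic_intros)
qed

text \<open>The rotation u is chosen with u^(k - n) = -1. It preserves the disc and the weight but
  reverses the sign of the integrand.\<close>

lemma disc_orthogonal:
  assumes "k \<noteq> n"
  shows "(LINT z|lborel. indicat_real (cball 0 R) z *\<^sub>R (z ^ k * cnj (z ^ n) * of_real (B1_weight z))) = 0"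
    (is "integral\<^sup>L lborel ?f = 0")
proof -
  define u where "u = cis (pi / (real k - real n))"
  have u: "cmod u = 1" by (simp add: u_def)
  have "u ^ k * cnj (u ^ n) = cis ((real k - real n) * (pi / (real k - real n)))"
    unfolding u_def Complex.DeMoivre cis_cnj cis_mult by (simp add: left_diff_distrib diff_divide_distrib)
  also have "\<dots> = -1"
    using assms by (simp add: cis_pi)
  finally have uu: "u ^ k * cnj (u ^ n) = -1" .
  have [measurable]: "?f \<in> borel_measurable borel"
    by measurable
  have "?f (u * z) = - ?f z" for z
  proof -
    have "(u * z) ^ k * cnj ((u * z) ^ n) = (u ^ k * cnj (u ^ n)) * (z ^ k * cnj (z ^ n))"
      by (simp only: power_mult_distrib complex_cnj_mult mult_ac)
    moreover have "B1_weight (u * z) = B1_weight z" "indicat_real (cball 0 R) (u * z) = indicat_real (cball 0 R) z"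
      using u by (simp_all add: B1_weight_def norm_mult indicator_def)
    ultimately show ?thesis using uu by simp
  qed
  then have "integral\<^sup>L lborel ?f = - integral\<^sup>L lborel ?f"
    using LINT_rotation[of ?f, OF _ u] by simp
  then show ?thesis by simp
qed

text \<open>On a bounded disc the power series has a summable majorant, so it may be integrated term
  by term, and orthogonality leaves the n-th term. On the whole plane no such majorant is at
  hand.\<close>

lemma disc_coefficient:
  assumes a: "\<And>z. (\<lambda>k. a k * z ^ k) sums F z"
  shows "(LINT z|lborel. indicat_real (cball 0 R) z *\<^sub>R (F z * cnj (z ^ n) * of_real (B1_weight z)))
     = a n * (LINT z|lborel. indicat_real (cball 0 R) z *\<^sub>R of_real ((cmod z) ^ (2 * n) * B1_weight z))"
proof (cases "0 \<le> R")
  case R: True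
  define f where "f k z = indicat_real (cball 0 R) z *\<^sub>R (a k * z ^ k * cnj (z ^ n) * of_real (B1_weight z))" for k z
  \<comment> \<open>An upper bound for |z|^n times the weight on the disc, from exp(-2 |z|^2) <= 1
    and dropping -1/2.\<close>
  define W where "W = R ^ n * (2 * pi + 2 * R\<^sup>2)"
  have [measurable]: "f k \<in> borel_measurable borel" for k
    unfolding f_def by measurable
  have bound: "norm (f k z) \<le> (cmod (a k) * R ^ k * W) * indicat_real (cball 0 R) z" for k z
  proof (cases "z \<in> cball 0 R")
    case True
    then have z: "cmod z \<le> R" by simp
    have "exp (- 2 * (cmod z)\<^sup>2) * (2 * pi - 1 / 2 + 2 * (cmod z)\<^sup>2) \<le> 1 * (2 * pi + 2 * R\<^sup>2)"
      using z pi_ge_two power_mono[OF z, of 2] by (intro mult_mono) auto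
    then have "B1_weight z \<le> 2 * pi + 2 * R\<^sup>2"
      by (simp add: B1_weight_def)
    then have "cmod (a k) * cmod z ^ k * (cmod z ^ n * B1_weight z) \<le> cmod (a k) * R ^ k * (R ^ n * (2 * pi + 2 * R\<^sup>2))"
      using z R B1_weight_pos[of z] by (intro mult_mono power_mono mult_nonneg_nonneg) auto
    then show ?thesis
      using True B1_weight_pos[of z] by (simp add: f_def W_def norm_mult norm_power mult.assoc)
  qed (simp add: f_def)
  have int_ind: "integrable (lborel :: complex measure) (\<lambda>z. c * indicat_real (cball 0 R) z)" for c
    using emeasure_bounded_finite[OF bounded_cball[of "0 :: complex" R]]
    by (intro integrable_mult_right integrable_real_indicator) auto
  have int: "integrable lborel (f k)" for k
    by (rule Bochner_Integration.integrable_bound[OF int_ind[of "cmod (a k) * R ^ k * W"]])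
      (auto intro!: AE_I2 order_trans[OF bound])
  \<comment> \<open>Convergence at R + 1 gives absolute convergence at the smaller radius R.\<close>
  have summ: "summable (\<lambda>k. cmod (a k) * R ^ k)"
    using powser_insidea[of a "of_real (R + 1)" "of_real R"] a R by (auto simp: norm_mult norm_power sums_iff)
  have "(\<lambda>k. integral\<^sup>L lborel (f k)) sums (LINT z|lborel. (\<Sum>k. f k z))"
  proof (rule sums_integral[OF int])
    show "AE z in lborel. summable (\<lambda>k. norm (f k z))"
    proof (rule AE_I2, rule summable_comparison_test'[where N = 0])
      fix z
      show "summable (\<lambda>k. (cmod (a k) * R ^ k * W) * indicat_real (cball 0 R) z)"
        by (intro summable_mult2 summ)
    qed (use bound in simp)
    show "summable (\<lambda>k. LINT z|lborel. norm (f k z))"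
    proof (rule summable_comparison_test'[where N = 0])
      show "summable (\<lambda>k. cmod (a k) * R ^ k * (W * (LINT z|(lborel :: complex measure). indicat_real (cball 0 R) z)))"
        by (intro summable_mult2 summ)
      fix k
      have "(LINT z|lborel. norm (f k z)) \<le> (LINT z|(lborel :: complex measure). (cmod (a k) * R ^ k * W) * indicat_real (cball 0 R) z)"
        by (intro integral_mono integrable_norm int int_ind bound)
      then show "norm (LINT z|lborel. norm (f k z)) \<le> cmod (a k) * R ^ k * (W * (LINT z|(lborel :: complex measure). indicat_real (cball 0 R) z))"
        by (simp add: mult.assoc)
    qed
  qed
  moreover have "(\<Sum>k. f k z) = indicat_real (cball 0 R) z *\<^sub>R (F z * cnj (z ^ n) * of_real (B1_weight z))" for z
  proof -
    have "(\<lambda>k. indicat_real (cball 0 R) z *\<^sub>R (a k * z ^ k * cnj (z ^ n) * of_real (B1_weight z)))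
        sums (indicat_real (cball 0 R) z *\<^sub>R (F z * cnj (z ^ n) * of_real (B1_weight z)))"
      by (intro sums_scaleR_right sums_mult2 a)
    then show ?thesis by (simp add: f_def sums_iff)
  qed
  moreover have "integral\<^sup>L lborel (f k) = (if k = n then a n * (LINT z|lborel. indicat_real (cball 0 R) z *\<^sub>R of_real ((cmod z) ^ (2 * n) * B1_weight z)) else 0)" for k
  proof -
    have "integral\<^sup>L lborel (f k) = a k * (LINT z|lborel. indicat_real (cball 0 R) z *\<^sub>R (z ^ k * cnj (z ^ n) * of_real (B1_weight z)))"
      unfolding f_def by (simp flip: integral_mult_right_zero) (simp add: mult_ac)
    moreover have "z ^ n * cnj (z ^ n) * of_real (B1_weight z) = of_real ((cmod z) ^ (2 * n) * B1_weight z)" for z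
    proof -
      have "z ^ n * cnj (z ^ n) = (z * cnj z) ^ n"
        by (simp add: power_mult_distrib)
      then show ?thesis by (simp add: mult_cnj_cmod power_mult)
    qed
    ultimately show ?thesis
      using disc_orthogonal[of k n R] by auto
  qed
  ultimately have "(\<lambda>k. if k = n then a n * (LINT z|lborel. indicat_real (cball 0 R) z *\<^sub>R of_real ((cmod z) ^ (2 * n) * B1_weight z)) else 0)
     sums (LINT z|lborel. indicat_real (cball 0 R) z *\<^sub>R (F z * cnj (z ^ n) * of_real (B1_weight z)))"
    by simp
  then show ?thesis
    by (rule sums_unique2) (rule sums_single[where f = "\<lambda>_. a n * (LINT z|lborel. indicat_real (cball 0 R) z *\<^sub>R of_real ((cmod z) ^ (2 * n) * B1_weight z))"])
next
  case False
  then have "cball (0::complex) R = {}" by simp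
  then show ?thesis by simp
qed

lemma LINT_cball_tendsto:
  fixes f :: "'a::euclidean_space \<Rightarrow> 'b::{banach, second_countable_topology}"
  assumes f: "integrable lborel f"
  shows "(\<lambda>N. LINT z|lborel. indicat_real (cball 0 (real N)) z *\<^sub>R f z) \<longlonglongrightarrow> (LINT z|lborel. f z)"
proof (rule integral_dominated_convergence[where w = "\<lambda>z. norm (f z)"])
  show "AE z in lborel. (\<lambda>N. indicat_real (cball 0 (real N)) z *\<^sub>R f z) \<longlonglongrightarrow> f z"
  proof (rule AE_I2, rule tendsto_eventually)
    fix z :: 'a
    have "\<forall>\<^sub>F N in sequentially. norm z \<le> real N"
      using eventually_ge_at_top[of "nat \<lceil>norm z\<rceil>"] by eventually_elim linarith
    then show "\<forall>\<^sub>F N in sequentially. indicat_real (cball 0 (real N)) z *\<^sub>R f z = f z"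
      by eventually_elim simp
  qed
qed (use f in \<open>auto simp: indicator_def\<close>)

text \<open>The disc identities pass to the limit by dominated convergence, since F and the monomial
  are both in \<open>B1\<close>. Taylor coefficients thus become inner products although norm
  convergence of the Taylor series is not known.\<close>

lemma B1_coefficient:
  assumes F: "F \<in> B1" and a: "\<And>z. (\<lambda>k. a k * z ^ k) sums F z"
  shows "B1_ip F (\<lambda>z. z ^ n) = a n * of_real (fock_moment n)"
proof (rule LIMSEQ_unique)
  have "integrable lborel (\<lambda>z. F z * cnj (z ^ n) * of_real (B1_weight z))"
    using F power_in_B1[of n] by (intro fock.integrable_ipw) (auto simp: B1_iff)
  from LINT_cball_tendsto[OF this]
  show "(\<lambda>N. LINT z|lborel. indicat_real (cball 0 (real N)) z *\<^sub>R (F z * cnj (z ^ n) * of_real (B1_weight z))) \<longlonglongrightarrow> B1_ip F (\<lambda>z. z ^ n)"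
    by (simp add: B1_ip_def)
  have hb: "has_bochner_integral lborel (\<lambda>z. complex_of_real ((cmod z) ^ (2 * n) * B1_weight z)) (of_real (fock_moment n))"
    by (intro has_bochner_integral_of_real has_bochner_integral_B1_moment)
  then have "(\<lambda>N. LINT z|lborel. indicat_real (cball 0 (real N)) z *\<^sub>R complex_of_real ((cmod z) ^ (2 * n) * B1_weight z)) \<longlonglongrightarrow> of_real (fock_moment n)"
    using LINT_cball_tendsto[of "\<lambda>z. complex_of_real ((cmod z) ^ (2 * n) * B1_weight z)"]
    by (simp only: has_bochner_integral_iff)
  from tendsto_mult_left[OF this, of "a n"]
  show "(\<lambda>N. LINT z|lborel. indicat_real (cball 0 (real N)) z *\<^sub>R (F z * cnj (z ^ n) * of_real (B1_weight z))) \<longlonglongrightarrow> a n * of_real (fock_moment n)"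
    by (simp only: disc_coefficient[OF a])
qed

definition fock_basis :: "nat \<Rightarrow> complex \<Rightarrow> complex" where
  "fock_basis n z = z ^ n / of_real (sqrt (fock_moment n))"

lemma B1_ip_fock_basis:
  assumes "F \<in> B1" "\<And>z. (\<lambda>k. a k * z ^ k) sums F z"
  shows "B1_ip F (fock_basis n) = a n * of_real (sqrt (fock_moment n))"
proof -
  let ?s = "sqrt (fock_moment n)"
  have "fock_basis n = (\<lambda>z. of_real (1 / ?s) * z ^ n)"
    by (simp add: fock_basis_def fun_eq_iff)
  then have "B1_ip F (fock_basis n) = cnj (of_real (1 / ?s)) * B1_ip F (\<lambda>z. z ^ n)"
    by (simp only: B1.ip_scale_right[OF power_in_B1 assms(1)])
  also have "\<dots> = a n * of_real (fock_moment n / ?s)"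
    unfolding B1_coefficient[OF assms] by simp
  also have "fock_moment n / ?s = ?s"
    using fock_moment_pos[of n] by (simp add: real_div_sqrt)
  finally show ?thesis .
qed

lemma fock_basis_in_B1: "fock_basis n \<in> B1"
  using B1.scale_closed[OF power_in_B1, of "1 / of_real (sqrt (fock_moment n))" n]
  by (simp add: fock_basis_def[abs_def])

interpretation B1: orthonormal_seq B1 "(=)" B1_ip fock_basis
proof unfold_locales
  fix i j
  let ?a = "\<lambda>k. if k = i then 1 / of_real (sqrt (fock_moment i)) else (0 :: complex)"
  have "(\<lambda>k. ?a k * z ^ k) sums fock_basis i z" for z
  proof -
    have "(\<lambda>k. if k = i then z ^ k / of_real (sqrt (fock_moment i)) else 0) sums (z ^ i / of_real (sqrt (fock_moment i)))"
      by (rule sums_single)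
    moreover have "(\<lambda>k. ?a k * z ^ k) = (\<lambda>k. if k = i then z ^ k / of_real (sqrt (fock_moment i)) else 0)"
      by auto
    ultimately show ?thesis by (simp add: fock_basis_def)
  qed
  from B1_ip_fock_basis[OF fock_basis_in_B1 this, of j]
  show "B1_ip (fock_basis i) (fock_basis j) = (if i = j then 1 else 0)"
    using fock_moment_pos[of i] by auto
qed (rule fock_basis_in_B1)

section \<open>The Fourier symmetric Sobolev space\<close>

lemma fourier_sobolev_iff:
  "f \<in> fourier_sobolev \<longleftrightarrow> f \<in> L2w lborel sobolev_weight \<and> fourier f \<in> L2w lborel sobolev_weight"
  using borel_measurable_fourier[of f] by (auto simp: fourier_sobolev_def L2w_def sobolev_weight_def)

lemma fourier_sobolev_ip_eq:
  "fourier_sobolev_ip f g = ipw lborel sobolev_weight f g + ipw lborel sobolev_weight (fourier f) (fourier g)"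
  by (simp add: fourier_sobolev_ip_def ipw_def sobolev_weight_def)

lemma fourier_sobolev_integrable: "f \<in> fourier_sobolev \<Longrightarrow> integrable lborel f"
  by (simp add: fourier_sobolev_iff sobolev_imp_integrable)

lemma fourier_add_fun:
  assumes "integrable lborel f" "integrable lborel g"
  shows "fourier (\<lambda>x. f x + g x) = (\<lambda>t. fourier f t + fourier g t)"
  by (rule ext) (rule fourier_add[OF assms])

lemma fourier_scale_fun: "fourier (\<lambda>x. c * f x) = (\<lambda>t. c * fourier f t)"
  by (rule ext) (rule fourier_scale)

lemma fourier_AE_0:
  assumes [measurable]: "f \<in> borel_measurable borel" and "AE x in lborel. f x = 0"
  shows "fourier f = (\<lambda>t. 0)"
proof
  fix t
  have "fourier f t = (LINT x|(lborel :: real measure). 0)"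
    unfolding fourier_def
    by (rule integral_cong_AE) (use assms(2) in \<open>measurable, auto\<close>)
  then show "fourier f t = 0" by simp
qed

interpretation sobolev: pre_hilbert fourier_sobolev ae_eq fourier_sobolev_ip
proof unfold_locales
  show "(\<lambda>x. 0) \<in> fourier_sobolev"
    by (simp add: fourier_sobolev_iff sob.zero_closed fourier_AE_0)
  show "(\<lambda>x. f x + g x) \<in> fourier_sobolev" if "f \<in> fourier_sobolev" "g \<in> fourier_sobolev" for f g
    using that fourier_add_fun[OF that[THEN fourier_sobolev_integrable]]
    by (simp add: fourier_sobolev_iff sob.add_closed)
  show "(\<lambda>x. c * f x) \<in> fourier_sobolev" if "f \<in> fourier_sobolev" for c f
    using that fourier_scale_fun[of c f]
    by (simp add: fourier_sobolev_iff sob.scale_closed)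
  show "fourier_sobolev_ip (\<lambda>x. f x + g x) h = fourier_sobolev_ip f h + fourier_sobolev_ip g h"
    if "f \<in> fourier_sobolev" "g \<in> fourier_sobolev" "h \<in> fourier_sobolev" for f g h
    using that fourier_add_fun[OF that(1,2)[THEN fourier_sobolev_integrable]]
    by (simp add: fourier_sobolev_iff fourier_sobolev_ip_eq sob.ipw_add_left)
  show "fourier_sobolev_ip (\<lambda>x. c * f x) h = c * fourier_sobolev_ip f h" for c f h
    using fourier_scale_fun[of c f] by (simp add: fourier_sobolev_ip_eq sob.ipw_scale_left distrib_left)
  show "fourier_sobolev_ip g f = cnj (fourier_sobolev_ip f g)" for f g
    unfolding fourier_sobolev_ip_eq complex_cnj_add
    by (intro arg_cong2[where f = "(+)"] sob.ipw_hermitian)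
  show "0 \<le> Re (fourier_sobolev_ip f f)" for f
    unfolding fourier_sobolev_ip_eq using sob.Re_ipw_nonneg by simp
  show "ae_eq f g \<longleftrightarrow> fourier_sobolev_ip (\<lambda>x. f x - g x) (\<lambda>x. f x - g x) = 0"
    if f: "f \<in> fourier_sobolev" and g: "g \<in> fourier_sobolev" for f g
  proof -
    let ?d = "\<lambda>x. f x - g x"
    let ?I = "ipw lborel sobolev_weight"
    have d: "?d \<in> L2w lborel sobolev_weight"
      using f g by (simp add: fourier_sobolev_iff sob.diff_closed)
    have [measurable]: "?d \<in> borel_measurable borel"
      using sob.measurableD[OF d] by simp
    \<comment> \<open>Both summands of the squared norm are nonnegative, so the first one vanishes
      with the sum. Conversely a null function has an identically zero Fourier transform.\<close>
    have "fourier_sobolev_ip ?d ?d = 0 \<longleftrightarrow> (AE x in lborel. ?d x = 0)"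
    proof
      assume "fourier_sobolev_ip ?d ?d = 0"
      then have "Re (?I ?d ?d) + Re (?I (fourier ?d) (fourier ?d)) = 0"
        unfolding fourier_sobolev_ip_eq by (metis plus_complex.sel(1) zero_complex.sel(1))
      then have "Re (?I ?d ?d) = 0"
        using sob.Re_ipw_nonneg[of ?d] sob.Re_ipw_nonneg[of "fourier ?d"] by linarith
      then have "?I ?d ?d = 0"
        unfolding sob.ipw_self by simp
      then show "AE x in lborel. ?d x = 0"
        using sob.ipw_self_eq_0_iff[OF d] by blast
    next
      assume *: "AE x in lborel. ?d x = 0"
      then have "?I ?d ?d = 0"
        using sob.ipw_self_eq_0_iff[OF d] by blast
      moreover have "fourier ?d = (\<lambda>t. 0)"
        by (rule fourier_AE_0) (use * in simp_all)
      ultimately show "fourier_sobolev_ip ?d ?d = 0"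
        unfolding fourier_sobolev_ip_eq by (simp add: ipw_def)
    qed
    then show ?thesis by (simp add: ae_eq_def)
  qed
qed

lemma sobolev_nrm_sq:
  assumes "f \<in> fourier_sobolev"
  shows "(sobolev.nrm f)\<^sup>2 = (LINT x|lborel. (cmod (f x))\<^sup>2 * sobolev_weight x)
     + (LINT x|lborel. (cmod (fourier f x))\<^sup>2 * sobolev_weight x)"
  unfolding sobolev.nrm_sq[OF assms] fourier_sobolev_ip_eq by (simp add: sob.Re_ipw_self)

lemma sobolev_nrm_bounds:
  assumes "f \<in> fourier_sobolev" "sobolev.nrm f \<le> d"
  shows "(LINT x|lborel. (cmod (f x))\<^sup>2 * sobolev_weight x) \<le> d\<^sup>2"
    and "(LINT x|lborel. (cmod (fourier f x))\<^sup>2 * sobolev_weight x) \<le> d\<^sup>2"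
proof -
  have "(sobolev.nrm f)\<^sup>2 \<le> d\<^sup>2"
    using assms by (intro power_mono) auto
  then show "(LINT x|lborel. (cmod (f x))\<^sup>2 * sobolev_weight x) \<le> d\<^sup>2"
    "(LINT x|lborel. (cmod (fourier f x))\<^sup>2 * sobolev_weight x) \<le> d\<^sup>2"
    using sobolev_nrm_sq[OF assms(1)] sob.Re_ipw_nonneg[of f] sob.Re_ipw_nonneg[of "fourier f"]
    unfolding sob.Re_ipw_self by linarith+
qed

text \<open>The L1 bound makes the sequence L1-Cauchy, and a subsequence converges almost everywhere
  to f. Fatou with one index fixed gives closeness in the first integral, hence L1 convergence,
  hence pointwise convergence of all Fourier transforms. Fatou then applies on the Fourier side as
  well.\<close>

lemma sobolev_complete:
  assumes X: "\<And>n. X n \<in> fourier_sobolev"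
    and Cauchy: "\<And>e. 0 < e \<Longrightarrow> \<exists>N. \<forall>m\<ge>N. \<forall>n\<ge>N. sobolev.nrm (\<lambda>x. X m x - X n x) < e"
  shows "\<exists>f\<in>fourier_sobolev. (\<lambda>n. sobolev.nrm (\<lambda>x. X n x - f x)) \<longlonglongrightarrow> 0"
proof -
  have XL: "X n \<in> L2w lborel sobolev_weight" for n
    using X by (simp add: fourier_sobolev_iff)
  have int: "integrable lborel (X n)" for n
    by (rule fourier_sobolev_integrable[OF X])
  have [measurable]: "X n \<in> borel_measurable borel" for n
    using sob.measurableD[OF XL] by simp
  have "\<exists>N. \<forall>i\<ge>N. \<forall>j\<ge>N. LINT x|lborel. norm (X i x - X j x) < e" if "0 < e" for e
  proof -
    obtain N where N: "\<And>i j. i \<ge> N \<Longrightarrow> j \<ge> N \<Longrightarrow> sobolev.nrm (\<lambda>x. X i x - X j x) < e / 4"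
      \<comment> \<open>With e / 4 the factor 3 of the L1 bound still leaves less than e.\<close>
      using Cauchy[of "e / 4"] \<open>0 < e\<close> by auto
    have "LINT x|lborel. norm (X i x - X j x) < e" if "i \<ge> N" "j \<ge> N" for i j
    proof -
      have "(LINT x|lborel. cmod (X i x - X j x)) \<le> 3 * (e / 4)"
        using N[OF that] \<open>0 < e\<close>
        by (intro sobolev_L1_bound sob.diff_closed XL sobolev_nrm_bounds(1) sobolev.diff_closed X) auto
      then show ?thesis using \<open>0 < e\<close> by simp
    qed
    then show ?thesis by blast
  qed
  then obtain r where r: "strict_mono r" "AE x in lborel. Cauchy (\<lambda>i. X (r i) x)"
    using cauchy_L1_AE_cauchy_subseq[of lborel X, OF int] by blast
  \<comment> \<open>The operator \<open>lim\<close> gives a measurable function everywhere; its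
    value where the subsequence diverges is immaterial.\<close>
  define f where "f x = lim (\<lambda>i. X (r i) x)" for x
  have [measurable]: "f \<in> borel_measurable borel"
    unfolding f_def[abs_def] by (rule borel_measurable_lim_metric) simp
  have lim: "AE x in lborel. (\<lambda>i. X (r i) x) \<longlonglongrightarrow> f x"
    using r(2) by eventually_elim (simp add: f_def Cauchy_convergent_iff convergent_LIMSEQ_iff)
  have r_ge: "\<forall>\<^sub>F i in sequentially. r i \<ge> N" for N
    using filterlim_subseq[OF r(1)] by (simp add: filterlim_at_top)
  have close: "\<exists>N. \<forall>m\<ge>N. (\<lambda>x. f x - X m x) \<in> L2w lborel sobolev_weight \<and>
      (LINT x|lborel. (cmod (f x - X m x))\<^sup>2 * sobolev_weight x) \<le> e\<^sup>2" if "0 < e" for e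
  proof -
    obtain N where N: "\<And>i j. i \<ge> N \<Longrightarrow> j \<ge> N \<Longrightarrow> sobolev.nrm (\<lambda>x. X i x - X j x) < e"
      using Cauchy[OF \<open>0 < e\<close>] by auto
    have "(\<lambda>x. f x - X m x) \<in> L2w lborel sobolev_weight"
      "(LINT x|lborel. (cmod (f x - X m x))\<^sup>2 * sobolev_weight x) \<le> e\<^sup>2" if "m \<ge> N" for m
    proof -
      have lim': "AE x in lborel. (\<lambda>i. X (r i) x - X m x) \<longlonglongrightarrow> f x - X m x"
        using lim by eventually_elim (intro tendsto_intros)
      have bd: "\<forall>\<^sub>F i in sequentially. (LINT x|lborel. (cmod (X (r i) x - X m x))\<^sup>2 * sobolev_weight x) \<le> e\<^sup>2"
        using r_ge[of N]
        by eventually_elim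
          (rule sobolev_nrm_bounds(1)[OF sobolev.diff_closed[OF X X] less_imp_le[OF N[OF _ that]]])
      show "(\<lambda>x. f x - X m x) \<in> L2w lborel sobolev_weight"
        "(LINT x|lborel. (cmod (f x - X m x))\<^sup>2 * sobolev_weight x) \<le> e\<^sup>2"
        by (rule sob.Fatou[where X = "\<lambda>i x. X (r i) x - X m x", OF sob.diff_closed[OF XL XL] _ lim' bd]; measurable)+
    qed
    then show ?thesis by blast
  qed
  have fL: "f \<in> L2w lborel sobolev_weight"
  proof -
    obtain m where "(\<lambda>x. f x - X m x) \<in> L2w lborel sobolev_weight"
      using close[of 1] by auto
    from sob.add_closed[OF this XL[of m]] show ?thesis by simp
  qed
  have fint: "integrable lborel f"
    by (rule sobolev_imp_integrable[OF fL])
  have flim: "(\<lambda>n. fourier (X n) t) \<longlonglongrightarrow> fourier f t" for t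
  proof (rule LIMSEQ_I)
    fix e :: real assume "0 < e"
    then obtain N where N: "\<And>m. m \<ge> N \<Longrightarrow> (\<lambda>x. f x - X m x) \<in> L2w lborel sobolev_weight \<and>
      (LINT x|lborel. (cmod (f x - X m x))\<^sup>2 * sobolev_weight x) \<le> (e / 4)\<^sup>2"
      using close[of "e / 4"] by auto
    have "norm (fourier (X m) t - fourier f t) < e" if "m \<ge> N" for m
    proof -
      have "norm (fourier (X m) t - fourier f t) = cmod (fourier (\<lambda>x. f x - X m x) t)"
        by (simp add: fourier_diff[OF fint int] norm_minus_commute)
      also have "\<dots> \<le> (LINT x|lborel. cmod (f x - X m x))"
        by (rule norm_fourier_le)
      also have "\<dots> \<le> 3 * (e / 4)"
        using N[OF that] \<open>0 < e\<close> by (intro sobolev_L1_bound) auto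
      finally show ?thesis using \<open>0 < e\<close> by simp
    qed
    then show "\<exists>N. \<forall>m\<ge>N. norm (fourier (X m) t - fourier f t) < e" by blast
  qed
  \<comment> \<open>Here the limit is taken along the full sequence, because the transforms converge
    at every point.\<close>
  have fclose: "\<exists>N. \<forall>m\<ge>N. fourier (\<lambda>x. f x - X m x) \<in> L2w lborel sobolev_weight \<and>
      (LINT x|lborel. (cmod (fourier (\<lambda>x. f x - X m x) x))\<^sup>2 * sobolev_weight x) \<le> e\<^sup>2" if "0 < e" for e
  proof -
    obtain N where N: "\<And>i j. i \<ge> N \<Longrightarrow> j \<ge> N \<Longrightarrow> sobolev.nrm (\<lambda>x. X i x - X j x) < e"
      using Cauchy[OF \<open>0 < e\<close>] by auto
    have "fourier (\<lambda>x. f x - X m x) \<in> L2w lborel sobolev_weight"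
      "(LINT x|lborel. (cmod (fourier (\<lambda>x. f x - X m x) x))\<^sup>2 * sobolev_weight x) \<le> e\<^sup>2" if "m \<ge> N" for m
    proof -
      let ?Y = "\<lambda>i. fourier (\<lambda>x. X i x - X m x)"
      have lim': "AE x in lborel. (\<lambda>i. ?Y i x) \<longlonglongrightarrow> fourier (\<lambda>x. f x - X m x) x"
        unfolding fourier_diff[OF int int] fourier_diff[OF fint int]
        by (intro AE_I2 tendsto_intros flim)
      have bd: "\<forall>\<^sub>F i in sequentially. (LINT x|lborel. (cmod (?Y i x))\<^sup>2 * sobolev_weight x) \<le> e\<^sup>2"
        using eventually_ge_at_top[of N]
        by eventually_elim
          (rule sobolev_nrm_bounds(2)[OF sobolev.diff_closed[OF X X] less_imp_le[OF N[OF _ that]]])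
      have Y: "?Y i \<in> L2w lborel sobolev_weight" for i
        using sobolev.diff_closed[OF X X] by (simp add: fourier_sobolev_iff)
      have "fourier (\<lambda>x. f x - X m x) \<in> borel_measurable lborel"
        using borel_measurable_fourier[of "\<lambda>x. f x - X m x"] by simp
      from sob.Fatou[OF Y this lim' bd]
      show "fourier (\<lambda>x. f x - X m x) \<in> L2w lborel sobolev_weight"
        "(LINT x|lborel. (cmod (fourier (\<lambda>x. f x - X m x) x))\<^sup>2 * sobolev_weight x) \<le> e\<^sup>2"
        by auto
    qed
    then show ?thesis by blast
  qed
  have main: "\<exists>N. \<forall>m\<ge>N. (\<lambda>x. f x - X m x) \<in> fourier_sobolev \<and> sobolev.nrm (\<lambda>x. f x - X m x) \<le> 2 * e" if "0 < e" for e
  proof -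
    obtain N M where N: "\<And>m. m \<ge> N \<Longrightarrow> (\<lambda>x. f x - X m x) \<in> L2w lborel sobolev_weight \<and>
        (LINT x|lborel. (cmod (f x - X m x))\<^sup>2 * sobolev_weight x) \<le> e\<^sup>2"
      and M: "\<And>m. m \<ge> M \<Longrightarrow> fourier (\<lambda>x. f x - X m x) \<in> L2w lborel sobolev_weight \<and>
        (LINT x|lborel. (cmod (fourier (\<lambda>x. f x - X m x) x))\<^sup>2 * sobolev_weight x) \<le> e\<^sup>2"
      using close[OF \<open>0 < e\<close>] fclose[OF \<open>0 < e\<close>] by auto
    have "(\<lambda>x. f x - X m x) \<in> fourier_sobolev \<and> sobolev.nrm (\<lambda>x. f x - X m x) \<le> 2 * e"
      if "m \<ge> max N M" for m
    proof
      show *: "(\<lambda>x. f x - X m x) \<in> fourier_sobolev"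
        using N[of m] M[of m] that by (simp add: fourier_sobolev_iff)
      have "(sobolev.nrm (\<lambda>x. f x - X m x))\<^sup>2 \<le> e\<^sup>2 + e\<^sup>2"
        unfolding sobolev_nrm_sq[OF *] using N[of m] M[of m] that by (intro add_mono) auto
      also have "\<dots> \<le> (2 * e)\<^sup>2"
        by (simp add: power_mult_distrib)
      finally show "sobolev.nrm (\<lambda>x. f x - X m x) \<le> 2 * e"
        by (rule power2_le_imp_le) (use \<open>0 < e\<close> in simp)
    qed
    then show ?thesis by blast
  qed
  have fH: "f \<in> fourier_sobolev"
  proof -
    obtain m where "(\<lambda>x. f x - X m x) \<in> fourier_sobolev"
      using main[of 1] by auto
    from sobolev.add_closed[OF this X[of m]] show ?thesis by simp
  qed
  have "(\<lambda>n. sobolev.nrm (\<lambda>x. X n x - f x)) \<longlonglongrightarrow> 0"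
  proof (rule LIMSEQ_I)
    fix e :: real assume "0 < e"
    then obtain N where N: "\<And>m. m \<ge> N \<Longrightarrow> sobolev.nrm (\<lambda>x. f x - X m x) \<le> 2 * (e / 4)"
      using main[of "e / 4"] by auto
    have "norm (sobolev.nrm (\<lambda>x. X m x - f x) - 0) < e" if "m \<ge> N" for m
      using N[OF that] \<open>0 < e\<close> sobolev.nrm_minus_commute[OF fH X, of m] sobolev.nrm_nonneg[OF sobolev.diff_closed[OF fH X], of m]
      by simp
    then show "\<exists>N. \<forall>m\<ge>N. norm (sobolev.nrm (\<lambda>x. X m x - f x) - 0) < e" by blast
  qed
  with fH show ?thesis by blast
qed

lemma hilbert_space_fourier_sobolev: "hilbert_space fourier_sobolev ae_eq fourier_sobolev_ip"
proof unfold_locales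
  show "\<exists>f\<in>fourier_sobolev. (\<lambda>n. sobolev.nrm (\<lambda>x. X n x - f x)) \<longlonglongrightarrow> 0"
    if "\<And>n. X n \<in> fourier_sobolev"
      "\<And>e. 0 < e \<Longrightarrow> \<exists>N. \<forall>m\<ge>N. \<forall>n\<ge>N. sobolev.nrm (\<lambda>x. X m x - X n x) < e" for X
    by (rule sobolev_complete[OF that])
qed (fact sobolev.zero_closed sobolev.add_closed sobolev.scale_closed sobolev.ip_add_left sobolev.ip_scale_left
      sobolev.ip_hermitian sobolev.ip_nonneg sobolev.definite)+

section \<open>Hermite functions in the Sobolev space\<close>

lemma hfun_in_fourier_sobolev: "hfun n \<in> fourier_sobolev"
proof -
  have "fourier (hfun n) = (\<lambda>\<xi>. (- \<i>) ^ n * hfun n \<xi>)"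
    by (rule ext) (rule fourier_hfun)
  then show ?thesis
    by (simp add: fourier_sobolev_iff hfun_L2w sob.scale_closed)
qed

text \<open>Equal to 2 (1 + (n + 1/2) / (2 pi)): the diagonal coefficient of multiplication by 1 +
  x^2, once for each of the two integrals in the inner product.\<close>

definition sobolev_eigenvalue :: "nat \<Rightarrow> real" where
  "sobolev_eigenvalue n = (real n + 2 * pi + 1 / 2) / pi"

text \<open>By the multiplication formula the Fourier part of the inner product becomes an integral of
  \<open>f\<close> against the Fourier transform of \<open>(1 + \<xi>\<^sup>2) hfun n\<close>; the terms \<open>hfun (n \<plusminus> 2)\<close> cancel against
  those of \<open>(1 + x\<^sup>2) hfun n\<close>.\<close>
lemma sobolev_ip_hfun:
  assumes f: "f \<in> fourier_sobolev"
  shows "fourier_sobolev_ip f (hfun n) = of_real (sobolev_eigenvalue n) * (LINT x|lborel. f x * hfun n x)"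
proof -
  define a :: complex where "a = 1 / (2 * of_real pi)"
  define p :: complex where "p = of_nat n + 1 / 2"
  define q :: complex where "q = of_nat n * (of_nat n - 1)"
  \<comment> \<open>The function (1 + \<xi>^2) \<open>hfun n\<close> written in Hermite functions,
    which makes it visibly integrable and its Fourier transform computable term by term.\<close>
  define G where "G \<xi> = (a / 4) * hfun (n + 2) \<xi> + ((1 + a * p) * hfun n \<xi> + (a * q) * hfun (n - 2) \<xi>)" for \<xi>
  have G: "hfun n \<xi> * of_real (1 + \<xi>\<^sup>2) = G \<xi>" for \<xi>
  proof -
    have "hfun n \<xi> * of_real (1 + \<xi>\<^sup>2) = hfun n \<xi> + of_real (\<xi>\<^sup>2) * hfun n \<xi>"
      by (simp add: algebra_simps)
    also have "\<dots> = G \<xi>"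
      unfolding sq_mult_hfun G_def a_def[symmetric] p_def[symmetric] q_def[symmetric] by (simp add: algebra_simps)
    finally show ?thesis .
  qed
  have Gint: "integrable lborel G"
    unfolding G_def[abs_def] by (intro Bochner_Integration.integrable_add integrable_mult_right integrable_hfun)
  \<comment> \<open>Relative to (-i)^n the terms of index n + 2 and n - 2 change sign and the
    diagonal term does not, so the transform is twice the diagonal term minus G.\<close>
  have fG: "fourier G x = (- \<i>) ^ n * (2 * (1 + a * p) * hfun n x - G x)" for x
  proof -
    have i: "integrable lborel (\<lambda>\<xi>. c * hfun m \<xi>)" for c m
      by (intro integrable_mult_right integrable_hfun)
    have "fourier G x = (a / 4) * fourier (hfun (n + 2)) x
        + ((1 + a * p) * fourier (hfun n) x + (a * q) * fourier (hfun (n - 2)) x)"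
      unfolding G_def[abs_def]
      by (simp only: fourier_add[OF i Bochner_Integration.integrable_add[OF i i]] fourier_add[OF i i] fourier_scale)
    also have "\<dots> = (a / 4) * ((- \<i>) ^ (n + 2) * hfun (n + 2) x)
        + ((1 + a * p) * ((- \<i>) ^ n * hfun n x) + a * (q * (- \<i>) ^ (n - 2)) * hfun (n - 2) x)"
      by (simp only: fourier_hfun mult.assoc)
    also have "(- \<i>) ^ (n + 2) = - ((- \<i>) ^ n)"
      by (simp add: power_add)
    \<comment> \<open>For n < 2 the exponent n - 2 is truncated to 0, and the equation holds because
      q = 0.\<close>
    also have "q * (- \<i>) ^ (n - 2) = - (q * (- \<i>) ^ n)"
    proof (cases "n < 2")
      case True
      then have "q = 0" by (auto simp: q_def less_2_cases_iff)
      then show ?thesis by simp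
    next
      case False
      then have "n - 2 + 2 = n" by simp
      then have "(- \<i>) ^ n = (- \<i>) ^ (n - 2) * (- \<i>) ^ 2"
        using power_add[of "- \<i>" "n - 2" 2] by (simp only:)
      then show ?thesis by simp
    qed
    also have "(a / 4) * (- ((- \<i>) ^ n) * hfun (n + 2) x)
        + ((1 + a * p) * ((- \<i>) ^ n * hfun n x) + a * (- (q * (- \<i>) ^ n)) * hfun (n - 2) x)
        = (- \<i>) ^ n * (2 * (1 + a * p) * hfun n x - G x)"
      unfolding G_def by (simp add: algebra_simps)
    finally show ?thesis .
  qed
  have fint: "integrable lborel f" by (rule fourier_sobolev_integrable[OF f])
  have unit: "cnj ((- \<i>) ^ n) * (- \<i>) ^ n = 1"
    by (simp flip: power_mult_distrib)
  \<comment> \<open>The weight is at least 1, so the weighted product is a majorant.\<close>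
  have ffh: "integrable lborel (\<lambda>x. f x * hfun n x)"
  proof (rule Bochner_Integration.integrable_bound)
    show "integrable lborel (\<lambda>x. f x * cnj (hfun n x) * of_real (sobolev_weight x))"
      using f hfun_L2w by (intro sob.integrable_ipw) (auto simp: fourier_sobolev_iff)
    show "(\<lambda>x. f x * hfun n x) \<in> borel_measurable lborel"
      using borel_measurable_integrable[OF fint] by measurable
    show "AE x in lborel. norm (f x * hfun n x) \<le> norm (f x * cnj (hfun n x) * of_real (sobolev_weight x))"
    proof (rule AE_I2)
      fix x
      have "norm (f x * hfun n x) * 1 \<le> norm (f x * hfun n x) * \<bar>sobolev_weight x\<bar>"
        by (intro mult_left_mono) (simp_all add: sobolev_weight_def)
      then show "norm (f x * hfun n x) \<le> norm (f x * cnj (hfun n x) * of_real (sobolev_weight x))"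
        by (simp add: norm_mult)
    qed
  qed
  have fG_int: "integrable lborel (\<lambda>x. f x * G x)"
    using sob.integrable_ipw[of f "hfun n"] f hfun_L2w
    by (simp add: fourier_sobolev_iff sobolev_weight_def mult.assoc G del: of_real_add)
  have "(LINT \<xi>|lborel. fourier f \<xi> * cnj (fourier (hfun n) \<xi>) * of_real (1 + \<xi>\<^sup>2))
      = (LINT \<xi>|lborel. cnj ((- \<i>) ^ n) * (fourier f \<xi> * G \<xi>))"
    by (intro Bochner_Integration.integral_cong refl)
      (simp only: fourier_hfun complex_cnj_mult cnj_hfun G[symmetric] mult_ac)
  also have "\<dots> = cnj ((- \<i>) ^ n) * (LINT x|lborel. f x * fourier G x)"
    unfolding integral_mult_right_zero fourier_multiplication[OF fint Gint] ..
  also have "\<dots> = (LINT x|lborel. (cnj ((- \<i>) ^ n) * (- \<i>) ^ n) * (2 * (1 + a * p) * (f x * hfun n x) - f x * G x))"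
    unfolding integral_mult_right_zero[symmetric] fG
    by (intro Bochner_Integration.integral_cong refl) (simp only: right_diff_distrib mult_ac)
  also have "\<dots> = 2 * (1 + a * p) * (LINT x|lborel. f x * hfun n x) - (LINT x|lborel. f x * G x)"
    unfolding unit using ffh fG_int by simp
  finally have "fourier_sobolev_ip f (hfun n) = 2 * (1 + a * p) * (LINT x|lborel. f x * hfun n x)"
    unfolding fourier_sobolev_ip_def by (simp add: mult.assoc G del: of_real_add)
  also have "2 * (1 + a * p) = of_real (sobolev_eigenvalue n)"
    by (simp add: a_def p_def sobolev_eigenvalue_def field_simps)
  finally show ?thesis .
qed

section \<open>The Bargmann transform\<close>

text \<open>The positive and negative parts of h have equal transforms, and s = 0 shows that they
  have equal mass m. If m = 0 both vanish; otherwise dividing by m gives probability densities,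
  which Levy's uniqueness theorem identifies.\<close>

lemma fourier_unique_real:
  fixes h :: "real \<Rightarrow> real"
  assumes h: "integrable lborel h"
    and zero: "\<And>s. (LINT t|lborel. of_real (h t) * iexp (s * t)) = 0"
  shows "AE t in lborel. h t = 0"
proof -
  define P where "P t = max 0 (h t)" for t
  define N where "N t = max 0 (- h t)" for t
  have [measurable]: "h \<in> borel_measurable borel"
    using borel_measurable_integrable[OF h] by simp
  have [measurable]: "P \<in> borel_measurable borel" "N \<in> borel_measurable borel"
    unfolding P_def[abs_def] N_def[abs_def] by measurable
  have PN: "P t - N t = h t" "0 \<le> P t" "0 \<le> N t" for t
    by (auto simp: P_def N_def max_def)
  have intP: "integrable lborel P" and intN: "integrable lborel N"
    unfolding P_def[abs_def] N_def[abs_def] using h by auto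
  have intc: "integrable lborel (\<lambda>t. complex_of_real (f t) * iexp (s * t))" if "integrable lborel f" for f s
  proof (rule Bochner_Integration.integrable_bound[OF that])
    show "(\<lambda>t. complex_of_real (f t) * iexp (s * t)) \<in> borel_measurable lborel"
      using borel_measurable_integrable[OF that] by measurable
  qed (simp add: norm_mult)
  have eq: "(LINT t|lborel. of_real (P t) * iexp (s * t)) = (LINT t|lborel. of_real (N t) * iexp (s * t))" for s
  proof -
    have "(LINT t|lborel. of_real (P t) * iexp (s * t)) - (LINT t|lborel. of_real (N t) * iexp (s * t))
        = (LINT t|lborel. of_real (P t) * iexp (s * t) - of_real (N t) * iexp (s * t))"
      by (rule Bochner_Integration.integral_diff[symmetric]) (intro intc intP intN)+
    also have "\<dots> = (LINT t|lborel. of_real (h t) * iexp (s * t))"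
      by (intro Bochner_Integration.integral_cong refl) (simp add: left_diff_distrib flip: PN(1))
    finally show ?thesis by (simp only: zero right_minus_eq)
  qed
  define m where "m = (LINT t|lborel. P t)"
  have mN: "(LINT t|lborel. N t) = m"
    using eq[of 0] by (simp add: m_def)
  have m0: "0 \<le> m"
    unfolding m_def using PN by (intro Bochner_Integration.integral_nonneg) auto
  show ?thesis
  proof (cases "m = 0")
    case True
    have "AE t in lborel. P t = 0" "AE t in lborel. N t = 0"
      using integral_nonneg_eq_0_iff_AE[OF intP] integral_nonneg_eq_0_iff_AE[OF intN] PN True mN
      by (auto simp: m_def)
    then show ?thesis
      by eventually_elim (use PN(1) in \<open>metis diff_0_right\<close>)
  next
    case False
    then have m: "0 < m" using m0 by simp
    let ?D = "\<lambda>f. density lborel (\<lambda>t. ennreal (f t / m))"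
    have rd: "real_distribution (?D f)"
      if f: "integrable lborel f" "\<And>t. 0 \<le> f t" "(LINT t|lborel. f t) = m" for f
    proof -
      have [measurable]: "f \<in> borel_measurable borel"
        using borel_measurable_integrable[OF f(1)] by simp
      have "emeasure (?D f) (space (?D f)) = (\<integral>\<^sup>+t. ennreal (f t / m) \<partial>lborel)"
        by (subst emeasure_density) auto
      also have "\<dots> = ennreal (LINT t|lborel. f t / m)"
        using f m by (intro nn_integral_eq_integral) auto
      also have "(LINT t|lborel. f t / m) = 1"
        using f m by simp
      finally have "prob_space (?D f)" by (intro prob_spaceI) simp
      then show ?thesis
        by (simp add: real_distribution_def real_distribution_axioms_def)
    qed
    have ch: "char (?D f) s = (LINT t|lborel. of_real (f t) * iexp (s * t)) / of_real m"
      if f: "integrable lborel f" "\<And>t. 0 \<le> f t" for f s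
    proof -
      have [measurable]: "f \<in> borel_measurable borel"
        using borel_measurable_integrable[OF f(1)] by simp
      have "char (?D f) s = (LINT t|lborel. (f t / m) *\<^sub>R iexp (s * t))"
        unfolding char_def using f m by (subst integral_density) auto
      also have "\<dots> = (LINT t|lborel. of_real (f t) * iexp (s * t) / of_real m)"
        by (intro Bochner_Integration.integral_cong refl) (simp add: scaleR_conv_of_real)
      finally show ?thesis by simp
    qed
    have "?D P = ?D N"
    proof (rule Levy_uniqueness)
      show "char (?D P) = char (?D N)"
        by (rule ext) (simp only: ch[OF intP PN(2)] ch[OF intN PN(3)] eq)
    qed (rule rd[OF intP PN(2) m_def[symmetric]] rd[OF intN PN(3) mN])+
    then have "AE t in lborel. ennreal (P t / m) = ennreal (N t / m)"
      by (subst (asm) sigma_finite_measure.density_unique_iff[OF sigma_finite_lborel]) auto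
    then show ?thesis
    proof eventually_elim
      case (elim t)
      then have "P t / m = N t / m"
        using m PN by (subst (asm) ennreal_inj) auto
      then show ?case using m PN(1)[of t] by simp
    qed
  qed
qed

text \<open>The transform of the conjugate of g at s is the conjugate of the transform of g at -s.
  Hence the real and imaginary parts, being combinations of g and its conjugate, also have zero
  transform.\<close>

lemma fourier_unique:
  fixes g :: "real \<Rightarrow> complex"
  assumes g: "integrable lborel g"
    and zero: "\<And>s. (LINT t|lborel. g t * iexp (s * t)) = 0"
  shows "AE t in lborel. g t = 0"
proof -
  have [measurable]: "g \<in> borel_measurable borel"
    using borel_measurable_integrable[OF g] by simp
  have int: "integrable lborel (\<lambda>t. f t * iexp (s * t))" if "integrable lborel f" for f :: "real \<Rightarrow> complex" and s
  proof (rule Bochner_Integration.integrable_bound[OF that])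
    show "(\<lambda>t. f t * iexp (s * t)) \<in> borel_measurable lborel"
      using borel_measurable_integrable[OF that] by measurable
  qed (simp add: norm_mult)
  have gc: "integrable lborel (\<lambda>t. cnj (g t))"
    using g by simp
  have zero': "(LINT t|lborel. cnj (g t) * iexp (s * t)) = 0" for s
  proof -
    have "(LINT t|lborel. cnj (g t) * iexp (s * t)) = (LINT t|lborel. cnj (g t * iexp (- s * t)))"
      by (intro Bochner_Integration.integral_cong refl) (simp add: exp_cnj)
    also have "\<dots> = cnj (LINT t|lborel. g t * iexp (- s * t))"
      by (rule Bochner_Integration.integral_cnj)
    also have "(LINT t|lborel. g t * iexp (- s * t)) = 0" by (rule zero)
    finally show ?thesis by simp
  qed
  have "AE t in lborel. Re (g t) = 0"
  proof (rule fourier_unique_real)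
    show "integrable lborel (\<lambda>t. Re (g t))" using g by simp
    fix s
    have "(LINT t|lborel. of_real (Re (g t)) * iexp (s * t))
        = (LINT t|lborel. (1 / 2) * (g t * iexp (s * t)) + (1 / 2) * (cnj (g t) * iexp (s * t)))"
    proof (intro Bochner_Integration.integral_cong refl)
      fix t
      have "complex_of_real (Re (g t)) = (1 / 2) * g t + (1 / 2) * cnj (g t)"
        by (simp add: complex_eq_iff)
      then show "of_real (Re (g t)) * iexp (s * t) = (1 / 2) * (g t * iexp (s * t)) + (1 / 2) * (cnj (g t) * iexp (s * t))"
        by (simp only: distrib_right mult.assoc)
    qed
    also have "\<dots> = (1 / 2) * (LINT t|lborel. g t * iexp (s * t)) + (1 / 2) * (LINT t|lborel. cnj (g t) * iexp (s * t))"
      unfolding integral_mult_right_zero[symmetric]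
      by (intro Bochner_Integration.integral_add integrable_mult_right int g gc)
    also have "\<dots> = 0" by (simp only: zero zero') simp
    finally show "(LINT t|lborel. of_real (Re (g t)) * iexp (s * t)) = 0" .
  qed
  moreover have "AE t in lborel. Im (g t) = 0"
  proof (rule fourier_unique_real)
    show "integrable lborel (\<lambda>t. Im (g t))" using g by simp
    fix s
    have "(LINT t|lborel. of_real (Im (g t)) * iexp (s * t))
        = (LINT t|lborel. (- \<i> / 2) * (g t * iexp (s * t)) + (\<i> / 2) * (cnj (g t) * iexp (s * t)))"
    proof (intro Bochner_Integration.integral_cong refl)
      fix t
      have "complex_of_real (Im (g t)) = (- \<i> / 2) * g t + (\<i> / 2) * cnj (g t)"
        by (simp add: complex_eq_iff)
      then show "of_real (Im (g t)) * iexp (s * t) = (- \<i> / 2) * (g t * iexp (s * t)) + (\<i> / 2) * (cnj (g t) * iexp (s * t))"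
        by (simp only: distrib_right mult.assoc)
    qed
    also have "\<dots> = (- \<i> / 2) * (LINT t|lborel. g t * iexp (s * t)) + (\<i> / 2) * (LINT t|lborel. cnj (g t) * iexp (s * t))"
      unfolding integral_mult_right_zero[symmetric]
      by (intro Bochner_Integration.integral_add integrable_mult_right int g gc)
    also have "\<dots> = 0" by (simp only: zero zero') simp
    finally show "(LINT t|lborel. of_real (Im (g t)) * iexp (s * t)) = 0" .
  qed
  ultimately show ?thesis
    by eventually_elim (simp add: complex_eq_iff)
qed

text \<open>The squared Sobolev norm of \<open>hfun n\<close>: its squared L2 norm times the
  eigenvalue. Its reciprocal is the radicand in the normalisation of
  \<open>hermite_system\<close>.\<close>

definition hnorm_sq :: "nat \<Rightarrow> real" where
  "hnorm_sq n = 2 ^ n * fact n / sqrt 2 * sobolev_eigenvalue n"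

lemma sobolev_eigenvalue_pos: "0 < sobolev_eigenvalue n"
  by (simp add: sobolev_eigenvalue_def add_nonneg_pos add_pos_pos)

lemma hnorm_sq_pos: "0 < hnorm_sq n"
  by (simp add: hnorm_sq_def sobolev_eigenvalue_pos)

lemma sobolev_ip_hfun_hfun:
  "fourier_sobolev_ip (hfun n) (hfun m) = (if m = n then of_real (hnorm_sq n) else 0)"
  unfolding sobolev_ip_hfun[OF hfun_in_fourier_sobolev] hfun_orthogonal
  by (simp add: hnorm_sq_def)

lemma hermite_system_eq: "hermite_system n = (\<lambda>x. of_real (1 / sqrt (hnorm_sq n)) * hfun n x)"
proof
  fix x
  have "2 powr (real n - 1 / 2) = 2 ^ n / sqrt 2"
    by (simp add: powr_diff powr_realpow powr_half_sqrt)
  then have "pi / (2 powr (real n - 1 / 2) * fact n * (real n + 2 * pi + 1 / 2)) = 1 / hnorm_sq n"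
    by (simp add: hnorm_sq_def sobolev_eigenvalue_def)
  then show "hermite_system n x = of_real (1 / sqrt (hnorm_sq n)) * hfun n x"
    unfolding hermite_system_def hermite_eq_herm hfun_def of_real_mult
    by (simp only: real_sqrt_divide real_sqrt_one mult.assoc)
qed

lemma hermite_system_in_fourier_sobolev: "hermite_system n \<in> fourier_sobolev"
  unfolding hermite_system_eq by (rule sobolev.scale_closed[OF hfun_in_fourier_sobolev])

lemma sobolev_ip_hermite_system:
  assumes "f \<in> fourier_sobolev"
  shows "fourier_sobolev_ip f (hermite_system n)
    = of_real (sobolev_eigenvalue n / sqrt (hnorm_sq n)) * (LINT x|lborel. f x * hfun n x)"
  unfolding hermite_system_eq sobolev.ip_scale_right[OF hfun_in_fourier_sobolev assms] sobolev_ip_hfun[OF assms]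
  by simp

interpretation hermite: hilbert_orthonormal_seq fourier_sobolev ae_eq fourier_sobolev_ip hermite_system
proof (intro hilbert_orthonormal_seq.intro orthonormal_seq.intro orthonormal_seq_axioms.intro)
  show "pre_hilbert fourier_sobolev ae_eq fourier_sobolev_ip"
    by (rule sobolev.pre_hilbert_axioms)
  show "hilbert_space fourier_sobolev ae_eq fourier_sobolev_ip"
    by (rule hilbert_space_fourier_sobolev)
  show "hermite_system i \<in> fourier_sobolev" for i
    by (rule hermite_system_in_fourier_sobolev)
  show "fourier_sobolev_ip (hermite_system i) (hermite_system j) = (if i = j then 1 else 0)" for i j
  proof -
    have "fourier_sobolev_ip (hermite_system i) (hermite_system j)
        = of_real (1 / sqrt (hnorm_sq i)) * (cnj (of_real (1 / sqrt (hnorm_sq j))) * fourier_sobolev_ip (hfun i) (hfun j))"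
      unfolding hermite_system_eq
      by (simp only: sobolev.ip_scale_left sobolev.ip_scale_right hfun_in_fourier_sobolev sobolev.scale_closed)
    also have "\<dots> = (if i = j then of_real (1 / sqrt (hnorm_sq i) * (1 / sqrt (hnorm_sq i)) * hnorm_sq i) else 0)"
      unfolding sobolev_ip_hfun_hfun by simp (simp flip: of_real_mult)
    also have "1 / sqrt (hnorm_sq i) * (1 / sqrt (hnorm_sq i)) * hnorm_sq i = 1"
      using hnorm_sq_pos[of i] by simp
    finally show ?thesis by simp
  qed
qed

text \<open>Only integrability of f enters: the Gaussian of the Bargmann kernel beats every
  exponential, by c |t| - t^2 / 2 <= c^2 / 2. Term-by-term integration is thereby available for
  every f in the space, without approximation.\<close>

lemma exp_integrable_sobolev:
  assumes f: "f \<in> fourier_sobolev"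
  shows "exp_integrable (\<lambda>t. f (t / sqrt (2 * pi)) * of_real (exp (- (1 / 2) * t\<^sup>2)))"
  unfolding exp_integrable_def
proof (intro conjI allI)
  have int: "integrable lborel f" by (rule fourier_sobolev_integrable[OF f])
  have [measurable]: "f \<in> borel_measurable borel"
    using borel_measurable_integrable[OF int] by simp
  show "(\<lambda>t. f (t / sqrt (2 * pi)) * of_real (exp (- (1 / 2) * t\<^sup>2))) \<in> borel_measurable borel"
    by measurable
  fix c
  show "integrable lborel (\<lambda>t. cmod (f (t / sqrt (2 * pi)) * of_real (exp (- (1 / 2) * t\<^sup>2))) * exp (c * \<bar>t\<bar>))"
  proof (rule Bochner_Integration.integrable_bound)
    show "integrable lborel (\<lambda>t. exp (c\<^sup>2 / 2) *\<^sub>R f (t / sqrt (2 * pi)))"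
      using int integrable_2pi_iff[of f] by (intro integrable_scaleR_right) simp
    show "AE t in lborel. norm (cmod (f (t / sqrt (2 * pi)) * of_real (exp (- (1 / 2) * t\<^sup>2))) * exp (c * \<bar>t\<bar>))
        \<le> norm (exp (c\<^sup>2 / 2) *\<^sub>R f (t / sqrt (2 * pi)))"
    proof (rule AE_I2)
      fix t
      have "0 \<le> (\<bar>t\<bar> - c)\<^sup>2 / 2" by simp
      also have "\<dots> = t\<^sup>2 / 2 - c * \<bar>t\<bar> + c\<^sup>2 / 2"
        by (simp add: power2_diff add_divide_distrib diff_divide_distrib)
      finally have "- (1 / 2) * t\<^sup>2 + c * \<bar>t\<bar> \<le> c\<^sup>2 / 2" by simp
      then have "exp (- (1 / 2) * t\<^sup>2) * exp (c * \<bar>t\<bar>) \<le> exp (c\<^sup>2 / 2)"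
        unfolding exp_add[symmetric] by simp
      then have "cmod (f (t / sqrt (2 * pi))) * (exp (- (1 / 2) * t\<^sup>2) * exp (c * \<bar>t\<bar>)) \<le> cmod (f (t / sqrt (2 * pi))) * exp (c\<^sup>2 / 2)"
        by (rule mult_left_mono) simp
      then show "norm (cmod (f (t / sqrt (2 * pi)) * of_real (exp (- (1 / 2) * t\<^sup>2))) * exp (c * \<bar>t\<bar>))
          \<le> norm (exp (c\<^sup>2 / 2) *\<^sub>R f (t / sqrt (2 * pi)))"
        by (simp add: norm_mult mult_ac)
    qed
  qed measurable
qed

section \<open>Hermite expansion of the Bargmann transform and totality\<close>

lemma bargmann_eq:
  "bargmann f z = of_real (2 powr (1/4) / pi powr (3/2)) *
     (LINT t|lborel. (f (t / sqrt (2 * pi)) * of_real (exp (- (1 / 2) * t\<^sup>2))) * exp (2 * of_real t * z - z\<^sup>2))"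
proof -
  have "exp (2 * of_real t * z - z\<^sup>2 - of_real (t\<^sup>2 / 2)) = of_real (exp (- (1 / 2) * t\<^sup>2)) * exp (2 * of_real t * z - z\<^sup>2)" for t
    unfolding exp_of_real[symmetric] exp_add[symmetric] by (rule arg_cong[where f = exp]) simp
  then show ?thesis
    unfolding bargmann_def by (simp only: mult.assoc)
qed

text \<open>Here the prefactor of the transform and the weight of \<open>B1\<close> are calibrated
  against each other. Both sides are positive and their squares agree, because
  \<open>fock_moment n\<close> contains \<open>sobolev_eigenvalue n\<close> as a factor.\<close>

lemma bargmann_coefficient:
  "2 powr (1/4) / pi powr (3/2) * sqrt (2 * pi) / fact n * sqrt (fock_moment n) = sobolev_eigenvalue n / sqrt (hnorm_sq n)"
proof -
  let ?L = "2 powr (1/4) / pi powr (3/2) * sqrt (2 * pi) / fact n * sqrt (fock_moment n)"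
  let ?l = "sobolev_eigenvalue n"
  have l: "0 < ?l" by (rule sobolev_eigenvalue_pos)
  have fm: "fock_moment n = pi\<^sup>2 * fact n / 2 ^ (n + 1) * ?l"
    by (simp add: fock_moment_def sobolev_eigenvalue_def power2_eq_square)
  have p1: "(2 powr (1/4))\<^sup>2 = sqrt 2"
    unfolding power2_eq_square powr_add[symmetric] by (simp add: powr_half_sqrt)
  have p2: "(pi powr (3/2))\<^sup>2 = pi ^ 3"
    by (simp add: powr_powr flip: powr_numeral)
  have "?L\<^sup>2 = sqrt 2 / pi ^ 3 * (2 * pi) / (fact n)\<^sup>2 * fock_moment n"
    unfolding power_mult_distrib power_divide p1 p2 using fock_moment_pos[of n] by simp
  also have "\<dots> = sqrt 2 / (2 ^ n * fact n) * ?l"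
    unfolding fm by (simp add: power2_eq_square power3_eq_cube field_simps)
  also have "\<dots> = ?l\<^sup>2 / hnorm_sq n"
    unfolding hnorm_sq_def using l by (simp add: power2_eq_square field_simps)
  also have "\<dots> = (?l / sqrt (hnorm_sq n))\<^sup>2"
    using hnorm_sq_pos[of n] by (simp add: power_divide)
  finally show ?thesis
    by (rule power2_eq_imp_eq) (use l hnorm_sq_pos[of n] fock_moment_pos[of n] in \<open>simp_all add: less_imp_le\<close>)
qed

text \<open>The Gaussian of the kernel combines with the Hermite polynomial to
  \<open>hfun n\<close>, so each Taylor coefficient is an L2 pairing, that is, a Sobolev inner
  product up to constants. Convergence is at each point z; norms are treated afterwards.\<close>

lemma bargmann_sums:
  assumes f: "f \<in> fourier_sobolev"
  shows "(\<lambda>n. fourier_sobolev_ip f (hermite_system n) * fock_basis n z) sums bargmann f z"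
proof -
  let ?C = "2 powr (1/4) / pi powr (3/2) :: real"
  let ?g = "\<lambda>t. f (t / sqrt (2 * pi)) * complex_of_real (exp (- (1 / 2) * t\<^sup>2))"
  have "(\<lambda>n. of_real ?C * ((LINT t|lborel. ?g t * of_real (herm n t)) / fact n * z ^ n)) sums bargmann f z"
    unfolding bargmann_eq by (intro sums_mult hermite_interchange exp_integrable_sobolev f)
  moreover have "of_real ?C * ((LINT t|lborel. ?g t * of_real (herm n t)) / fact n * z ^ n)
      = fourier_sobolev_ip f (hermite_system n) * fock_basis n z" for n
  proof -
    let ?I = "LINT x|lborel. f x * hfun n x"
    have "(LINT t|lborel. ?g t * of_real (herm n t)) = (LINT t|lborel. f (t / sqrt (2 * pi)) * hfun n (t / sqrt (2 * pi)))"
      unfolding hfun_scaled by (simp only: of_real_mult mult_ac)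
    also have "\<dots> = of_real (sqrt (2 * pi)) * ?I"
      unfolding LINT_2pi[of "\<lambda>x. f x * hfun n x"] by simp
    finally have "of_real ?C * ((LINT t|lborel. ?g t * of_real (herm n t)) / fact n * z ^ n)
        = of_real (?C * sqrt (2 * pi) / fact n) * ?I * z ^ n"
      by simp
    also have "?C * sqrt (2 * pi) / fact n = sobolev_eigenvalue n / sqrt (hnorm_sq n) / sqrt (fock_moment n)"
      unfolding bargmann_coefficient[symmetric] using fock_moment_pos[of n] by simp
    finally show ?thesis
      unfolding sobolev_ip_hermite_system[OF f] fock_basis_def by simp
  qed
  ultimately show ?thesis by simp
qed

lemma hermite_system_total:
  assumes f: "f \<in> fourier_sobolev" and zero: "\<And>n. fourier_sobolev_ip f (hermite_system n) = 0"
  shows "ae_eq f (\<lambda>x. 0)"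
proof -
  let ?g = "\<lambda>t. f (t / sqrt (2 * pi)) * complex_of_real (exp (- (1 / 2) * t\<^sup>2))"
  have [measurable]: "f \<in> borel_measurable borel"
    using borel_measurable_integrable[OF fourier_sobolev_integrable[OF f]] by simp
  have B0: "bargmann f z = 0" for z
    using bargmann_sums[OF f, of z] sums_unique2[OF _ sums_zero] by (simp add: zero)
  have "AE t in lborel. ?g t = 0"
  proof (rule fourier_unique)
    show "integrable lborel ?g"
      using exp_integrable_sobolev[OF f] by (rule exp_integrable_bound[where K = 1 and c = 0]) auto
    fix s :: real
    \<comment> \<open>This choice makes 2 t z equal to i s t, while -z^2 contributes only a nonzero
      factor independent of t.\<close>
    let ?z = "\<i> * of_real (s / 2)"
    have "?g t * exp (2 * of_real t * ?z - ?z\<^sup>2) = exp (- (?z\<^sup>2)) * (?g t * iexp (s * t))" for t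
    proof -
      have "2 * of_real t * ?z - ?z\<^sup>2 = - (?z\<^sup>2) + \<i> * of_real (s * t)"
        by simp
      then show ?thesis by (simp only: exp_add mult_ac)
    qed
    then have "(LINT t|lborel. ?g t * exp (2 * of_real t * ?z - ?z\<^sup>2)) = exp (- (?z\<^sup>2)) * (LINT t|lborel. ?g t * iexp (s * t))"
      by (simp only: integral_mult_right_zero)
    moreover have "(LINT t|lborel. ?g t * exp (2 * of_real t * ?z - ?z\<^sup>2)) = 0"
    proof -
      have "complex_of_real (2 powr (1/4) / pi powr (3/2)) \<noteq> 0" by simp
      then show ?thesis
        using B0[of ?z] unfolding bargmann_eq mult_eq_0_iff by blast
    qed
    ultimately have "exp (- (?z\<^sup>2)) * (LINT t|lborel. ?g t * iexp (s * t)) = 0"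
      by (simp only:)
    then show "(LINT t|lborel. ?g t * iexp (s * t)) = 0"
      by (simp only: mult_eq_0_iff exp_not_eq_zero simp_thms)
  qed
  then have "AE t in lborel. f (t / sqrt (2 * pi)) = 0"
    by eventually_elim simp
  \<comment> \<open>The dilation by sqrt(2 pi) is undone; it preserves null sets.\<close>
  then have "AE x in lborel. f ((0 + sqrt (2 * pi) * x) / sqrt (2 * pi)) = 0"
    by (intro AE_borel_affine) auto
  then show ?thesis
    by (simp add: ae_eq_def)
qed

text \<open>Membership in \<open>B1\<close> is obtained without its completeness: F is entire as a
  power series, and Fatou applied to differences of partial sums bounds F minus the N-th partial sum
  by the tail \<open>?T N\<close>. The tails tend to 0, which gives Parseval's identity.\<close>

lemma B1_series:
  assumes c: "summable (\<lambda>n. (cmod (c n))\<^sup>2)" and F: "\<And>z. (\<lambda>n. c n * fock_basis n z) sums F z"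
  shows "F \<in> B1" "(B1.nrm F)\<^sup>2 = (\<Sum>n. (cmod (c n))\<^sup>2)"
proof -
  let ?S = "\<lambda>N z. \<Sum>n<N. c n * fock_basis n z"
  let ?T = "\<lambda>N. (\<Sum>n. (cmod (c n))\<^sup>2) - (\<Sum>n<N. (cmod (c n))\<^sup>2)"
  have "F holomorphic_on ball 0 r" for r
  proof (rule power_series_holomorphic)
    show "(\<lambda>n. c n / of_real (sqrt (fock_moment n)) * (z - 0) ^ n) sums F z" for z
      using F[of z] by (simp add: fock_basis_def)
  qed
  then have hol: "F holomorphic_on UNIV"
    by (rule holomorphic_on_balls_imp_entire')
  have SB: "?S N \<in> B1" for N
    by (rule B1.comb_closed)
  have Fm: "F \<in> borel_measurable lborel"
    using holomorphic_borel_measurable[OF hol] by simp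
  have T_bound: "(LINT z|lborel. (cmod (?S M z - ?S N z))\<^sup>2 * B1_weight z) \<le> ?T N" if "N \<le> M" for M N
  proof -
    have "(LINT z|lborel. (cmod (?S M z - ?S N z))\<^sup>2 * B1_weight z) = (B1.nrm (\<lambda>z. \<Sum>n\<in>{N..<M}. c n * fock_basis n z))\<^sup>2"
      unfolding B1.comb_diff[OF that] B1.nrm_sq[OF B1.comb_closed] B1_ip_eq fock.Re_ipw_self ..
    also have "\<dots> = (\<Sum>n\<in>{N..<M}. (cmod (c n))\<^sup>2)"
      by (rule B1.nrm_comb) simp
    also have "\<dots> = (\<Sum>n<M. (cmod (c n))\<^sup>2) - (\<Sum>n<N. (cmod (c n))\<^sup>2)"
      using sum_diff_nat_ivl[of 0 N M "\<lambda>n. (cmod (c n))\<^sup>2"] that by (simp add: atLeast0LessThan)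
    also have "\<dots> \<le> ?T N"
      using sum_le_suminf[OF c, of "{..<M}"] by simp
    finally show ?thesis .
  qed
  have diff: "(\<lambda>z. F z - ?S N z) \<in> L2w lborel B1_weight"
    "(LINT z|lborel. (cmod (F z - ?S N z))\<^sup>2 * B1_weight z) \<le> ?T N" for N
  proof -
    have lim: "AE z in lborel. (\<lambda>M. ?S M z - ?S N z) \<longlonglongrightarrow> F z - ?S N z"
      using F by (intro AE_I2 tendsto_intros) (simp add: sums_def)
    have bd: "\<forall>\<^sub>F M in sequentially. (LINT z|lborel. (cmod (?S M z - ?S N z))\<^sup>2 * B1_weight z) \<le> ?T N"
      using eventually_ge_at_top[of N] by eventually_elim (rule T_bound)
    have SL: "(\<lambda>z. ?S M z - ?S N z) \<in> L2w lborel B1_weight" for M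
      using B1.diff_closed[OF SB SB, of M N] by (simp add: B1_iff)
    have m: "(\<lambda>z. F z - ?S N z) \<in> borel_measurable lborel"
      using SB[of N] Fm by (intro borel_measurable_diff) (auto simp: B1_iff dest: fock.measurableD)
    show "(\<lambda>z. F z - ?S N z) \<in> L2w lborel B1_weight"
      "(LINT z|lborel. (cmod (F z - ?S N z))\<^sup>2 * B1_weight z) \<le> ?T N"
      using fock.Fatou[OF SL m lim bd] by auto
  qed
  \<comment> \<open>At N = 0 the partial sum is empty, so the difference is F itself.\<close>
  show FB: "F \<in> B1"
    using diff(1)[of 0] hol by (simp add: B1_iff)
  have "(\<lambda>N. B1.nrm (\<lambda>z. ?S N z - F z)) \<longlonglongrightarrow> 0"
  proof -
    have le: "B1.nrm (\<lambda>z. ?S N z - F z) \<le> sqrt (?T N)" for N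
    proof -
      have "B1.nrm (\<lambda>z. ?S N z - F z) = B1.nrm (\<lambda>z. F z - ?S N z)"
        by (rule B1.nrm_minus_commute[OF SB FB])
      also have "\<dots> \<le> sqrt (?T N)"
        unfolding ip_norm_def B1_ip_eq fock.Re_ipw_self by (intro real_sqrt_le_mono diff)
      finally show ?thesis .
    qed
    have "?T \<longlonglongrightarrow> (\<Sum>n. (cmod (c n))\<^sup>2) - (\<Sum>n. (cmod (c n))\<^sup>2)"
      by (intro tendsto_intros summable_LIMSEQ c)
    then have "(\<lambda>N. sqrt (?T N)) \<longlonglongrightarrow> 0"
      using tendsto_real_sqrt[of ?T 0] by simp
    then show ?thesis
      by (rule Lim_null_comparison[rotated])
        (intro always_eventually allI, use le B1.nrm_nonneg[OF B1.diff_closed[OF SB FB]] in simp)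
  qed
  from tendsto_power[OF B1.tendsto_nrm[OF SB FB this], of 2]
  have "(\<lambda>N. \<Sum>n<N. (cmod (c n))\<^sup>2) \<longlonglongrightarrow> (B1.nrm F)\<^sup>2"
    by (simp add: B1.nrm_comb)
  then show "(B1.nrm F)\<^sup>2 = (\<Sum>n. (cmod (c n))\<^sup>2)"
    by (simp add: sums_def[symmetric] sums_iff)
qed

section \<open>Linearity, isometry and surjectivity\<close>

lemma bargmann_in_B1: "f \<in> fourier_sobolev \<Longrightarrow> bargmann f \<in> B1"
  by (rule B1_series(1)[OF hermite.Bessel bargmann_sums])

text \<open>Parseval on both sides with the same coefficients: through totality of the Hermite
  system in the Sobolev space, and through \<open>B1_series\<close> in the target.\<close>

lemma nrm_bargmann:
  assumes f: "f \<in> fourier_sobolev"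
  shows "B1.nrm (bargmann f) = sobolev.nrm f"
proof -
  let ?c = "\<lambda>n. fourier_sobolev_ip f (hermite_system n)"
  from tendsto_power[OF sobolev.tendsto_nrm[OF hermite.comb_closed f hermite.expansion[OF hermite_system_total f]], of 2]
  have "(\<lambda>N. \<Sum>n<N. (cmod (?c n))\<^sup>2) \<longlonglongrightarrow> (sobolev.nrm f)\<^sup>2"
    by (simp add: hermite.nrm_comb)
  then have "(sobolev.nrm f)\<^sup>2 = (\<Sum>n. (cmod (?c n))\<^sup>2)"
    by (simp add: sums_def[symmetric] sums_iff)
  also have "\<dots> = (B1.nrm (bargmann f))\<^sup>2"
    by (rule B1_series(2)[symmetric, OF hermite.Bessel[OF f] bargmann_sums[OF f]])
  finally show ?thesis
    using f bargmann_in_B1[OF f] by (intro power2_eq_imp_eq[of "B1.nrm (bargmann f)"]) auto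
qed

text \<open>Additivity is read off the coefficient series, which sidesteps integrability of the
  Bargmann integrand.\<close>

lemma bargmann_add:
  assumes "f \<in> fourier_sobolev" "g \<in> fourier_sobolev"
  shows "bargmann (\<lambda>x. f x + g x) = (\<lambda>z. bargmann f z + bargmann g z)"
proof
  fix z
  from sums_add[OF bargmann_sums[OF assms(1), of z] bargmann_sums[OF assms(2), of z]]
  have "(\<lambda>n. fourier_sobolev_ip (\<lambda>x. f x + g x) (hermite_system n) * fock_basis n z) sums (bargmann f z + bargmann g z)"
    by (simp add: sobolev.ip_add_left assms hermite_system_in_fourier_sobolev distrib_right)
  then show "bargmann (\<lambda>x. f x + g x) z = bargmann f z + bargmann g z"
    by (rule sums_unique2[OF bargmann_sums[OF sobolev.add_closed[OF assms]]])
qed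

lemma bargmann_scale: "bargmann (\<lambda>x. c * f x) = (\<lambda>z. c * bargmann f z)"
proof
  fix z
  show "bargmann (\<lambda>x. c * f x) z = c * bargmann f z"
    unfolding bargmann_def mult.assoc[of c] integral_mult_right_zero by (rule mult.left_commute)
qed

lemma bargmann_diff:
  assumes "f \<in> fourier_sobolev" "g \<in> fourier_sobolev"
  shows "bargmann (\<lambda>x. f x - g x) = (\<lambda>z. bargmann f z - bargmann g z)"
  using bargmann_add[OF assms(1) sobolev.scale_closed[OF assms(2), of "-1"]] bargmann_scale[of "-1" g]
  by simp

text \<open>Polarization in both spaces, with the norms of f + g and of f + i g transported by
  linearity.\<close>

lemma bargmann_ip:
  assumes "f \<in> fourier_sobolev" "g \<in> fourier_sobolev"
  shows "B1_ip (bargmann f) (bargmann g) = fourier_sobolev_ip f g"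
proof -
  have "B1.nrm (\<lambda>z. bargmann f z + c * bargmann g z) = sobolev.nrm (\<lambda>x. f x + c * g x)" for c
    using nrm_bargmann[OF sobolev.add_closed[OF assms(1) sobolev.scale_closed[OF assms(2), of c]]]
    unfolding bargmann_add[OF assms(1) sobolev.scale_closed[OF assms(2)]] bargmann_scale .
  from this[of 1] this[of \<i>] show ?thesis
    unfolding B1.polarization[OF assms[THEN bargmann_in_B1]] sobolev.polarization[OF assms]
    by (simp add: nrm_bargmann assms)
qed

text \<open>Bessel's inequality in \<open>B1\<close> makes the coefficients of F square summable,
  and Riesz-Fischer is applied in the Sobolev space, whose completeness is known. The transform of
  the resulting f equals F at every point because both have the same Taylor series, so totality of
  the monomials is not presupposed.\<close>

lemma bargmann_onto:
  assumes F: "F \<in> B1"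
  shows "\<exists>f\<in>fourier_sobolev. bargmann f = F"
proof -
  define a where "a k = (deriv ^^ k) F 0 / fact k" for k
  have a: "(\<lambda>k. a k * z ^ k) sums F z" for z
  proof -
    have "F holomorphic_on ball 0 (cmod z + 1)"
      using F holomorphic_on_subset by (auto simp: B1_iff)
    from holomorphic_power_series[OF this, of z] show ?thesis
      by (simp add: a_def)
  qed
  obtain f where f: "f \<in> fourier_sobolev" "\<And>k. fourier_sobolev_ip f (hermite_system k) = B1_ip F (fock_basis k)"
    using hermite.Riesz_Fischer[OF B1.Bessel[OF F]] by blast
  have "bargmann f z = F z" for z
  proof (rule sums_unique2)
    show "(\<lambda>k. a k * z ^ k) sums F z" by (rule a)
    have "fourier_sobolev_ip f (hermite_system k) * fock_basis k z = a k * z ^ k" for k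
      unfolding f(2) B1_ip_fock_basis[OF F a] using fock_moment_pos[of k] by (simp add: fock_basis_def)
    then show "(\<lambda>k. a k * z ^ k) sums bargmann f z"
      using bargmann_sums[OF f(1), of z] by simp
  qed
  with f(1) show ?thesis by blast
qed

lemma hilbert_space_B1: "hilbert_space B1 (=) B1_ip"
  by (rule hilbert_space_unitary_image[OF hilbert_space_fourier_sobolev B1.pre_hilbert_axioms
        bargmann_in_B1 bargmann_diff nrm_bargmann bargmann_onto])

theorem theorem4:
  shows "unitary_operator fourier_sobolev ae_eq fourier_sobolev_ip B1 (=) B1_ip bargmann \<and>
         orthonormal_basis fourier_sobolev ae_eq fourier_sobolev_ip hermite_system"
proof
  \<comment> \<open>The transforms differ by an element of norm 0, which in \<open>B1\<close> means
    equality at every point.\<close>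
  have "bargmann f = bargmann g" if "f \<in> fourier_sobolev" "g \<in> fourier_sobolev" "ae_eq f g" for f g
  proof -
    have "B1.nrm (\<lambda>z. bargmann f z - bargmann g z) = 0"
      using nrm_bargmann[OF sobolev.diff_closed[OF that(1,2)]] that(3)
      unfolding bargmann_diff[OF that(1,2)] sobolev.eqv_iff_nrm[OF that(1,2)] by simp
    then show ?thesis
      using B1.eqv_iff_nrm[OF that(1,2)[THEN bargmann_in_B1]] by simp
  qed
  then show "unitary_operator fourier_sobolev ae_eq fourier_sobolev_ip B1 (=) B1_ip bargmann"
    unfolding unitary_operator_def
    by (intro conjI ballI allI impI hilbert_space_fourier_sobolev hilbert_space_B1 bargmann_in_B1
        bargmann_add bargmann_scale bargmann_ip bargmann_onto)
  show "orthonormal_basis fourier_sobolev ae_eq fourier_sobolev_ip hermite_system"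
    by (rule hermite.orthonormal_basisI[OF hermite_system_total])
qed

end
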